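(* Let $g \geqslant 2$ be a fixed integer. There exists an infinite sequence $\mathcal{D} = \{d_i\}_{i=0}^\infty \in \{0,1,\ldots,g-1\}^\infty$ with infinitely many non-zero elements such that $$\varpi_{\mathcal{D},g}(N) \geqslant \left(\frac{1}{\log(12/5)} + o(1)\right)\log N \qquad \text{as } N \to \infty.$$
   Context: For a sequence $\mathcal{D} = \{d_i\}_{i=0}^\infty$ of $g$-ary digits $d_i \in \{0,\ldots,g-1\}$ and an integer $n \geqslant 1$, define $u_{\mathcal{D},g}(n) = \sum_{i=0}^{n-1} d_i g^i$. Let $\varpi_{\mathcal{D},g}(N)$ denote the number of integers $n$ with $1 \leqslant n \leqslant N$ for which $u_{\mathcal{D},g}(n)$ is prime. The term $o(1)$ denotes a quantity tending to $0$ as $N \to \infty$. *)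

theory Defs
  imports Complex_Main "HOL-Computational_Algebra.Primes"
begin

definition digit_trunc :: "(nat \<Rightarrow> nat) \<Rightarrow> nat \<Rightarrow> nat \<Rightarrow> nat" where
  "digit_trunc d g n = (\<Sum>i<n. d i * g ^ i)"

text \<open>
  The count is over lengths \<open>n\<close>: a prime value that is attained at several lengths
  (because of zero digits) is counted once for each of them.
\<close>

definition prime_trunc_count :: "(nat \<Rightarrow> nat) \<Rightarrow> nat \<Rightarrow> nat \<Rightarrow> nat" where
  "prime_trunc_count d g N = card {n \<in> {1..N}. prime (digit_trunc d g n)}"

end

theory Submission
  imports Defs "HOL-Number_Theory.Number_Theory" "HOL-Analysis.Analysis" "HOL-Real_Asymp.Real_Asymp"
begin

text \<open>
  Appending zero digits keeps the truncation equal to the same prime, and every such length is counted.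
  So it suffices to chain primes: given a prime \<open>p < g ^ l\<close>, pad with zeros up to a length \<open>n \<ge> 2 l\<close> and
  continue with a prime \<open>r \<noteq> p\<close>, \<open>r = p\<close> mod \<open>g ^ n\<close>, of at most \<open>exp (n / 4)\<close> digits. The \<open>n - l\<close> lengths
  of the zero block pay for the logarithm of the number of digits of \<open>r\<close>.

  The existence of \<open>r\<close> needs \<open>log r \<le> q powr \<epsilon>\<close> for the moduli \<open>q = g ^ n\<close> only. Weight the primes in the class by
  \<open>log\<^sup>k m / m powr (1 + \<delta>)\<close>, that is, take the \<open>k\<close>-th derivative of \<open>L' / L\<close> at \<open>1 + \<delta>\<close>, with \<open>\<delta>\<close> a small negative power
  of \<open>q\<close> and \<open>k\<close> large but fixed. The principal character contributes about \<open>k! / \<delta> ^ (k + 1)\<close>; the other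
  characters contribute much less as soon as \<open>L(1 + \<delta>, \<psi>)\<close> is not too small, because \<open>L\<close> and its derivatives are
  bounded by powers of \<open>log q\<close>. If \<open>\<psi>\<close> is not real, the lower bound is the 3-4-1 inequality at the real point \<open>1 + \<delta>\<close>.
  A real \<open>\<psi>\<close> mod \<open>g ^ n\<close> has period \<open>4 g\<close>, so only finitely many occur and \<open>L(1, \<psi>) \<noteq> 0\<close> suffices.
\<close>

section \<open>Dirichlet characters\<close>

text \<open>The constant 1 / ln (12/5) lies below 2, and the sequence built here has count at least
  2 ln N for all large N, so the error sequence is simply 0. A zero block on the lengths from l to
  n, with n \<ge> 2 l, pays for 2 ln of the next length as soon as that length is at most exp (n /
  4). The obstacle is the size of the modulus q. A single class receives only a share of about 1 / q
  of the pole, while up to q characters compete with it. With k = 0 this would force 1 / \<delta> >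
  q, and the bound for ln r would exceed q = exp (n ln g), which is too long for every g \<ge> 2.
  For order k each character contributes a (k + 1)-st power, so a gain by the small power t = q powr
  (1 / (k + 1)) inside it becomes a gain by q. Hence 1 / \<delta> may be a fixed power of t, and k
  depends on g alone. What could destroy the argument is a zero of some L very close to 1. For real
  characters this is the problem of Siegel zeros, which disappears because all moduli are powers of
  one base.\<close>

definition dchar :: "nat \<Rightarrow> (nat \<Rightarrow> complex) \<Rightarrow> bool" where
  "dchar q \<psi> \<longleftrightarrow> (\<forall>m n. \<psi> (m * n) = \<psi> m * \<psi> n) \<and> (\<forall>m. \<psi> (m + q) = \<psi> m) \<and>
     (\<forall>m. \<psi> m \<noteq> 0 \<longleftrightarrow> coprime m q)"

definition principal_char :: "nat \<Rightarrow> nat \<Rightarrow> complex" where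
  "principal_char q m = of_bool (coprime m q)"

lemma dchar_mult: "dchar q \<psi> \<Longrightarrow> \<psi> (m * n) = \<psi> m * \<psi> n"
  and dchar_eq_0_iff: "dchar q \<psi> \<Longrightarrow> \<psi> m = 0 \<longleftrightarrow> \<not> coprime m q"
  by (auto simp: dchar_def)

lemma periodic_mod:
  fixes f :: "nat \<Rightarrow> 'a"
  assumes "\<And>m. f (m + q) = f m"
  shows "f (m mod q) = f m"
proof -
  have "f (r + j * q) = f r" for r j
  proof (induction j)
    case (Suc j)
    have "f (r + Suc j * q) = f ((r + j * q) + q)" by (simp add: algebra_simps)
    then show ?case using assms Suc by simp
  qed simp
  from this[of "m mod q" "m div q"] show ?thesis by (simp only: mod_div_mult_eq)
qed

lemma dchar_mod: "dchar q \<psi> \<Longrightarrow> \<psi> (m mod q) = \<psi> m"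
  by (rule periodic_mod) (simp add: dchar_def)

lemma dchar_cong: "dchar q \<psi> \<Longrightarrow> [m = n] (mod q) \<Longrightarrow> \<psi> m = \<psi> n"
  by (metis dchar_mod Cong.cong_def)

lemma dchar_1:
  assumes "dchar q \<psi>"
  shows "\<psi> 1 = 1" "\<psi> (Suc 0) = 1"
proof -
  have "\<psi> (1 * 1) = \<psi> 1 * \<psi> 1" "\<psi> 1 \<noteq> 0"
    using assms unfolding dchar_def by (blast, simp)
  then show "\<psi> 1 = 1" by simp
  then show "\<psi> (Suc 0) = 1" by simp
qed

lemma dchar_power: "dchar q \<psi> \<Longrightarrow> \<psi> (m ^ k) = \<psi> m ^ k"
  by (induction k) (auto simp: dchar_mult dchar_1)

lemma dchar_power_totient:
  assumes "dchar q \<psi>" "coprime m q"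
  shows "\<psi> m ^ totient q = 1"
  using dchar_cong[OF assms(1) euler_theorem[OF assms(2)]]
  by (simp add: dchar_power[OF assms(1)] dchar_1[OF assms(1)])

lemma norm_dchar:
  assumes "dchar q \<psi>" "q > 0" "coprime m q"
  shows "norm (\<psi> m) = 1"
proof -
  have "norm (\<psi> m) ^ totient q = 1"
    using dchar_power_totient[OF assms(1,3)] by (metis norm_one norm_power)
  then show ?thesis using assms(2)
    by (intro power_eq_imp_eq_base[of _ "totient q" 1]) auto
qed

lemma norm_dchar_le: "dchar q \<psi> \<Longrightarrow> q > 0 \<Longrightarrow> norm (\<psi> m) \<le> 1"
  using norm_dchar[of q \<psi> m] dchar_eq_0_iff[of q \<psi> m] by (cases "coprime m q") auto

lemma dchar_principal: "dchar q (principal_char q)"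
proof -
  have "coprime (m + q) q \<longleftrightarrow> coprime m q" for m by (metis coprime_iff_gcd_eq_1 gcd_add1)
  then show ?thesis by (auto simp: dchar_def principal_char_def)
qed

lemma dchar_times: "dchar q \<psi> \<Longrightarrow> dchar q \<phi> \<Longrightarrow> dchar q (\<lambda>m. \<psi> m * \<phi> m)"
  by (auto simp: dchar_def)

text \<open>A character is determined by its values below \<open>q\<close>, and each of these is 0
  or a root of unity of order dividing \<open>totient q\<close>.\<close>

lemma finite_dchar:
  assumes "q > 0"
  shows "finite {\<psi>. dchar q \<psi>}"
proof (rule inj_on_finite)
  let ?V = "insert 0 {z :: complex. z ^ totient q = 1}"
  show "inj_on (\<lambda>\<psi>. restrict \<psi> {..<q}) {\<psi>. dchar q \<psi>}"
  proof (rule inj_onI, rule ext)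
    fix \<psi> \<phi> m assume *: "\<psi> \<in> {\<psi>. dchar q \<psi>}" "\<phi> \<in> {\<psi>. dchar q \<psi>}"
      "restrict \<psi> {..<q} = restrict \<phi> {..<q}"
    have "\<psi> (m mod q) = \<phi> (m mod q)"
      using fun_cong[OF *(3), of "m mod q"] assms by simp
    then show "\<psi> m = \<phi> m" using * by (simp add: dchar_mod)
  qed
  show "(\<lambda>\<psi>. restrict \<psi> {..<q}) ` {\<psi>. dchar q \<psi>} \<subseteq> {..<q} \<rightarrow>\<^sub>E ?V"
    
  proof (intro image_subsetI restrict_PiE_iff[THEN iffD2] ballI)
    fix \<psi> m assume "\<psi> \<in> {\<psi>. dchar q \<psi>}"
    then show "\<psi> m \<in> ?V"
      using dchar_power_totient[of q \<psi> m] dchar_eq_0_iff[of q \<psi> m] by blast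
  qed
  show "finite ({..<q} \<rightarrow>\<^sub>E ?V)"
    using assms by (intro finite_PiE) (auto intro!: finite_roots_unity simp: Suc_le_eq)
qed

text \<open>\<open>H\<close> is a union of residue classes that form a subgroup of the units, so no reduction mod \<open>q\<close> is needed.\<close>

definition partial_char :: "nat \<Rightarrow> nat set \<Rightarrow> (nat \<Rightarrow> complex) \<Rightarrow> bool" where
  "partial_char q H f \<longleftrightarrow> H \<subseteq> {m. coprime m q} \<and> 1 \<in> H \<and>
     (\<forall>x\<in>H. \<forall>y\<in>H. x * y \<in> H \<and> f (x * y) = f x * f y) \<and>
     (\<forall>x\<in>H. \<forall>y. [x = y] (mod q) \<longrightarrow> y \<in> H \<and> f y = f x) \<and> (\<forall>x\<in>H. f x \<noteq> 0)"

lemma partial_charD: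
  assumes "partial_char q H f"
  shows "x \<in> H \<Longrightarrow> coprime x q" "1 \<in> H" "x \<in> H \<Longrightarrow> f x \<noteq> 0"
    and "x \<in> H \<Longrightarrow> y \<in> H \<Longrightarrow> x * y \<in> H" "x \<in> H \<Longrightarrow> y \<in> H \<Longrightarrow> f (x * y) = f x * f y"
    and "x \<in> H \<Longrightarrow> [x = y] (mod q) \<Longrightarrow> y \<in> H" "x \<in> H \<Longrightarrow> [x = y] (mod q) \<Longrightarrow> f y = f x"
  using assms unfolding partial_char_def by blast+

lemma partial_char_power:
  assumes "partial_char q H f" "x \<in> H"
  shows "x ^ k \<in> H \<and> f (x ^ k) = f x ^ k"
proof (induction k)
  case 0
  have "f (1 * 1) = f 1 * f 1" "f 1 \<noteq> 0" "1 \<in> H" using partial_charD[OF assms(1)] by blast+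
  then show ?case by simp
next
  case (Suc k)
  then show ?case using assms partial_charD(4,5)[OF assms(1)] by simp
qed

text \<open>Euler's theorem makes \<open>x ^ (totient q - 1)\<close> an inverse of \<open>x\<close>
  that is again in \<open>H\<close>.\<close>

lemma partial_char_cancel:
  assumes pc: "partial_char q H f" and q: "q > 0" and "x \<in> H" "x * y \<in> H"
  shows "y \<in> H"
proof -
  have "coprime x q" using partial_charD(1)[OF pc] assms by blast
  then have *: "[x ^ totient q = 1] (mod q)" by (rule euler_theorem)
  have "x ^ (totient q - 1) * (x * y) \<in> H"
    using partial_char_power[OF pc \<open>x \<in> H\<close>] partial_charD(4)[OF pc _ assms(4)] by blast
  also have "x ^ (totient q - 1) * (x * y) = x ^ totient q * y"
    using q by (cases "totient q") (auto simp: algebra_simps)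
  finally have "x ^ totient q * y \<in> H" .
  moreover have "[x ^ totient q * y = 1 * y] (mod q)"
    using * by (rule cong_mult) simp
  ultimately show ?thesis using partial_charD(6)[OF pc] by (metis mult_1)
qed

text \<open>Adjoins \<open>x\<close> to \<open>H\<close>: the new group consists of the classes of
  \<open>h * x ^ i\<close>, and such a class is sent to \<open>f h * w ^ i\<close>. As
  \<open>k\<close> is the order of \<open>x\<close> modulo \<open>H\<close>, the only relation to
  respect is the one at \<open>x ^ k\<close>, which is the condition on \<open>w\<close>.\<close>

lemma partial_char_extend:
  assumes pc: "partial_char q H f" and q: "q > 0" and x: "coprime x q"
    and k: "k > 0" "x ^ k \<in> H" "\<And>j. 0 < j \<Longrightarrow> j < k \<Longrightarrow> x ^ j \<notin> H" and w: "w ^ k = f (x ^ k)"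
  obtains H' f' where "partial_char q H' f'" "H \<subseteq> H'" "x \<in> H'" "f' x = w"
    "\<And>y. y \<in> H \<Longrightarrow> f' y = f y"
proof -
  have copr: "coprime h q" if "h \<in> H" for h using that partial_charD(1)[OF pc] by blast
  have one: "1 \<in> H" "f 1 = 1"
    using partial_charD(2)[OF pc] partial_char_power[OF pc, of 1 0] by simp_all
  have mult: "h * h' \<in> H" "f (h * h') = f h * f h'" if "h \<in> H" "h' \<in> H" for h h'
    using that partial_charD(4,5)[OF pc] by blast+
  have congr: "h' \<in> H" "f h' = f h" if "h \<in> H" "[h = h'] (mod q)" for h h'
    using that partial_charD(6,7)[OF pc] by blast+
  have w0: "w \<noteq> 0"
    using k(1) w partial_charD(3)[OF pc k(2)] by (metis power_0_left less_not_refl2)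
  \<comment> \<open>Reduce the exponent modulo \<open>k\<close>; a nonzero remainder would
    contradict the minimality of \<open>k\<close>.\<close>
  have kdvd: "k dvd j" if "x ^ j \<in> H" for j
  proof -
    have "(x ^ k) ^ (j div k) * x ^ (j mod k) = x ^ j"
      by (metis mult_div_mod_eq power_add power_mult)
    then have "x ^ (j mod k) \<in> H"
      using partial_char_cancel[OF pc q] partial_char_power[OF pc k(2)] that by metis
    then show ?thesis
      using k(3)[of "j mod k"] k(1) by (metis mod_less_divisor mod_0_imp_dvd neq0_conv)
  qed
  \<comment> \<open>Well-definedness: cancelling \<open>x ^ i\<close> leaves \<open>h\<close>
    congruent to \<open>h' * x ^ (j - i)\<close>, so \<open>x ^ (j - i)\<close> is in
    \<open>H\<close> and is a power of \<open>x ^ k\<close>.\<close>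
  have wd': "f h * w ^ i = f h' * w ^ j"
    if "h \<in> H" "h' \<in> H" "[h * x ^ i = h' * x ^ j] (mod q)" "i \<le> j" for h h' i j
  proof -
    have "h' * x ^ j = h' * x ^ (j - i) * x ^ i" using that(4) by (simp flip: power_add)
    then have c: "[h = h' * x ^ (j - i)] (mod q)"
      using that(3) x by (metis cong_mult_rcancel_nat coprime_power_left_iff coprime_commute)
    then have "x ^ (j - i) \<in> H" using congr(1)[OF that(1)] partial_char_cancel[OF pc q that(2)] by blast
    moreover from this obtain d where d: "j - i = k * d" using kdvd by blast
    ultimately have "f (h' * x ^ (j - i)) = f h' * w ^ (j - i)"
      using mult[OF that(2)] partial_char_power[OF pc k(2), of d] w by (simp add: power_mult)
    then show ?thesis using congr(2)[OF that(1) c] that(4) by (simp flip: power_add)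
  qed
  have wd: "f h * w ^ i = f h' * w ^ j"
    if "h \<in> H" "h' \<in> H" "[h * x ^ i = h' * x ^ j] (mod q)" for h h' i j
    using wd'[of h h' i j] wd'[of h' h j i] that by (metis cong_sym nle_le)
  define H' where "H' = {y. \<exists>h\<in>H. \<exists>i. [y = h * x ^ i] (mod q)}"
  \<comment> \<open>A class has many representations \<open>h * x ^ i\<close>; one is picked, and
    \<open>wd\<close> makes the choice irrelevant.\<close>
  define f' where "f' y = (SOME v. \<exists>h\<in>H. \<exists>i. [y = h * x ^ i] (mod q) \<and> v = f h * w ^ i)" for y
  have f': "f' y = f h * w ^ i" if "h \<in> H" "[y = h * x ^ i] (mod q)" for y h i
  proof -
    have "\<exists>v. \<exists>h\<in>H. \<exists>i. [y = h * x ^ i] (mod q) \<and> v = f h * w ^ i" using that by blast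
    from someI_ex[OF this, folded f'_def] obtain h' j
      where "h' \<in> H" "[y = h' * x ^ j] (mod q)" "f' y = f h' * w ^ j" by blast
    moreover have "[h * x ^ i = h' * x ^ j] (mod q)"
      using that calculation by (meson cong_sym cong_trans)
    ultimately show ?thesis using wd that by metis
  qed
  have "partial_char q H' f'"
    unfolding partial_char_def
  proof (intro conjI ballI allI impI)
    show "H' \<subseteq> {m. coprime m q}"
    proof
      fix y assume "y \<in> H'"
      then obtain h i where "h \<in> H" "[h * x ^ i = y] (mod q)" unfolding H'_def by (blast dest: cong_sym)
      moreover have "coprime (h * x ^ i) q" using copr[OF \<open>h \<in> H\<close>] x by simp
      ultimately have "coprime y q" by (metis cong_imp_coprime)
      then show "y \<in> {m. coprime m q}" by simp
    qed
    have "[1 = 1 * x ^ 0] (mod q)" by simp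
    then show "1 \<in> H'" using one unfolding H'_def by blast
  next
    fix y z assume "y \<in> H'" "z \<in> H'"
    then obtain h i h' j where *: "h \<in> H" "h' \<in> H" "[y = h * x ^ i] (mod q)" "[z = h' * x ^ j] (mod q)"
      unfolding H'_def by blast
    have c: "[y * z = (h * h') * x ^ (i + j)] (mod q)"
      using cong_mult[OF *(3,4)] by (simp add: power_add mult_ac)
    with mult[OF *(1,2)] show "y * z \<in> H'" unfolding H'_def by blast
    show "f' (y * z) = f' y * f' z"
      using f'[OF mult(1)[OF *(1,2)] c] f'[OF *(1,3)] f'[OF *(2,4)] mult[OF *(1,2)]
      by (simp add: power_add mult_ac)
  next
    fix y z assume "y \<in> H'" "[y = z] (mod q)"
    then obtain h i where *: "h \<in> H" "[y = h * x ^ i] (mod q)" unfolding H'_def by blast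
    with \<open>[y = z] (mod q)\<close> have **: "[z = h * x ^ i] (mod q)" by (meson cong_sym cong_trans)
    show "z \<in> H'" using * ** unfolding H'_def by blast
    show "f' z = f' y" using f'[OF *] f'[OF *(1) **] by simp
  next
    fix y assume "y \<in> H'"
    then obtain h i where *: "h \<in> H" "[y = h * x ^ i] (mod q)" unfolding H'_def by blast
    show "f' y \<noteq> 0" using f'[OF *] w0 partial_charD(3)[OF pc *(1)] by simp
  qed
  moreover have "y \<in> H'" "f' y = f y" if "y \<in> H" for y
    using that f'[of y y 0] unfolding H'_def by (auto intro!: bexI[of _ y] exI[of _ 0])
  moreover have "x \<in> H'" "f' x = w"
    using one f'[of 1 x 1] unfolding H'_def by (auto intro!: bexI[of _ 1] exI[of _ 1])
  ultimately show ?thesis using that by blast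
qed

text \<open>Adjoin one unit at a time; the required value is a complex root, so it always exists.
  The set \<open>H\<close> is infinite, so progress is measured by the residues below
  \<open>q\<close> that it misses.\<close>

lemma partial_char_extend_total:
  assumes "partial_char q H f" and q: "q > 0"
  obtains f' where "partial_char q {m. coprime m q} f'" "\<And>y. y \<in> H \<Longrightarrow> f' y = f y"
  using assms(1)
proof (induction "card ({..<q} - H)" arbitrary: H f thesis rule: less_induct)
  case less
  show ?case
  proof (cases "H = {m. coprime m q}")
    case True
    then show ?thesis using less.prems by auto
  next
    case False
    then obtain x where x: "coprime x q" "x \<notin> H" using partial_charD(1)[OF less.prems(2)] by blast
    define k where "k = (LEAST k. 0 < k \<and> x ^ k \<in> H)"
    have "[1 = x ^ totient q] (mod q)" using euler_theorem[OF x(1)] by (rule cong_sym)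
    then have "0 < totient q \<and> x ^ totient q \<in> H"
      using partial_charD(6)[OF less.prems(2) partial_charD(2)[OF less.prems(2)]] q by simp
    then have k: "0 < k \<and> x ^ k \<in> H" unfolding k_def by (rule LeastI)
    have k': "x ^ j \<notin> H" if "0 < j" "j < k" for j using not_less_Least[of j] that unfolding k_def by blast
    obtain w where w: "w ^ k = f (x ^ k)"
      using k by (metis exists_complex_root neq0_conv)
    obtain H' f' where *: "partial_char q H' f'" "H \<subseteq> H'" "x \<in> H'" "\<And>y. y \<in> H \<Longrightarrow> f' y = f y"
      using partial_char_extend[where k = k and w = w, OF less.prems(2) q x(1)] k k' w by metis
    \<comment> \<open>The measure sees only residues below \<open>q\<close>, hence the passage from
      \<open>x\<close> to its reduced representative.\<close>
    have "x mod q \<notin> H" "x mod q \<in> H'"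
      using x(2) *(3) partial_charD(6)[OF less.prems(2), of "x mod q" x] partial_charD(6)[OF *(1), of x "x mod q"]
      by (auto simp: Cong.cong_def)
    then have "{..<q} - H' \<subset> {..<q} - H" using *(2) q by auto
    then have "card ({..<q} - H') < card ({..<q} - H)" by (intro psubset_card_mono) auto
    from less.hyps[OF this _ *(1)] obtain f'' where
      "partial_char q {m. coprime m q} f''" "\<And>y. y \<in> H' \<Longrightarrow> f'' y = f' y" by metis
    then show ?thesis using less.prems(1) * by (metis subsetD)
  qed
qed

text \<open>The trivial character on the class of 1 is extended to \<open>a\<close> first. The order
  \<open>k\<close> of \<open>a\<close> is at least 2, so a primitive \<open>k\<close>-th root of
  unity is an admissible value other than 1, and the further extension to all units keeps
  it.\<close>

lemma dchar_separates:
  assumes q: "q > 0" and a: "coprime a q" "\<not> [a = 1] (mod q)"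
  obtains \<psi> where "dchar q \<psi>" "\<psi> a \<noteq> 1"
proof -
  let ?H = "{m. [m = 1] (mod q)}"
  have pc: "partial_char q ?H (\<lambda>_. 1)"
    unfolding partial_char_def
  proof (intro conjI ballI allI impI)
    show "?H \<subseteq> {m. coprime m q}" using cong_imp_coprime[OF cong_sym] by fastforce
    show "x * y \<in> ?H" if "x \<in> ?H" "y \<in> ?H" for x y using that cong_mult[of x 1 q y 1] by simp
    show "y \<in> ?H" if "x \<in> ?H" "[x = y] (mod q)" for x y
      using that by (metis mem_Collect_eq cong_sym cong_trans)
  qed auto
  define k where "k = (LEAST k. 0 < k \<and> a ^ k \<in> ?H)"
  have "0 < totient q \<and> a ^ totient q \<in> ?H" using euler_theorem[OF a(1)] q by simp
  then have k: "0 < k \<and> a ^ k \<in> ?H" unfolding k_def by (rule LeastI)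
  have k': "a ^ j \<notin> ?H" if "0 < j" "j < k" for j using not_less_Least[of j] that unfolding k_def by blast
  have "k \<noteq> 1" using k a(2) by auto
  then have k2: "k \<ge> 2" using k by simp
  define w where "w = cis (2 * pi / k)"
  have "w ^ k = cis (real k * (2 * pi / k))" unfolding w_def by (rule Complex.DeMoivre)
  then have w: "w ^ k = 1" using k2 by simp
  have "w \<noteq> 1"
  proof
    assume "w = 1"
    then have "cos (2 * pi / k) = 1" by (simp add: w_def cis.ctr complex_eq_iff)
    then obtain n :: int where "2 * pi / k = n * 2 * pi" by (auto simp: cos_one_2pi_int)
    then have "real_of_int n * k = 1" using k by (simp add: field_simps)
    then have "n * int k = 1" by (metis of_int_eq_1_iff of_int_mult of_int_of_nat_eq)
    then show False using k2 by (simp add: zmult_eq_1_iff)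
  qed
  obtain H' f' where *: "partial_char q H' f'" "a \<in> H'" "f' a = w"
    using partial_char_extend[where k = k and w = w, OF pc q a(1)] k k' w by metis
  obtain f where f: "partial_char q {m. coprime m q} f" "f a = w"
    using partial_char_extend_total[OF *(1) q] * by metis
  define \<psi> where "\<psi> m = (if coprime m q then f m else 0)" for m
  have [simp]: "[m + q = m] (mod q)" for m by (simp add: Cong.cong_def)
  have "dchar q \<psi>"
    unfolding dchar_def
  proof (intro conjI allI)
    fix m n
    show "\<psi> (m * n) = \<psi> m * \<psi> n" using partial_charD(5)[OF f(1), of m n] unfolding \<psi>_def by simp
    have c: "coprime (m + q) q \<longleftrightarrow> coprime m q" by (metis coprime_iff_gcd_eq_1 gcd_add1)
    then show "\<psi> (m + q) = \<psi> m"
      using partial_charD(7)[OF f(1), of m "m + q"] cong_sym[of "m + q" m q] unfolding \<psi>_def by simp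
    show "\<psi> m \<noteq> 0 \<longleftrightarrow> coprime m q" using partial_charD(3)[OF f(1), of m] unfolding \<psi>_def by simp
  qed
  moreover have "\<psi> a \<noteq> 1" using f a \<open>w \<noteq> 1\<close> by (simp add: \<psi>_def)
  ultimately show ?thesis using that by blast
qed

section \<open>Orthogonality relations\<close>

lemma sum_dchar_shift:
  assumes "dchar q \<psi>" "q > 0" "coprime a q"
  shows "(\<Sum>m<q. \<psi> (a * m)) = (\<Sum>m<q. \<psi> m)"
proof -
  have inj: "inj_on (\<lambda>m. a * m mod q) {..<q}"
  proof (rule inj_onI)
    fix x y assume *: "x \<in> {..<q}" "y \<in> {..<q}" "a * x mod q = a * y mod q"
    then have "[x = y] (mod q)" using assms(3) by (metis Cong.cong_def cong_mult_lcancel_nat coprime_commute)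
    then show "x = y" using * by (simp add: Cong.cong_def)
  qed
  have "(\<lambda>m. a * m mod q) ` {..<q} = {..<q}"
    using assms inj by (intro endo_inj_surj) auto
  then have "(\<Sum>m<q. \<psi> m) = (\<Sum>m\<in>(\<lambda>m. a * m mod q) ` {..<q}. \<psi> m)" by simp
  also have "\<dots> = (\<Sum>m<q. \<psi> (a * m))"
    using inj assms by (subst sum.reindex) (auto simp: dchar_mod)
  finally show ?thesis by simp
qed

lemma sum_dchar_eq_0:
  assumes "dchar q \<psi>" "q > 0" "\<psi> \<noteq> principal_char q"
  shows "(\<Sum>m<q. \<psi> m) = 0"
proof -
  obtain a where a: "\<psi> a \<noteq> principal_char q a" using assms by blast
  then have "coprime a q" "\<psi> a \<noteq> 1"
    using dchar_eq_0_iff[OF assms(1), of a] by (auto simp: principal_char_def split: if_splits)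
  then have "\<psi> a * (\<Sum>m<q. \<psi> m) = (\<Sum>m<q. \<psi> m)"
    using sum_dchar_shift[OF assms(1,2)] by (simp add: sum_distrib_left dchar_mult[OF assms(1)])
  then show ?thesis using \<open>\<psi> a \<noteq> 1\<close> by simp
qed

text \<open>Multiplication by a character \<open>\<phi>\<close> with
  \<open>\<phi> a \<noteq> 1\<close> permutes the characters and multiplies the sum by
  \<open>\<phi> a\<close>.\<close>

lemma sum_over_dchars:
  assumes "q > 0"
  shows "(\<Sum>\<psi> | dchar q \<psi>. \<psi> a) =
    (if [a = 1] (mod q) then of_nat (card {\<psi>. dchar q \<psi>}) else 0)"
proof (cases "[a = 1] (mod q)")
  case True
  then have "\<psi> a = 1" if "dchar q \<psi>" for \<psi> using dchar_cong[OF that True] dchar_1[OF that] by simp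
  then have "(\<Sum>\<psi> | dchar q \<psi>. \<psi> a) = (\<Sum>\<psi> | dchar q \<psi>. 1)" by (intro sum.cong) auto
  then show ?thesis using True by simp
next
  case False
  show ?thesis
  proof (cases "coprime a q")
    case True
    obtain \<phi> where \<phi>: "dchar q \<phi>" "\<phi> a \<noteq> 1" using dchar_separates assms True False by metis
    \<comment> \<open>All characters mod \<open>q\<close> vanish at the same arguments, so
      \<open>\<phi>\<close> can be cancelled pointwise.\<close>
    have inj: "inj_on (\<lambda>\<psi> m. \<phi> m * \<psi> m) {\<psi>. dchar q \<psi>}"
    proof (rule inj_onI, rule ext)
      fix \<psi> \<psi>' m assume *: "\<psi> \<in> {\<psi>. dchar q \<psi>}" "\<psi>' \<in> {\<psi>. dchar q \<psi>}"
        "(\<lambda>m. \<phi> m * \<psi> m) = (\<lambda>m. \<phi> m * \<psi>' m)"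
      then have "\<phi> m * \<psi> m = \<phi> m * \<psi>' m" by meson
      then show "\<psi> m = \<psi>' m"
        using dchar_eq_0_iff[OF \<phi>(1), of m] dchar_eq_0_iff[of q \<psi> m] dchar_eq_0_iff[of q \<psi>' m] *
        by (cases "coprime m q") auto
    qed
    have "(\<lambda>\<psi> m. \<phi> m * \<psi> m) ` {\<psi>. dchar q \<psi>} = {\<psi>. dchar q \<psi>}"
      using inj finite_dchar[OF assms] dchar_times[OF \<phi>(1)] by (intro endo_inj_surj) auto
    then have "(\<Sum>\<psi> | dchar q \<psi>. \<psi> a) = (\<Sum>\<psi>\<in>(\<lambda>\<psi> m. \<phi> m * \<psi> m) ` {\<psi>. dchar q \<psi>}. \<psi> a)" by simp
    also have "\<dots> = \<phi> a * (\<Sum>\<psi> | dchar q \<psi>. \<psi> a)"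
      using inj by (subst sum.reindex) (auto simp: sum_distrib_left)
    finally show ?thesis using \<phi> False by simp
  next
    case False
    then show ?thesis using \<open>\<not> [a = 1] (mod q)\<close> dchar_eq_0_iff[of q _ a] by (auto intro!: sum.neutral)
  qed
qed

text \<open>The conjugate of \<open>\<psi> a\<close> is the value of \<open>\<psi>\<close> at an
  inverse \<open>b\<close> of \<open>a\<close>, which turns the sum into that of
  \<open>\<psi> (b * m)\<close>.\<close>

lemma dchar_orthogonality:
  assumes "q > 0" "coprime a q"
  shows "(\<Sum>\<psi> | dchar q \<psi>. cnj (\<psi> a) * \<psi> m) =
    (if [m = a] (mod q) then of_nat (card {\<psi>. dchar q \<psi>}) else 0)"
proof -
  obtain b where b: "[a * b = 1] (mod q)" using cong_solve_coprime_nat[OF assms(2)] by auto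
  then have "coprime b q" by (metis cong_imp_coprime cong_sym coprime_1_left coprime_mult_left_iff)
  have "cnj (\<psi> a) = \<psi> b" if "dchar q \<psi>" for \<psi>
  proof -
    have "\<psi> a * \<psi> b = 1" using dchar_cong[OF that b] by (simp add: dchar_mult[OF that] dchar_1[OF that])
    moreover have "\<psi> a * cnj (\<psi> a) = 1"
      using norm_dchar[OF that assms] by (simp add: complex_norm_square[symmetric])
    ultimately show ?thesis by (metis mult_cancel_left mult_zero_left zero_neq_one)
  qed
  then have "(\<Sum>\<psi> | dchar q \<psi>. cnj (\<psi> a) * \<psi> m) = (\<Sum>\<psi> | dchar q \<psi>. \<psi> (b * m))"
    by (intro sum.cong) (auto simp: dchar_mult)
  also have "[b * m = 1] (mod q) \<longleftrightarrow> [m = a] (mod q)"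
  proof -
    have "[b * m = 1] (mod q) \<longleftrightarrow> [b * m = a * b] (mod q)" using b by (meson cong_sym cong_trans)
    also have "\<dots> \<longleftrightarrow> [m = a] (mod q)"
      using \<open>coprime b q\<close> by (metis cong_mult_lcancel_nat coprime_commute mult.commute)
    finally show ?thesis .
  qed
  ultimately show ?thesis using sum_over_dchars[OF assms(1), of "b * m"] by simp
qed

lemma card_dchar_le:
  assumes "q > 1"
  shows "card {\<psi>. dchar q \<psi>} > 0" "card {\<psi>. dchar q \<psi>} \<le> q"
proof -
  have fin: "finite {\<psi>. dchar q \<psi>}" using assms by (intro finite_dchar) auto
  then show "card {\<psi>. dchar q \<psi>} > 0" using dchar_principal[of q] by (auto simp: card_gt_0_iff)
  \<comment> \<open>Double counting: summed over characters first, only the residue 1 survives (here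
    \<open>q > 1\<close> matters); summed over residues first, only the principal character
    does.\<close>
  have "complex_of_nat (card {\<psi>. dchar q \<psi>}) = (\<Sum>m<q. \<Sum>\<psi> | dchar q \<psi>. \<psi> m)"
  proof -
    have "(\<Sum>m<q. \<Sum>\<psi> | dchar q \<psi>. \<psi> m) =
        (\<Sum>m<q. if m = 1 then of_nat (card {\<psi>. dchar q \<psi>}) else 0)"
      using assms by (intro sum.cong) (auto simp: sum_over_dchars Cong.cong_def)
    then show ?thesis using assms by simp
  qed
  also have "\<dots> = (\<Sum>\<psi> | dchar q \<psi>. \<Sum>m<q. \<psi> m)" by (rule sum.swap)
  also have "\<dots> = (\<Sum>\<psi>\<in>{principal_char q}. \<Sum>m<q. \<psi> m)"
    using fin dchar_principal[of q] assms sum_dchar_eq_0 by (intro sum.mono_neutral_right) auto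
  also have "\<dots> = (\<Sum>m<q. principal_char q m)" by simp
  finally have "real (card {\<psi>. dchar q \<psi>}) = norm (\<Sum>m<q. principal_char q m)"
    by (metis norm_of_nat)
  also have "\<dots> \<le> (\<Sum>m<q. 1)" by (intro sum_norm_le) (auto simp: principal_char_def)
  finally show "card {\<psi>. dchar q \<psi>} \<le> q" by simp
qed

section \<open>Dirichlet series with logarithmic weights\<close>

text \<open>Up to sign, \<open>wt k \<delta> x\<close> is the \<open>k\<close>-th derivative in \<open>s\<close> of \<open>x powr (- s)\<close> at \<open>s = 1 + \<delta>\<close>.
  Since \<open>0 powr y = 0\<close>, sums over all naturals ignore \<open>m = 0\<close>.\<close>

definition wt :: "nat \<Rightarrow> real \<Rightarrow> real \<Rightarrow> real" where
  "wt k \<delta> x = ln x ^ k * x powr (-1 - \<delta>)"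

lemma wt_nonneg: "wt k \<delta> (real m) \<ge> 0"
  by (cases "m = 0") (auto simp: wt_def)

lemma wt_0 [simp]: "wt k \<delta> 0 = 0"
  by (simp add: wt_def)

text \<open>In the variable u = ln x the weight is u ^ k exp (- (1 + \<delta>) u), which decreases
  from u = k on. The threshold does not depend on \<delta>, which keeps the later tail bounds
  uniform.\<close>

lemma wt_antimono:
  assumes "real k \<le> ln x" "1 \<le> x" "x \<le> y" "\<delta> \<ge> 0"
  shows "wt k \<delta> y \<le> wt k \<delta> x"
proof -
  define u v where "u = ln x" and "v = ln y"
  have uv: "u \<le> v" "0 \<le> u" "real k \<le> u" using assms by (auto simp: u_def v_def)
  have *: "v ^ k \<le> u ^ k * exp (v - u)"
  proof (cases "k = 0")
    case False
    then have "u > 0" using uv by linarith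
    have "v / u \<le> exp ((v - u) / u)"
      using exp_ge_add_one_self[of "(v - u) / u"] \<open>u > 0\<close> by (simp add: field_simps)
    then have "(v / u) ^ k \<le> exp ((v - u) / u) ^ k" using \<open>u > 0\<close> uv by (intro power_mono) auto
    also have "\<dots> = exp (real k * ((v - u) / u))" by (rule exp_of_nat_mult[symmetric])
    also have "\<dots> \<le> exp (v - u)"
    proof -
      have "real k * (v - u) \<le> u * (v - u)" using uv by (intro mult_right_mono) auto
      then show ?thesis using \<open>u > 0\<close> by (simp add: field_simps)
    qed
    finally show ?thesis using \<open>u > 0\<close> by (simp add: power_divide field_simps)
  qed (use uv in auto)
  have "wt k \<delta> y = v ^ k * exp ((-1 - \<delta>) * v)" using assms by (simp add: wt_def v_def powr_def)
  also have "\<dots> \<le> u ^ k * exp (v - u) * exp ((-1 - \<delta>) * v)" using * by (intro mult_right_mono) auto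
  also have "\<dots> = u ^ k * exp (- u - \<delta> * v)" by (simp add: mult.assoc flip: exp_add) (simp add: algebra_simps)
  also have "\<dots> \<le> u ^ k * exp (- u - \<delta> * u)"
    using uv assms by (intro mult_left_mono) (auto intro: mult_left_mono)
  also have "\<dots> = wt k \<delta> x" using assms by (simp add: wt_def u_def powr_def algebra_simps)
  finally show ?thesis .
qed

lemma wt_le_ln_power:
  assumes "\<delta> \<ge> 0" "m \<ge> 1"
  shows "wt k \<delta> (real m) \<le> ln (real m) ^ k / real m"
proof -
  have "real m powr (-1 - \<delta>) \<le> real m powr (-1)" using assms by (intro powr_mono) auto
  also have "\<dots> = 1 / real m" using assms by (simp add: powr_minus_divide)
  finally show ?thesis using assms mult_left_mono[of _ "1 / real m" "ln (real m) ^ k"]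
    by (simp add: wt_def)
qed

lemma summable_wt:
  assumes "\<delta> > 0"
  shows "summable (\<lambda>m. wt k \<delta> (real m))"
proof (rule summable_comparison_test_bigo)
  show "summable (\<lambda>m. norm (real m powr (-1 - \<delta> / 2)))"
    using assms by (simp add: summable_real_powr_iff)
  show "(\<lambda>m. wt k \<delta> (real m)) \<in> O(\<lambda>m. real m powr (-1 - \<delta> / 2))"
    unfolding wt_def using assms by real_asymp
qed

text \<open>Abel summation: the differences of the weights are nonnegative and telescope, so only
  the first weight is left.\<close>

lemma norm_sum_abel:
  fixes a :: "nat \<Rightarrow> complex"
  assumes B: "\<And>K. norm (\<Sum>m=N..<K. a m) \<le> B"
    and f: "\<And>m. m \<ge> N \<Longrightarrow> 0 \<le> f m" "\<And>m. m \<ge> N \<Longrightarrow> f (Suc m) \<le> f m"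
  shows "norm (\<Sum>m=N..<K. a m * of_real (f m)) \<le> B * f N"
proof (cases "N \<le> K")
  case True
  define T where "T j = (\<Sum>m=N..<j. a m)" for j
  have "(\<Sum>m=N..<K. a m * of_real (f m)) =
     T K * of_real (f K) + (\<Sum>m=N..<K. T (Suc m) * of_real (f m - f (Suc m)))"
    using True
  proof (induction K rule: dec_induct)
    case base
    then show ?case by (simp add: T_def)
  next
    case (step n)
    have "T (Suc n) = T n + a n" using step.hyps by (simp add: T_def)
    then show ?case using step by (simp add: algebra_simps)
  qed
  also have "norm \<dots> \<le> B * f K + (\<Sum>m=N..<K. B * (f m - f (Suc m)))"
  proof (intro norm_triangle_le add_mono sum_norm_le)
    show "norm (T K * of_real (f K)) \<le> B * f K"
      using B f(1)[OF True] by (auto simp: norm_mult T_def intro!: mult_right_mono)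
    show "norm (T (Suc m) * of_real (f m - f (Suc m))) \<le> B * (f m - f (Suc m))" if "m \<in> {N..<K}" for m
      using B[of "Suc m"] f(2)[of m] that mult_right_mono[of "norm (T (Suc m))" B "f m - f (Suc m)"]
      by (simp add: norm_mult T_def flip: of_real_diff)
  qed
  also have "(\<Sum>m=N..<K. B * (f m - f (Suc m))) = B * (f N - f K)"
  proof -
    have "(\<Sum>m=N..<K. f m - f (Suc m)) = f N - f K"
      using sum_Suc_diff'[OF True, of f] by (simp add: sum_subtractf)
    then show ?thesis by (simp only: sum_distrib_left[symmetric])
  qed
  finally show ?thesis by (simp add: algebra_simps)
next
  case False
  have "0 \<le> B" using B[of N] by simp
  then show ?thesis using False f by simp
qed

text \<open>Every window of \<open>q\<close> consecutive terms sums to 0, wherever it starts, so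
  windows can be removed from the front until fewer than \<open>q\<close> terms remain.\<close>

lemma norm_sum_periodic_le:
  fixes a :: "nat \<Rightarrow> complex"
  assumes per: "\<And>m. a (m + q) = a m" and z: "(\<Sum>m<q. a m) = 0" and le: "\<And>m. norm (a m) \<le> 1" and "q > 0"
  shows "norm (\<Sum>m=N..<K. a m) \<le> real q"
proof -
  have block: "(\<Sum>m=N..<N+q. a m) = 0" for N
  proof (induction N)
    case 0
    then show ?case using z by (simp add: atLeast0LessThan)
  next
    case (Suc N)
    have "(\<Sum>m=N..<N+q. a m) = a N + (\<Sum>m=Suc N..<N+q. a m)"
      using \<open>q > 0\<close> by (subst sum.atLeast_Suc_lessThan) auto
    moreover have "(\<Sum>m=Suc N..<Suc N+q. a m) = (\<Sum>m=Suc N..<N+q. a m) + a (N + q)"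
      using \<open>q > 0\<close> by simp
    ultimately show ?case using Suc per by (simp add: add.commute)
  qed
  show ?thesis
  proof (induction "K - N" arbitrary: N rule: less_induct)
    case less
    show ?case
    proof (cases "K - N < q")
      case True
      have "norm (\<Sum>m=N..<K. a m) \<le> (\<Sum>m=N..<K. 1)" using le by (intro sum_norm_le) auto
      then show ?thesis using True by simp
    next
      case False
      then have "(\<Sum>m=N..<K. a m) = (\<Sum>m=N..<N+q. a m) + (\<Sum>m=N+q..<K. a m)"
        using \<open>q > 0\<close> by (subst sum.atLeastLessThan_concat) auto
      then show ?thesis using block less.hyps[of "N + q"] False \<open>q > 0\<close> by simp
    qed
  qed
qed

text \<open>Up to sign, the k-th derivative at 1 + \<delta> of the Dirichlet series with
  coefficients \<open>a\<close>. Taking the derivative as an explicit series keeps the whole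
  argument at real points, without complex analysis.\<close>

definition dser :: "(nat \<Rightarrow> complex) \<Rightarrow> nat \<Rightarrow> real \<Rightarrow> complex" where
  "dser a k \<delta> = (\<Sum>m. a m * of_real (wt k \<delta> (real m)))"

lemma summable_dser:
  fixes a :: "nat \<Rightarrow> complex"
  assumes "\<delta> > 0" "\<And>m. norm (a m) \<le> C"
  shows "summable (\<lambda>m. norm (a m * of_real (wt k \<delta> (real m))))"
proof (rule summable_comparison_test)
  show "summable (\<lambda>m. C * wt k \<delta> (real m))" using summable_wt[OF assms(1)] by (rule summable_mult)
  show "\<exists>N. \<forall>n\<ge>N. norm (norm (a n * of_real (wt k \<delta> (real n)))) \<le> C * wt k \<delta> (real n)"
    using mult_right_mono[OF assms(2) wt_nonneg] by (simp add: norm_mult wt_nonneg)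
qed

text \<open>Abel summation on finite tails, followed by a limit; the condition on \<open>N\<close>
  places the tail where the weights decrease.\<close>

lemma norm_dser_periodic_tail_le:
  fixes a :: "nat \<Rightarrow> complex"
  assumes per: "\<And>m. a (m + q) = a m" and z: "(\<Sum>m<q. a m) = 0" and le: "\<And>m. norm (a m) \<le> 1" and "q > 0"
    and N: "N \<ge> 1" "real k \<le> ln (real N)" and "\<delta> > 0"
  shows "norm (dser a k \<delta> - (\<Sum>m<N. a m * of_real (wt k \<delta> (real m)))) \<le> real q * wt k \<delta> (real N)"
proof -
  let ?f = "\<lambda>m. a m * of_real (wt k \<delta> (real m))"
  have lim: "(\<lambda>K. norm ((\<Sum>m<K. ?f m) - (\<Sum>m<N. ?f m))) \<longlonglongrightarrow> norm (dser a k \<delta> - (\<Sum>m<N. ?f m))"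
    unfolding dser_def using summable_norm_cancel[OF summable_dser[where a = a and C = 1 and k = k, OF \<open>\<delta> > 0\<close> le]]
    by (intro tendsto_intros summable_LIMSEQ)
  have "norm ((\<Sum>m<K. ?f m) - (\<Sum>m<N. ?f m)) \<le> real q * wt k \<delta> (real N)" if "K \<ge> N" for K
  proof -
    have "(\<Sum>m<K. ?f m) - (\<Sum>m<N. ?f m) = (\<Sum>m=N..<K. ?f m)"
      using sum.atLeastLessThan_concat[of 0 N K ?f] that by (simp add: atLeast0LessThan algebra_simps)
    also have "norm \<dots> \<le> real q * wt k \<delta> (real N)"
    proof -
      have "real k \<le> ln (real m)" if "m \<ge> N" for m
        using N that by (intro order_trans[OF N(2)]) (auto intro!: ln_mono)
      then show ?thesis
        using N \<open>\<delta> > 0\<close> norm_sum_periodic_le[of a q, OF per z le \<open>q > 0\<close>]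
        by (intro norm_sum_abel[where f = "\<lambda>m. wt k \<delta> (real m)"]) (auto intro!: wt_antimono wt_nonneg)
    qed
    finally show ?thesis .
  qed
  then show ?thesis by (intro Lim_bounded[OF lim, of N]) auto
qed

lemma norm_dser_periodic_le:
  fixes a :: "nat \<Rightarrow> complex"
  assumes "\<And>m. a (m + q) = a m" "(\<Sum>m<q. a m) = 0" and le: "\<And>m. norm (a m) \<le> 1" and "q > 0"
    and "N \<ge> 1" "real k \<le> ln (real N)" and "\<delta> > 0"
  shows "norm (dser a k \<delta>) \<le> (\<Sum>m<N. wt k \<delta> (real m)) + real q * wt k \<delta> (real N)"
proof -
  have "norm (\<Sum>m<N. a m * of_real (wt k \<delta> (real m))) \<le> (\<Sum>m<N. wt k \<delta> (real m))"
    using mult_right_mono[OF le wt_nonneg] by (intro sum_norm_le) (auto simp: norm_mult wt_nonneg)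
  moreover have "norm (dser a k \<delta> - (\<Sum>m<N. a m * of_real (wt k \<delta> (real m)))) \<le> real q * wt k \<delta> (real N)"
    using assms by (intro norm_dser_periodic_tail_le)
  ultimately show ?thesis
    using norm_triangle_sub[of "dser a k \<delta>" "\<Sum>m<N. a m * of_real (wt k \<delta> (real m))"] by linarith
qed

lemma sum_inverse_le:
  assumes "q \<ge> 1"
  shows "(\<Sum>m=1..<q. 1 / real m) \<le> 1 + ln (real q)"
proof -
  obtain n where q: "q = Suc n" using assms by (cases q) auto
  have "(\<Sum>m=1..<q. 1 / real m) \<le> harm q"
    unfolding harm_def inverse_eq_divide by (intro sum_mono2) auto
  also have "\<dots> \<le> 1 + ln (real q)"
    using decseqD[OF decseq_harm_diff_ln, of 0 n] q by (simp add: harm_Suc harm_expand(1))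
  finally show ?thesis .
qed

text \<open>Cut at \<open>N = q\<close>: the head is at most \<open>ln q ^ k\<close> times a
  harmonic sum, and in the tail the factor \<open>q\<close> from the partial sums is cancelled by
  the weight at \<open>q\<close>. The bound is uniform in \<delta>.\<close>

lemma norm_dser_le_ln_power:
  fixes a :: "nat \<Rightarrow> complex"
  assumes "\<And>m. a (m + q) = a m" "(\<Sum>m<q. a m) = 0" "\<And>m. norm (a m) \<le> 1" "q > 0"
    and k: "real k \<le> ln (real q)" and "\<delta> > 0"
  shows "norm (dser a k \<delta>) \<le> (2 + ln (real q)) ^ (k + 1)"
proof -
  let ?l = "ln (real q)"
  have l0: "?l \<ge> 0" using k by linarith
  have "norm (dser a k \<delta>) \<le> (\<Sum>m<q. wt k \<delta> (real m)) + real q * wt k \<delta> (real q)"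
    using assms by (intro norm_dser_periodic_le) auto
  also have "(\<Sum>m<q. wt k \<delta> (real m)) = (\<Sum>m=1..<q. wt k \<delta> (real m))"
    by (intro sum.mono_neutral_right) (auto simp: not_le)
  also have "\<dots> \<le> (\<Sum>m=1..<q. ?l ^ k * (1 / real m))"
  proof (intro sum_mono)
    fix m assume m: "m \<in> {1..<q}"
    have "wt k \<delta> (real m) \<le> ln (real m) ^ k / real m" using assms m by (intro wt_le_ln_power) auto
    also have "\<dots> \<le> ?l ^ k / real m" using m by (intro divide_right_mono power_mono) auto
    finally show "wt k \<delta> (real m) \<le> ?l ^ k * (1 / real m)" by simp
  qed
  also have "\<dots> = ?l ^ k * (\<Sum>m=1..<q. 1 / real m)" by (rule sum_distrib_left[symmetric])
  also have "\<dots> \<le> ?l ^ k * (1 + ?l)" using assms sum_inverse_le[of q] l0 by (intro mult_left_mono) auto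
  also have "real q * wt k \<delta> (real q) \<le> ?l ^ k"
    using wt_le_ln_power[of \<delta> q k] assms by (simp add: field_simps)
  finally have "norm (dser a k \<delta>) \<le> ?l ^ k * (2 + ?l)" by (simp add: algebra_simps)
  also have "\<dots> \<le> (2 + ?l) ^ k * (2 + ?l)" using l0 by (intro mult_right_mono power_mono) auto
  finally show ?thesis by (simp add: mult.commute)
qed

text \<open>The integral of \<open>wt k \<delta>\<close> over \<open>{x..}\<close>, by repeated integration by parts.\<close>

primrec wt_int :: "nat \<Rightarrow> real \<Rightarrow> real \<Rightarrow> real" where
  "wt_int 0 \<delta> x = x powr - \<delta> / \<delta>"
| "wt_int (Suc k) \<delta> x = (x powr - \<delta> * ln x ^ Suc k + real (Suc k) * wt_int k \<delta> x) / \<delta>"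

lemma has_derivative_wt_int:
  assumes "\<delta> > 0" "x > 0"
  shows "(wt_int k \<delta> has_real_derivative - wt k \<delta> x) (at x)"
proof (induction k)
  case 0
  have [simp]: "- \<delta> - 1 = - 1 - \<delta>" by simp
  have "((\<lambda>x. x powr - \<delta> / \<delta>) has_real_derivative - wt 0 \<delta> x) (at x)"
    using assms by (auto intro!: derivative_eq_intros simp: wt_def)
  then show ?case by simp
next
  case (Suc k)
  have "((\<lambda>x. (x powr - \<delta> * ln x ^ Suc k + real (Suc k) * wt_int k \<delta> x) / \<delta>)
     has_real_derivative
      (- \<delta> * x powr (- \<delta> - 1) * ln x ^ Suc k + x powr - \<delta> * (real (Suc k) * ln x ^ k * (1 / x))
        + real (Suc k) * (- wt k \<delta> x)) / \<delta>) (at x)"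
    using assms by (auto intro!: derivative_eq_intros Suc simp del: power_Suc)
  also have "x powr - \<delta> * (real (Suc k) * ln x ^ k * (1 / x)) = real (Suc k) * wt k \<delta> x"
    using assms by (simp add: wt_def powr_diff powr_minus_divide field_simps)
  also have "(- \<delta> * x powr (- \<delta> - 1) * ln x ^ Suc k + real (Suc k) * wt k \<delta> x
        + real (Suc k) * (- wt k \<delta> x)) / \<delta> = - wt (Suc k) \<delta> x"
    using assms by (simp add: wt_def diff_diff_eq2 minus_diff_commute)
  finally show ?case by simp
qed

lemma wt_int_tendsto_0:
  assumes "\<delta> > 0"
  shows "(\<lambda>m. wt_int k \<delta> (real m)) \<longlonglongrightarrow> 0"
proof (induction k)
  case 0
  show ?case using assms by simp real_asymp
next
  case (Suc k)
  have "(\<lambda>m. real m powr - \<delta> * ln (real m) ^ Suc k) \<longlonglongrightarrow> 0" using assms by real_asymp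
  from tendsto_divide[OF tendsto_add[OF this tendsto_mult[OF tendsto_const[of "real (Suc k)"] Suc]]
      tendsto_const[of \<delta>]] assms
  show ?case by simp
qed

text \<open>In the recursion scaled by \<open>\<delta> ^ (k + 2)\<close> the boundary term tends to
  0, and the other term brings the factor \<open>k + 1\<close>.\<close>

lemma wt_int_scaled_tendsto:
  assumes "x \<ge> 1"
  shows "((\<lambda>\<delta>. \<delta> ^ (k + 1) * wt_int k \<delta> x) \<longlongrightarrow> fact k) (at_right 0)"
proof (induction k)
  case 0
  have "((\<lambda>\<delta>. x powr - \<delta>) \<longlongrightarrow> x powr - 0) (at_right 0)" using assms by (intro tendsto_intros) auto
  then have "((\<lambda>\<delta>. x powr - \<delta>) \<longlongrightarrow> fact 0) (at_right 0)" using assms by simp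
  then show ?case
    by (rule Lim_transform_eventually) (auto simp: eventually_at_filter)
next
  case (Suc k)
  have "((\<lambda>\<delta>::real. \<delta> ^ (k + 1) * x powr - \<delta> * ln x ^ Suc k) \<longlongrightarrow> 0 ^ (k + 1) * x powr - 0 * ln x ^ Suc k) (at_right 0)"
    using assms by (intro tendsto_intros) auto
  from tendsto_add[OF this tendsto_mult[OF tendsto_const[of "real (Suc k)"] Suc]]
  have "((\<lambda>\<delta>::real. \<delta> ^ (k + 1) * x powr - \<delta> * ln x ^ Suc k + real (Suc k) * (\<delta> ^ (k + 1) * wt_int k \<delta> x))
     \<longlongrightarrow> fact (Suc k)) (at_right 0)" by simp
  then show ?case
    by (rule Lim_transform_eventually) (auto simp: eventually_at_filter field_simps)
qed

text \<open>Integral test: by the mean value theorem each increment of the primitive lies between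
  two neighbouring weights, and the increments telescope.\<close>

lemma wt_tail_bounds:
  assumes "\<delta> > 0" and N: "N \<ge> 1" "real k \<le> ln (real N)"
  shows "wt_int k \<delta> (real N) \<le> (\<Sum>m. wt k \<delta> (real (m + N)))"
    and "(\<Sum>m. wt k \<delta> (real (m + N))) \<le> wt_int k \<delta> (real N) + wt k \<delta> (real N)"
proof -
  let ?I = "\<lambda>m. wt_int k \<delta> (real (m + N))"
  have step: "wt k \<delta> (real (Suc m + N)) \<le> ?I m - ?I (Suc m) \<and> ?I m - ?I (Suc m) \<le> wt k \<delta> (real (m + N))" for m
  proof -
    let ?x = "real (m + N)"
    have "\<exists>z>?x. z < ?x + 1 \<and> wt_int k \<delta> (?x + 1) - wt_int k \<delta> ?x = (?x + 1 - ?x) * - wt k \<delta> z"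
      using assms by (intro MVT2) (auto intro!: has_derivative_wt_int)
    then obtain z where z: "?x < z" "z < ?x + 1" "wt_int k \<delta> (?x + 1) - wt_int k \<delta> ?x = - wt k \<delta> z" by auto
    have k: "real k \<le> ln ?x" using N by (intro order_trans[OF N(2)]) (auto intro!: ln_mono)
    have "wt k \<delta> z \<le> wt k \<delta> ?x" using z k N assms(1) by (intro wt_antimono) auto
    moreover have "wt k \<delta> (?x + 1) \<le> wt k \<delta> z"
    proof (rule wt_antimono)
      show "real k \<le> ln z" using z N by (intro order_trans[OF k]) (auto intro!: ln_mono)
    qed (use z N assms(1) in auto)
    ultimately show ?thesis using z(3) by (simp add: algebra_simps)
  qed
  have sm: "summable (\<lambda>m. wt k \<delta> (real (m + N)))"
    using summable_wt[OF assms(1)] by (subst summable_iff_shift[of "\<lambda>m. wt k \<delta> (real m)"])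
  have "?I \<longlonglongrightarrow> 0" using LIMSEQ_ignore_initial_segment[OF wt_int_tendsto_0[OF assms(1)]] .
  from telescope_sums'[OF this] have tel: "(\<lambda>m. ?I m - ?I (Suc m)) sums wt_int k \<delta> (real N)" by simp
  show "wt_int k \<delta> (real N) \<le> (\<Sum>m. wt k \<delta> (real (m + N)))"
    using step by (intro sums_le[OF _ tel summable_sums[OF sm]]) auto
  have "(\<lambda>m. wt k \<delta> (real (Suc m + N))) sums ((\<Sum>m. wt k \<delta> (real (m + N))) - wt k \<delta> (real N))"
    using sums_Suc_iff[of "\<lambda>m. wt k \<delta> (real (m + N))"] summable_sums[OF sm] by simp
  from sums_le[OF _ this tel] step
  show "(\<Sum>m. wt k \<delta> (real (m + N))) \<le> wt_int k \<delta> (real N) + wt k \<delta> (real N)" by auto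
qed

text \<open>Up to sign, the k-th derivative of the Riemann zeta function at 1 + \<delta>.\<close>

definition wt_sum :: "nat \<Rightarrow> real \<Rightarrow> real" where
  "wt_sum k \<delta> = (\<Sum>m. wt k \<delta> (real m))"

text \<open>The simple pole of zeta with residue 1. Only the integral over the tail matters; the
  terms below exp k, where the weights need not decrease, stay bounded and are killed by
  \<open>\<delta> ^ (k + 1)\<close>.\<close>

lemma wt_sum_scaled_tendsto: "((\<lambda>\<delta>. \<delta> ^ (k + 1) * wt_sum k \<delta>) \<longlongrightarrow> fact k) (at_right 0)"
proof (rule tendsto_sandwich)
  define N where "N = nat \<lceil>exp (real k)\<rceil>"
  have eN: "exp (real k) \<le> real N" unfolding N_def by linarith
  have N: "N \<ge> 1" unfolding N_def by (simp add: Suc_le_eq)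
  have kN: "real k \<le> ln (real N)" using eN N by (subst ln_ge_iff) auto
  \<comment> \<open>The range includes \<open>N\<close> itself, so that \<open>C\<close> also bounds
    the boundary term in the upper half of the integral test.\<close>
  define C where "C = (\<Sum>m<Suc N. ln (real m) ^ k)"
  have le: "wt k \<delta> (real m) \<le> ln (real m) ^ k" if "\<delta> > 0" for \<delta> m
  proof (cases "m = 0")
    case False
    have "ln (real m) ^ k / real m \<le> ln (real m) ^ k / 1" using False by (intro divide_left_mono) auto
    then show ?thesis using wt_le_ln_power[of \<delta> m k] that False by simp
  qed (use that in \<open>auto simp: power_0_left\<close>)
  have split: "wt_sum k \<delta> = (\<Sum>m. wt k \<delta> (real (m + N))) + (\<Sum>m<N. wt k \<delta> (real m))" if "\<delta> > 0" for \<delta>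
    unfolding wt_sum_def using suminf_split_initial_segment[OF summable_wt[OF that]] .
  show "\<forall>\<^sub>F \<delta> in at_right 0. \<delta> ^ (k + 1) * wt_int k \<delta> (real N) \<le> \<delta> ^ (k + 1) * wt_sum k \<delta>"
  proof (rule eventually_at_right_less[THEN eventually_mono])
    fix \<delta> :: real assume "0 < \<delta>"
    then show "\<delta> ^ (k + 1) * wt_int k \<delta> (real N) \<le> \<delta> ^ (k + 1) * wt_sum k \<delta>"
      using wt_tail_bounds(1)[OF _ N kN] split by (intro mult_left_mono) (auto intro!: add_increasing2 sum_nonneg wt_nonneg)
  qed
  show "\<forall>\<^sub>F \<delta> in at_right 0. \<delta> ^ (k + 1) * wt_sum k \<delta> \<le> \<delta> ^ (k + 1) * wt_int k \<delta> (real N) + \<delta> ^ (k + 1) * C"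
  proof (rule eventually_at_right_less[THEN eventually_mono])
    fix \<delta> :: real assume d: "0 < \<delta>"
    have "wt k \<delta> (real N) + (\<Sum>m<N. wt k \<delta> (real m)) \<le> C"
      using le[OF d] unfolding C_def by (simp add: add.commute) (intro add_mono sum_mono)
    then have "wt_sum k \<delta> \<le> wt_int k \<delta> (real N) + C" using wt_tail_bounds(2)[OF d N kN] split[OF d] by linarith
    then show "\<delta> ^ (k + 1) * wt_sum k \<delta> \<le> \<delta> ^ (k + 1) * wt_int k \<delta> (real N) + \<delta> ^ (k + 1) * C"
      using d by (simp flip: distrib_left)
  qed
  show "((\<lambda>\<delta>. \<delta> ^ (k + 1) * wt_int k \<delta> (real N)) \<longlongrightarrow> fact k) (at_right 0)"
    using N by (intro wt_int_scaled_tendsto) auto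
  have "((\<lambda>\<delta>. \<delta> ^ (k + 1) * wt_int k \<delta> (real N) + \<delta> ^ (k + 1) * C) \<longlongrightarrow> fact k + 0 ^ (k + 1) * C) (at_right 0)"
    using N by (intro tendsto_add wt_int_scaled_tendsto tendsto_intros) auto
  then show "((\<lambda>\<delta>. \<delta> ^ (k + 1) * wt_int k \<delta> (real N) + \<delta> ^ (k + 1) * C) \<longlongrightarrow> fact k) (at_right 0)" by simp
qed

text \<open>Meant for a fixed modulus: the cut depends on \<open>k\<close> instead of
  \<open>q\<close>, so no relation between \<open>k\<close> and \<open>q\<close> is required, and
  the bound may depend on both.\<close>

lemma dser_bounded_of_periodic:
  fixes a :: "nat \<Rightarrow> complex"
  assumes "\<And>m. a (m + q) = a m" "(\<Sum>m<q. a m) = 0" "\<And>m. norm (a m) \<le> 1" "q > 0"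
  shows "\<exists>C. \<forall>\<delta>>0. norm (dser a k \<delta>) \<le> C"
proof -
  define N where "N = nat \<lceil>exp (real k)\<rceil>"
  have eN: "exp (real k) \<le> real N" unfolding N_def by linarith
  have N: "N \<ge> 1" unfolding N_def by (simp add: Suc_le_eq)
  have kN: "real k \<le> ln (real N)" using eN N by (subst ln_ge_iff) auto
  have "norm (dser a k \<delta>) \<le> (\<Sum>m=1..<N. ln (real m) ^ k / real m) + real q * (ln (real N) ^ k / real N)"
    if "\<delta> > 0" for \<delta>
  proof -
    have "norm (dser a k \<delta>) \<le> (\<Sum>m<N. wt k \<delta> (real m)) + real q * wt k \<delta> (real N)"
      using assms N kN that by (intro norm_dser_periodic_le) auto
    also have "(\<Sum>m<N. wt k \<delta> (real m)) = (\<Sum>m=1..<N. wt k \<delta> (real m))"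
      by (intro sum.mono_neutral_right) (auto simp: not_le)
    also have "\<dots> + real q * wt k \<delta> (real N) \<le>
        (\<Sum>m=1..<N. ln (real m) ^ k / real m) + real q * (ln (real N) ^ k / real N)"
      using that N by (intro add_mono sum_mono mult_left_mono wt_le_ln_power) auto
    finally show ?thesis .
  qed
  then show ?thesis by blast
qed

section \<open>The logarithmic derivative\<close>

lemma has_sum_product_complex:
  fixes f :: "'a \<Rightarrow> complex" and g :: "'b \<Rightarrow> complex"
  assumes "(f has_sum a) A" "(g has_sum b) B"
  shows "((\<lambda>(x, y). f x * g y) has_sum a * b) (A \<times> B)"
proof (rule has_sum_SigmaI)
  show "((\<lambda>y. case (x, y) of (x, y) \<Rightarrow> f x * g y) has_sum f x * b) B" for x
    using has_sum_cmult_right[OF assms(2), of "f x"] by simp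
  show "((\<lambda>x. f x * b) has_sum a * b) A" using has_sum_cmult_left[OF assms(1), of b] .
  have f: "(\<lambda>x. norm (f x)) summable_on A" and g: "(\<lambda>y. norm (g y)) summable_on B"
    using assms by (auto simp: summable_on_iff_abs_summable_on_complex[symmetric] dest: has_sum_imp_summable)
  have "(\<lambda>z. norm (case z of (x, y) \<Rightarrow> f x * g y)) summable_on A \<times> B"
    unfolding Infinite_Sum.abs_summable_on_Sigma_iff
    using f g by (auto simp: norm_mult infsum_cmult_right' abs_mult infsum_nonneg intro!: summable_on_cmult_right summable_on_cmult_left)
  then show "(\<lambda>(x, y). f x * g y) summable_on A \<times> B"
    by (rule abs_summable_summable)
qed

lemma has_sum_sum_finite:
  fixes f :: "'i \<Rightarrow> 'a \<Rightarrow> complex"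
  assumes "finite I" "\<And>i. i \<in> I \<Longrightarrow> (f i has_sum s i) A"
  shows "((\<lambda>x. \<Sum>i\<in>I. f i x) has_sum (\<Sum>i\<in>I. s i)) A"
  using assms by (induction I rule: finite_induct) (auto intro!: has_sum_add)

lemma dser_has_sum:
  assumes "\<delta> > 0" "\<And>m. norm (a m) \<le> C"
  shows "((\<lambda>m. a m * of_real (wt k \<delta> (real m))) has_sum dser a k \<delta>) UNIV"
proof -
  note * = summable_dser[where a = a and k = k, OF assms]
  show ?thesis unfolding dser_def
    using * summable_norm_cancel[OF *] by (intro norm_summable_imp_has_sum summable_sums)
qed

lemma norm_mangoldt_mult_wt_le:
  assumes "norm c \<le> 1"
  shows "norm (mangoldt m * c * complex_of_real (wt k \<delta> (real m))) \<le> wt (Suc k) \<delta> (real m)"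
proof (cases "m = 0")
  case False
  have "norm (mangoldt m * c * complex_of_real (wt k \<delta> (real m))) = mangoldt m * norm c * wt k \<delta> (real m)"
    by (simp add: norm_mult wt_nonneg)
  also have "\<dots> \<le> ln (real m) * 1 * wt k \<delta> (real m)"
    using mangoldt_le[of m] False assms by (intro mult_mono) (auto simp: mangoldt_nonneg wt_nonneg)
  also have "\<dots> = wt (Suc k) \<delta> (real m)" by (simp add: wt_def)
  finally show ?thesis .
qed auto

lemma dser_mangoldt_has_sum:
  assumes "\<delta> > 0" "\<And>m. norm (a m) \<le> 1"
  shows "((\<lambda>m. mangoldt m * a m * of_real (wt k \<delta> (real m))) has_sum dser (\<lambda>m. mangoldt m * a m) k \<delta>) UNIV"
proof -
  have *: "summable (\<lambda>m. norm (mangoldt m * a m * complex_of_real (wt k \<delta> (real m))))"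
    by (rule summable_comparison_test[OF _ summable_wt[OF assms(1), of "Suc k"]])
       (use norm_mangoldt_mult_wt_le[OF assms(2)] in auto)
  show ?thesis unfolding dser_def
    using * summable_norm_cancel[OF *] by (intro norm_summable_imp_has_sum summable_sums)
qed

text \<open>The identity (L' / L) L = L' differentiated \<open>k\<close> times. Termwise, the
  binomial theorem expands (ln d + ln e) ^ k, and the divisor sum of the von Mangoldt function
  supplies the additional logarithm.\<close>

lemma dser_mangoldt_recurrence:
  assumes mult: "\<And>m n. a (m * n) = a m * a n" and le: "\<And>m. norm (a m) \<le> 1" and d: "\<delta> > 0"
  shows "(\<Sum>j\<le>k. of_nat (k choose j) * (dser (\<lambda>m. mangoldt m * a m) j \<delta> * dser a (k - j) \<delta>)) = dser a (Suc k) \<delta>"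
    (is "?lhs = _")
proof -
  let ?F = "\<lambda>(d, e). mangoldt d * a (d * e) * complex_of_real (wt k \<delta> (real (d * e)))"
  have "((\<lambda>z. \<Sum>j\<le>k. of_nat (k choose j) * (case z of (d, e) \<Rightarrow>
      (mangoldt d * a d * of_real (wt j \<delta> (real d))) * (a e * of_real (wt (k - j) \<delta> (real e))))) has_sum ?lhs)
      (UNIV \<times> UNIV)"
    by (intro has_sum_sum_finite finite_atMost has_sum_cmult_right has_sum_product_complex dser_has_sum[where C = 1] dser_mangoldt_has_sum d le)
  also have "?this \<longleftrightarrow> (?F has_sum ?lhs) ({0<..} \<times> {0<..})"
  proof (intro has_sum_cong_neutral)
    fix z :: "nat \<times> nat" assume "z \<in> UNIV \<times> UNIV \<inter> {0<..} \<times> {0<..}"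
    then obtain d e where z: "z = (d, e)" "d > 0" "e > 0" by (cases z) auto
    have "(\<Sum>j\<le>k. real (k choose j) * (wt j \<delta> (real d) * wt (k - j) \<delta> (real e))) =
       (\<Sum>j\<le>k. real (k choose j) * ln (real d) ^ j * ln (real e) ^ (k - j)) * (real d powr (-1 - \<delta>) * real e powr (-1 - \<delta>))"
      unfolding sum_distrib_right wt_def by (intro sum.cong) (auto simp: mult_ac)
    also have "\<dots> = wt k \<delta> (real (d * e))"
      using z by (simp add: binomial_ring[symmetric] wt_def ln_mult powr_mult)
    finally have *: "complex_of_real (wt k \<delta> (real (d * e))) =
       (\<Sum>j\<le>k. of_nat (k choose j) * (of_real (wt j \<delta> (real d)) * of_real (wt (k - j) \<delta> (real e))))"
      by (metis (no_types, lifting) of_real_sum of_real_mult of_real_of_nat_eq sum.cong)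
    show "(\<Sum>j\<le>k. of_nat (k choose j) * (case z of (d, e) \<Rightarrow>
      (mangoldt d * a d * of_real (wt j \<delta> (real d))) * (a e * of_real (wt (k - j) \<delta> (real e))))) = ?F z"
      unfolding z prod.case * sum_distrib_left mult by (intro sum.cong) (auto simp: mult_ac)
  qed (auto intro!: Nat.gr0I)
  \<comment> \<open>Group the pairs \<open>(d, e)\<close> by their product; zero entries had weight
    0 and were dropped just before.\<close>
  also have "\<dots> \<longleftrightarrow> ((\<lambda>(n, d). mangoldt d * a n * complex_of_real (wt k \<delta> (real n))) has_sum ?lhs)
      (SIGMA n:{0<..}. {d. d dvd n})"
    by (rule has_sum_reindex_bij_witness[of _ "\<lambda>(n, d). (d, n div d)" "\<lambda>(d, e). (d * e, d)"])
       (auto elim!: dvdE)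
  finally have "((\<lambda>(n, d). mangoldt d * a n * complex_of_real (wt k \<delta> (real n))) has_sum ?lhs)
      (SIGMA n:{0<..}. {d. d dvd n})" .
  then have "((\<lambda>n. a n * of_real (wt (Suc k) \<delta> (real n))) has_sum ?lhs) {0<..}"
  proof (rule has_sum_SigmaD)
    fix n :: nat assume n: "n \<in> {0<..}"
    have "(\<Sum>d | d dvd n. mangoldt d * a n * complex_of_real (wt k \<delta> (real n))) =
        (\<Sum>d | d dvd n. mangoldt d) * (a n * complex_of_real (wt k \<delta> (real n)))"
      unfolding sum_distrib_right by (simp add: mult_ac)
    also have "\<dots> = a n * of_real (wt (Suc k) \<delta> (real n))"
      using n by (simp add: mangoldt_sum wt_def)
    finally show "((\<lambda>d. case (n, d) of (n, d) \<Rightarrow> mangoldt d * a n * complex_of_real (wt k \<delta> (real n)))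
        has_sum a n * of_real (wt (Suc k) \<delta> (real n))) {d. d dvd n}"
      using n by (intro has_sum_finiteI) auto
  qed
  also have "?this \<longleftrightarrow> ((\<lambda>n. a n * of_real (wt (Suc k) \<delta> (real n))) has_sum ?lhs) UNIV"
    by (intro has_sum_cong_neutral) auto
  finally have "((\<lambda>n. a n * of_real (wt (Suc k) \<delta> (real n))) has_sum ?lhs) UNIV" .
  from has_sum_unique[OF this dser_has_sum[where k = "Suc k", OF d le]] show ?thesis .
qed

text \<open>Solve the recurrence for its last term and divide by \<open>L 0\<close>: each order
  costs one more factor \<open>M / \<mu>\<close>. The quantifiers inside make \<open>C\<close>
  depend on \<open>k\<close> only, hence serve all characters and all moduli;
  \<open>M / \<mu> \<ge> 1\<close> lets lower powers be absorbed.\<close>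

lemma recurrence_bound:
  "\<exists>C\<ge>1. \<forall>P L :: nat \<Rightarrow> complex. \<forall>M \<mu> :: real.
     (\<forall>i. (\<Sum>j\<le>i. of_nat (i choose j) * (P j * L (i - j))) = L (Suc i)) \<longrightarrow>
     (\<forall>i\<le>Suc k. norm (L i) \<le> M) \<longrightarrow> \<mu> \<le> norm (L 0) \<longrightarrow> 0 < \<mu> \<longrightarrow> \<mu> \<le> 1 \<longrightarrow> 1 \<le> M \<longrightarrow>
     (\<forall>i\<le>k. norm (P i) \<le> C * (M / \<mu>) ^ Suc i)"
proof (induction k)
  case 0
  show ?case
  proof (intro exI[of _ 1] conjI allI impI)
    fix P L :: "nat \<Rightarrow> complex" and M \<mu> :: real and i :: nat
    assume *: "\<forall>i. (\<Sum>j\<le>i. of_nat (i choose j) * (P j * L (i - j))) = L (Suc i)"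
      "\<forall>i\<le>Suc 0. norm (L i) \<le> M" "\<mu> \<le> norm (L 0)" "0 < \<mu>" "\<mu> \<le> 1" "1 \<le> M" "i \<le> 0"
    have "norm (P 0) * \<mu> \<le> norm (P 0) * norm (L 0)" using * by (intro mult_left_mono) auto
    also have "\<dots> = norm (L (Suc 0))" using *(1)[rule_format, of 0] by (simp flip: norm_mult)
    also have "\<dots> \<le> M" using *(2) by simp
    finally show "norm (P i) \<le> 1 * (M / \<mu>) ^ Suc i" using * by (simp add: field_simps)
  qed auto
next
  case (Suc k)
  then obtain C where C: "C \<ge> 1" and IH: "\<And>P L :: nat \<Rightarrow> complex. \<And>M \<mu> :: real. \<And>i.
     (\<forall>i. (\<Sum>j\<le>i. of_nat (i choose j) * (P j * L (i - j))) = L (Suc i)) \<Longrightarrow>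
     (\<forall>i\<le>Suc k. norm (L i) \<le> M) \<Longrightarrow> \<mu> \<le> norm (L 0) \<Longrightarrow> 0 < \<mu> \<Longrightarrow> \<mu> \<le> 1 \<Longrightarrow> 1 \<le> M \<Longrightarrow>
     i \<le> k \<Longrightarrow> norm (P i) \<le> C * (M / \<mu>) ^ Suc i" by blast
  \<comment> \<open>The 1 pays for the term \<open>L (Suc (Suc k))\<close>, and
    \<open>2 ^ Suc k\<close> bounds the sum of the binomial coefficients.\<close>
  define D where "D = 1 + 2 ^ Suc k * C"
  have "1 * C \<le> 2 ^ Suc k * C" using C by (intro mult_right_mono one_le_power) auto
  then have CD: "C \<le> D" "1 \<le> D" using C unfolding D_def by linarith+
  show ?case
  proof (intro exI[of _ D] conjI allI impI)
    show "1 \<le> D" by (rule CD)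
    fix P L :: "nat \<Rightarrow> complex" and M \<mu> :: real and i :: nat
    assume *: "\<forall>i. (\<Sum>j\<le>i. of_nat (i choose j) * (P j * L (i - j))) = L (Suc i)"
      "\<forall>i\<le>Suc (Suc k). norm (L i) \<le> M" "\<mu> \<le> norm (L 0)" "0 < \<mu>" "\<mu> \<le> 1" "1 \<le> M" "i \<le> Suc k"
    define r where "r = M / \<mu>"
    have r: "r \<ge> 1" using * by (simp add: r_def)
    have IH': "norm (P j) \<le> C * r ^ Suc j" if "j \<le> k" for j
      unfolding r_def using * that by (intro IH[where L = L]) auto
    show "norm (P i) \<le> D * (M / \<mu>) ^ Suc i"
    proof (cases "i = Suc k")
      case False
      then show ?thesis using IH'[of i] * CD r mult_right_mono[OF CD(1), of "r ^ Suc i"]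
        by (auto simp: r_def)
    next
      case True
      have "P (Suc k) * L 0 = L (Suc (Suc k)) - (\<Sum>j\<le>k. of_nat (Suc k choose j) * (P j * L (Suc k - j)))"
        using *(1)[rule_format, of "Suc k"] by (simp add: algebra_simps)
      then have "norm (P (Suc k)) * norm (L 0) \<le>
          norm (L (Suc (Suc k))) + norm (\<Sum>j\<le>k. of_nat (Suc k choose j) * (P j * L (Suc k - j)))"
        by (metis norm_mult norm_triangle_ineq4)
      also have "\<dots> \<le> M + (\<Sum>j\<le>k. real (Suc k choose j) * (C * r ^ Suc k * M))"
      proof (intro add_mono sum_norm_le)
        fix j assume j: "j \<in> {..k}"
        have "norm (P j * L (Suc k - j)) \<le> (C * r ^ Suc j) * M"
          unfolding norm_mult using IH'[of j] j * C r by (intro mult_mono) auto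
        also have "\<dots> \<le> (C * r ^ Suc k) * M"
          using j C r * by (intro mult_right_mono mult_left_mono power_increasing) auto
        finally show "norm (of_nat (Suc k choose j) * (P j * L (Suc k - j))) \<le> real (Suc k choose j) * (C * r ^ Suc k * M)"
          by (simp only: norm_mult norm_of_nat) (intro mult_left_mono, auto)
      qed (use * in auto)
      also have "\<dots> = M + (\<Sum>j\<le>k. real (Suc k choose j)) * (C * r ^ Suc k * M)"
        by (simp only: sum_distrib_right)
      also have "\<dots> \<le> M * r ^ Suc k + 2 ^ Suc k * (C * r ^ Suc k * M)"
      proof (intro add_mono mult_right_mono)
        have "(\<Sum>j\<le>k. real (Suc k choose j)) \<le> (\<Sum>j\<le>Suc k. real (Suc k choose j))" by simp
        also have "\<dots> = 2 ^ Suc k"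
          using choose_row_sum[of "Suc k"] by (metis of_nat_sum of_nat_power of_nat_numeral)
        finally show "(\<Sum>j\<le>k. real (Suc k choose j)) \<le> 2 ^ Suc k" .
        show "M \<le> M * r ^ Suc k" using * r one_le_power[OF r, of "Suc k"] by (simp add: mult_le_cancel_left1 del: power_Suc)
      qed (use * C r in auto)
      also have "\<dots> = D * r ^ Suc k * M" by (simp add: D_def algebra_simps)
      finally have "norm (P (Suc k)) * norm (L 0) \<le> D * r ^ Suc k * M" .
      from order.trans[OF mult_left_mono[OF *(3) norm_ge_zero] this]
      have "norm (P (Suc k)) * \<mu> \<le> D * r ^ Suc k * M" .
      then have "norm (P (Suc k)) \<le> D * r ^ Suc k * M / \<mu>" using * by (simp add: field_simps)
      also have "\<dots> = D * r ^ Suc (Suc k)" by (simp add: r_def)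
      finally show ?thesis using True by (simp add: r_def)
    qed
  qed
qed

text \<open>The same recurrence at a simple pole: if L behaves like c / \<delta> together with its
  derivatives, its logarithmic derivative behaves like 1 / \<delta>, and the residue c
  cancels.\<close>

lemma recurrence_tendsto:
  fixes P L :: "nat \<Rightarrow> real \<Rightarrow> complex" and c :: complex
  assumes rec: "\<And>k \<delta>. \<delta> > 0 \<Longrightarrow> (\<Sum>j\<le>k. of_nat (k choose j) * (P j \<delta> * L (k - j) \<delta>)) = L (Suc k) \<delta>"
    and L: "\<And>k. ((\<lambda>\<delta>. of_real \<delta> ^ Suc k * L k \<delta>) \<longlongrightarrow> c * fact k) (at_right 0)" and c: "c \<noteq> 0"
  shows "((\<lambda>\<delta>. of_real \<delta> ^ Suc k * P k \<delta>) \<longlongrightarrow> fact k) (at_right 0)"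
proof (induction k rule: less_induct)
  case (less k)
  define p l where "p = (\<lambda>j \<delta>. of_real \<delta> ^ Suc j * P j \<delta>)" and "l = (\<lambda>j \<delta>. of_real \<delta> ^ Suc j * L j \<delta>)"
  have l: "(l j \<longlongrightarrow> c * fact j) (at_right 0)" for j using L unfolding l_def .
  have p: "(p j \<longlongrightarrow> fact j) (at_right 0)" if "j < k" for j using less that unfolding p_def .
  have "((\<lambda>\<delta>. (l (Suc k) \<delta> - (\<Sum>j<k. of_nat (k choose j) * (p j \<delta> * l (k - j) \<delta>))) / l 0 \<delta>) \<longlongrightarrow>
     (c * fact (Suc k) - (\<Sum>j<k. of_nat (k choose j) * (fact j * (c * fact (k - j))))) / (c * fact 0)) (at_right 0)"
    using c by (intro tendsto_intros l p) auto
  \<comment> \<open>Each of the \<open>k\<close> terms has the limit \<open>c * fact k\<close>,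
    which leaves (k + 1)! - k k! = k! after division by \<open>c\<close>.\<close>
  also have "(\<Sum>j<k. of_nat (k choose j) * (fact j * (c * fact (k - j)))) = (\<Sum>j<k. c * fact k)"
  proof (intro sum.cong refl)
    fix j assume "j \<in> {..<k}"
    then have "fact j * fact (k - j) * (k choose j) = fact k" by (intro binomial_fact_lemma) auto
    then have "of_nat (fact j * fact (k - j) * (k choose j)) = (of_nat (fact k) :: complex)" by metis
    then have "(fact j * fact (k - j) * of_nat (k choose j) :: complex) = fact k" by simp
    then show "of_nat (k choose j) * (fact j * (c * fact (k - j))) = c * fact k" by (simp add: mult_ac)
  qed
  also have "(c * fact (Suc k) - (\<Sum>j<k. c * fact k)) / (c * fact 0) = fact k"
    using c by (simp add: field_simps)
  finally have lim: "((\<lambda>\<delta>. (l (Suc k) \<delta> - (\<Sum>j<k. of_nat (k choose j) * (p j \<delta> * l (k - j) \<delta>))) / l 0 \<delta>) \<longlongrightarrow> fact k) (at_right 0)" .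
  have "\<forall>\<^sub>F \<delta> in at_right 0. l 0 \<delta> \<noteq> 0"
    using l[of 0] c by (intro tendsto_imp_eventually_ne) auto
  moreover have "\<forall>\<^sub>F \<delta>::real in at_right 0. \<delta> > 0" by (rule eventually_at_right_less)
  ultimately have "\<forall>\<^sub>F \<delta> in at_right 0.
     (l (Suc k) \<delta> - (\<Sum>j<k. of_nat (k choose j) * (p j \<delta> * l (k - j) \<delta>))) / l 0 \<delta> = p k \<delta>"
  proof eventually_elim
    case (elim \<delta>)
    have "l (Suc k) \<delta> = of_real \<delta> ^ Suc (Suc k) * (\<Sum>j\<le>k. of_nat (k choose j) * (P j \<delta> * L (k - j) \<delta>))"
      using rec[OF elim(2), of k] by (simp add: l_def)
    also have "\<dots> = (\<Sum>j\<le>k. of_nat (k choose j) * (p j \<delta> * l (k - j) \<delta>))"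
      unfolding sum_distrib_left
    proof (intro sum.cong refl)
      fix j assume "j \<in> {..k}"
      then have "Suc (Suc k) = Suc j + Suc (k - j)" by simp
      then have "complex_of_real \<delta> ^ Suc (Suc k) = of_real \<delta> ^ Suc j * of_real \<delta> ^ Suc (k - j)"
        by (metis power_add)
      then show "of_real \<delta> ^ Suc (Suc k) * (of_nat (k choose j) * (P j \<delta> * L (k - j) \<delta>)) =
         of_nat (k choose j) * (p j \<delta> * l (k - j) \<delta>)" by (simp add: p_def l_def mult_ac del: power_Suc)
    qed
    also have "\<dots> = (\<Sum>j<k. of_nat (k choose j) * (p j \<delta> * l (k - j) \<delta>)) + p k \<delta> * l 0 \<delta>"
      by (simp flip: lessThan_Suc_atMost)
    finally show ?case using elim by simp
  qed
  from Lim_transform_eventually[OF lim this] show ?case unfolding p_def .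
qed

text \<open>Here \<open>c\<close> is the density of the integers coprime to \<open>g\<close>.
  Subtracting it leaves a periodic function of mean zero with bounded series, so the pole is
  \<open>c\<close> times that of zeta.\<close>

lemma principal_char_tendsto:
  assumes "g > 0"
  shows "\<exists>c::complex. c \<noteq> 0 \<and> (\<forall>k. ((\<lambda>\<delta>. of_real \<delta> ^ Suc k * dser (principal_char g) k \<delta>) \<longlongrightarrow> c * fact k) (at_right 0))"
proof -
  define c where "c = real (card {m. m < g \<and> coprime m g}) / real g"
  \<comment> \<open>For \<open>g = 1\<close> the only residue is 0, and it is coprime to 1.\<close>
  have "1 mod g \<in> {m. m < g \<and> coprime m g}" using assms
    by (cases "g = 1") (auto simp: mod_less)
  then have "card {m. m < g \<and> coprime m g} > 0" by (subst card_gt_0_iff) auto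
  moreover have "card {m. m < g \<and> coprime m g} \<le> card {..<g}" by (intro card_mono) auto
  ultimately have c: "0 < c" "c \<le> 1" using assms by (auto simp: c_def)
  define a where "a m = principal_char g m - of_real c" for m
  have "(\<Sum>m<g. principal_char g m) = of_nat (card {m. m < g \<and> coprime m g})"
    by (simp add: principal_char_def of_bool_def sum.If_cases Int_def)
  then have z: "(\<Sum>m<g. a m) = 0" using assms by (simp add: a_def sum_subtractf c_def)
  have per: "a (m + g) = a m" for m
    using dchar_principal[of g] unfolding a_def dchar_def by metis
  have le: "norm (a m) \<le> 1" for m
  proof -
    have "a m = of_real (of_bool (coprime m g) - c)" by (simp add: a_def principal_char_def)
    then have "norm (a m) = \<bar>of_bool (coprime m g) - c\<bar>" by (simp only: norm_of_real)
    then show ?thesis using c by (cases "coprime m g") auto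
  qed
  have "((\<lambda>\<delta>. of_real \<delta> ^ Suc k * dser (principal_char g) k \<delta>) \<longlongrightarrow> of_real c * fact k) (at_right 0)" for k
  proof -
    have eq: "dser (principal_char g) k \<delta> = dser a k \<delta> + of_real (c * wt_sum k \<delta>)" if "\<delta> > 0" for \<delta>
    proof -
      have "(\<lambda>m. of_real c * complex_of_real (wt k \<delta> (real m))) sums (of_real c * of_real (wt_sum k \<delta>))"
        unfolding wt_sum_def by (intro sums_mult sums_of_real summable_sums summable_wt that)
      moreover have "(\<lambda>m. a m * complex_of_real (wt k \<delta> (real m))) sums dser a k \<delta>"
        unfolding dser_def by (intro summable_sums summable_norm_cancel[OF summable_dser[OF that le]])
      ultimately have "(\<lambda>m. a m * complex_of_real (wt k \<delta> (real m)) + of_real c * complex_of_real (wt k \<delta> (real m))) sums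
          (dser a k \<delta> + of_real (c * wt_sum k \<delta>))" by (simp add: sums_add)
      then have "(\<lambda>m. principal_char g m * complex_of_real (wt k \<delta> (real m))) sums (dser a k \<delta> + of_real (c * wt_sum k \<delta>))"
        by (simp add: a_def algebra_simps)
      then show ?thesis unfolding dser_def by (simp add: sums_iff)
    qed
    obtain C where C: "\<And>\<delta>. \<delta> > 0 \<Longrightarrow> norm (dser a k \<delta>) \<le> C"
      using dser_bounded_of_periodic[of a g k, OF per z le assms] by blast
    have "((\<lambda>\<delta>. of_real \<delta> ^ Suc k * dser a k \<delta>) \<longlongrightarrow> 0) (at_right 0)"
    proof (rule Lim_null_comparison)
      have "((\<lambda>\<delta>::real. \<delta> ^ Suc k * C) \<longlongrightarrow> 0 ^ Suc k * C) (at_right 0)" by (intro tendsto_intros)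
      then show "((\<lambda>\<delta>::real. \<delta> ^ Suc k * C) \<longlongrightarrow> 0) (at_right 0)" by simp
      show "\<forall>\<^sub>F \<delta> in at_right 0. norm (complex_of_real \<delta> ^ Suc k * dser a k \<delta>) \<le> \<delta> ^ Suc k * C"
        by (rule eventually_at_right_less[THEN eventually_mono])
           (use C in \<open>auto simp: norm_mult norm_power simp del: power_Suc intro!: mult_left_mono\<close>)
    qed
    moreover have "((\<lambda>\<delta>. of_real (\<delta> ^ (k + 1) * wt_sum k \<delta>) * complex_of_real c) \<longlongrightarrow> of_real (fact k) * of_real c) (at_right 0)"
      by (intro tendsto_intros wt_sum_scaled_tendsto)
    ultimately have "((\<lambda>\<delta>. of_real \<delta> ^ Suc k * dser a k \<delta> + of_real (\<delta> ^ (k + 1) * wt_sum k \<delta>) * complex_of_real c) \<longlongrightarrow>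
        0 + of_real (fact k) * of_real c) (at_right 0)" by (rule tendsto_add)
    then have "((\<lambda>\<delta>. of_real \<delta> ^ Suc k * dser a k \<delta> + of_real (\<delta> ^ (k + 1) * wt_sum k \<delta>) * complex_of_real c) \<longlongrightarrow>
        of_real c * fact k) (at_right 0)" by (simp add: mult.commute)
    then show ?thesis
    proof (rule Lim_transform_eventually)
      show "\<forall>\<^sub>F \<delta> in at_right 0. of_real \<delta> ^ Suc k * dser a k \<delta> + of_real (\<delta> ^ (k + 1) * wt_sum k \<delta>) * complex_of_real c =
          of_real \<delta> ^ Suc k * dser (principal_char g) k \<delta>"
        by (rule eventually_at_right_less[THEN eventually_mono]) (auto simp: eq algebra_simps)
    qed
  qed
  then show ?thesis using c by (intro exI[of _ "of_real c"]) auto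
qed

lemma mangoldt_principal_char_tendsto:
  assumes "g > 0"
  shows "((\<lambda>\<delta>. of_real \<delta> ^ Suc k * dser (\<lambda>m. mangoldt m * principal_char g m) k \<delta>) \<longlongrightarrow> fact k) (at_right 0)"
proof -
  obtain c :: complex where c: "c \<noteq> 0"
    "\<And>k. ((\<lambda>\<delta>. of_real \<delta> ^ Suc k * dser (principal_char g) k \<delta>) \<longlongrightarrow> c * fact k) (at_right 0)"
    using principal_char_tendsto[OF assms] by blast
  show ?thesis
    by (rule recurrence_tendsto[where L = "dser (principal_char g)" and c = c, OF _ c(2,1)])
       (rule dser_mangoldt_recurrence[OF dchar_mult[OF dchar_principal] norm_dchar_le[OF dchar_principal assms]])
qed

section \<open>The 3-4-1 inequality\<close>

text \<open>Multiplying the sum by \<open>1 - f p\<close> removes exactly the multiples of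
  \<open>p\<close>. In this form the Euler product needs only finite products.\<close>

lemma euler_sieve_has_sum:
  fixes f :: "nat \<Rightarrow> complex"
  assumes mult: "\<And>m n. f (m * n) = f m * f n" and "f 0 = 0" and S: "(f has_sum S) UNIV"
  shows "(f has_sum (S * (\<Prod>p | prime p \<and> p \<le> N. 1 - f p))) {m. m > 0 \<and> (\<forall>p. prime p \<longrightarrow> p \<le> N \<longrightarrow> \<not> p dvd m)}"
proof (induction N)
  case 0
  have "(f has_sum S) UNIV \<longleftrightarrow> (f has_sum S) {m. m > 0 \<and> (\<forall>p. prime p \<longrightarrow> p \<le> 0 \<longrightarrow> \<not> p dvd m)}"
    using \<open>f 0 = 0\<close> by (intro has_sum_cong_neutral) auto
  moreover have "{p::nat. prime p \<and> p \<le> 0} = {}" by auto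
  ultimately show ?case using S by (simp only: prod.empty mult_1_right)
next
  case (Suc N)
  define A where "A N = {m::nat. m > 0 \<and> (\<forall>p. prime p \<longrightarrow> p \<le> N \<longrightarrow> \<not> p dvd m)}" for N
  let ?P = "\<lambda>N. \<Prod>p | prime p \<and> p \<le> N. 1 - f p"
  have fin: "finite {p::nat. prime p \<and> p \<le> N}" by (rule finite_subset[of _ "{..N}"]) auto
  show ?case
  proof (cases "prime (Suc N)")
    case False
    then have "{p. prime p \<and> p \<le> Suc N} = {p. prime p \<and> p \<le> N}" "A (Suc N) = A N"
      unfolding A_def by (auto simp: le_Suc_eq)
    then show ?thesis using Suc unfolding A_def by simp
  next
    case True
    let ?p = "Suc N"
    have "{p. prime p \<and> p \<le> ?p} = insert ?p {p. prime p \<and> p \<le> N}" using True by (auto simp: le_Suc_eq)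
    then have P: "?P ?p = (1 - f ?p) * ?P N" using fin by simp
    have 1: "(f has_sum (S * ?P N)) (A N)" using Suc unfolding A_def .
    have "((\<lambda>m. f (?p * m)) has_sum (f ?p * (S * ?P N))) (A N)"
      unfolding mult by (intro has_sum_cmult_right 1)
    then have 2: "(f has_sum (f ?p * (S * ?P N))) ((*) ?p ` A N)"
      by (subst has_sum_reindex) (auto simp: o_def inj_on_def simp del: mult_Suc)
    have sub: "(*) ?p ` A N \<subseteq> A N"
    proof
      fix x assume "x \<in> (*) ?p ` A N"
      then obtain m where m: "m \<in> A N" "x = ?p * m" by blast
      have "\<not> p dvd x" if "prime p" "p \<le> N" for p
      proof
        assume "p dvd x"
        then have "p dvd ?p \<or> p dvd m" using m that by (simp only: prime_dvd_mult_iff)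
        moreover have "\<not> p dvd m" using m(1) that unfolding A_def by blast
        ultimately show False using that True primes_dvd_imp_eq[of p ?p] by auto
      qed
      moreover have "x > 0" using m unfolding A_def by simp
      ultimately show "x \<in> A N" unfolding A_def by blast
    qed
    have "A N - (*) ?p ` A N = A ?p"
    proof (intro equalityI subsetI)
      fix x assume x: "x \<in> A N - (*) ?p ` A N"
      have "\<not> ?p dvd x"
      proof
        assume "?p dvd x"
        then obtain m where m: "x = ?p * m" by blast
        have "m > 0" using x m unfolding A_def by (cases m) auto
        moreover have "\<not> p dvd m" if "prime p" "p \<le> N" for p
        proof
          assume "p dvd m"
          then have "p dvd x" using m by simp
          then show False using x that unfolding A_def by blast
        qed
        ultimately have "m \<in> A N" unfolding A_def by blast
        then show False using x m by blast
      qed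
      moreover have "\<not> p dvd x" if "prime p" "p \<le> N" for p using x that unfolding A_def by blast
      moreover have "x > 0" using x unfolding A_def by blast
      ultimately show "x \<in> A ?p" unfolding A_def le_Suc_eq by blast
    next
      fix x assume x: "x \<in> A ?p"
      then have "\<not> ?p dvd x" using True unfolding A_def by blast
      then have "x \<notin> (*) ?p ` A N" by (metis dvd_triv_left imageE)
      moreover have "x \<in> A N" using x unfolding A_def le_Suc_eq by blast
      ultimately show "x \<in> A N - (*) ?p ` A N" by blast
    qed
    with has_sum_Diff[OF 1 2 sub] have "(f has_sum (S * ?P N - f ?p * (S * ?P N))) (A ?p)" by simp
    then show ?thesis unfolding P A_def by (simp add: algebra_simps)
  qed
qed

text \<open>Apart from 1, everything that survives the sieve up to \<open>N\<close> exceeds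
  \<open>N\<close>, so it is covered by a tail of an absolutely convergent series.\<close>

lemma euler_product_tendsto:
  fixes f :: "nat \<Rightarrow> complex"
  assumes mult: "\<And>m n. f (m * n) = f m * f n" and "f 0 = 0" "f 1 = 1" and S: "(f has_sum S) UNIV"
  shows "(\<lambda>N. S * (\<Prod>p | prime p \<and> p \<le> N. 1 - f p)) \<longlonglongrightarrow> 1"
proof (rule Lim_transform)
  have ab: "(\<lambda>m. norm (f m)) summable_on UNIV"
    using S by (simp add: summable_on_iff_abs_summable_on_complex[symmetric] has_sum_imp_summable)
  define T where "T = (\<Sum>m. norm (f m))"
  have "(\<lambda>m. norm (f m)) sums T" unfolding T_def using summable_on_imp_summable[OF ab] by (rule summable_sums)
  then have lim: "(\<lambda>N. T - (\<Sum>m<Suc N. norm (f m))) \<longlonglongrightarrow> 0"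
    using tendsto_diff[OF tendsto_const[of T] LIMSEQ_Suc] unfolding sums_def by fastforce
  show "(\<lambda>_. 1) \<longlonglongrightarrow> (1::complex)" by simp
  show "(\<lambda>N. S * (\<Prod>p | prime p \<and> p \<le> N. 1 - f p) - 1) \<longlonglongrightarrow> 0"
  proof (rule Lim_null_comparison[OF _ lim], intro always_eventually allI)
    fix N
    let ?A = "{m::nat. m > 0 \<and> (\<forall>p. prime p \<longrightarrow> p \<le> N \<longrightarrow> \<not> p dvd m)}"
    let ?X = "S * (\<Prod>p | prime p \<and> p \<le> N. 1 - f p)"
    have "(f has_sum (?X - f 1)) (?A - {1})"
      using euler_sieve_has_sum[OF mult \<open>f 0 = 0\<close> S]
      by (rule has_sum_Diff) (auto intro: has_sum_finiteI)
    moreover have sub: "?A - {1} \<subseteq> {N<..}"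
    proof
      fix m assume m: "m \<in> ?A - {1}"
      then obtain p where "prime p" "p dvd m" using prime_factor_nat[of m] by auto
      then show "m \<in> {N<..}" using m dvd_imp_le[of p m] by force
    qed
    moreover have "(\<lambda>m. norm (f m)) summable_on (?A - {1})" by (rule summable_on_subset[OF ab]) simp
    ultimately have "norm (?X - f 1) \<le> infsum (\<lambda>m. norm (f m)) (?A - {1})"
      by (intro norm_has_sum_bound[OF has_sum_infsum])
    also have "\<dots> \<le> infsum (\<lambda>m. norm (f m)) {N<..}"
      using sub by (intro infsum_mono2 summable_on_subset[OF ab]) auto
    also have "\<dots> = T - (\<Sum>m<Suc N. norm (f m))"
    proof -
      have "((\<lambda>m. norm (f m)) has_sum T) UNIV"
        using has_sum_infsum[OF ab] has_sum_imp_sums[OF has_sum_infsum[OF ab]] unfolding T_def by (simp add: sums_iff)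
      from has_sum_Diff[OF this has_sum_finite[of "{..<Suc N}"]]
      have "((\<lambda>m. norm (f m)) has_sum (T - (\<Sum>m<Suc N. norm (f m)))) (UNIV - {..<Suc N})" by simp
      moreover have "UNIV - {..<Suc N} = {N<..}" by auto
      ultimately show ?thesis by (simp add: infsumI)
    qed
    finally show "norm (?X - 1) \<le> T - (\<Sum>m<Suc N. norm (f m))"
      using \<open>f 1 = 1\<close> by simp
  qed
qed

text \<open>Real part of the Taylor series of \<open>Ln\<close>; the summand at \<open>n = 0\<close>
  is a division by zero and hence 0.\<close>

lemma ln_norm_one_minus_sums:
  fixes w :: complex
  assumes "norm w < 1"
  shows "(\<lambda>n. - Re (w ^ n) / real n) sums ln (norm (1 - w))"
proof -
  have "(\<lambda>n. (-1) ^ Suc n / of_nat n * (- w) ^ n) sums Ln (1 + - w)"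
    using assms by (intro Ln_series) auto
  then have "(\<lambda>n. Re ((-1) ^ Suc n / of_nat n * (- w) ^ n)) sums Re (Ln (1 + - w))"
    by (rule sums_Re)
  moreover have "Re ((-1) ^ Suc n / of_nat n * (- w) ^ n) = - Re (w ^ n) / real n" for n
  proof -
    have "(-1) ^ Suc n / of_nat n * (- w) ^ n = - (w ^ n) / of_real (real n)"
      by (subst power_minus) (simp add: power_mult_distrib[symmetric])
    then show ?thesis by (simp only: Re_divide_of_real) simp
  qed
  moreover have "Re (Ln (1 + - w)) = ln (norm (1 - w))" using assms by (subst Re_Ln) auto
  ultimately show ?thesis by (simp only:)
qed

lemma three_four_one:
  fixes z :: complex
  assumes x: "0 \<le> x" "x < 1" and z: "norm z = 1 \<or> z = 0"
  shows "norm (1 - complex_of_real x) ^ 3 * norm (1 - z * of_real x) ^ 4 * norm (1 - z\<^sup>2 * of_real x) \<le> 1"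
proof (cases "z = 0")
  case True
  have "norm (1 - complex_of_real x) = 1 - x" using x by (metis abs_of_nonneg diff_ge_0_iff_ge less_imp_le norm_of_real of_real_1 of_real_diff)
  then show ?thesis using True x by (simp add: power_le_one)
next
  case False
  then have z1: "norm z = 1" using z by simp
  define w0 w1 w2 where "w0 = complex_of_real x" and "w1 = z * of_real x" and "w2 = z\<^sup>2 * of_real x"
  have n: "norm w0 < 1" "norm w1 < 1" "norm w2 < 1"
    using x z1 by (auto simp: w0_def w1_def w2_def norm_mult norm_power)
  then have pos: "norm (1 - w0) > 0" "norm (1 - w1) > 0" "norm (1 - w2) > 0" by auto
  have sm: "(\<lambda>n. 3 * (- Re (w0 ^ n) / real n) + 4 * (- Re (w1 ^ n) / real n) + (- Re (w2 ^ n) / real n)) sums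
      (3 * ln (norm (1 - w0)) + 4 * ln (norm (1 - w1)) + ln (norm (1 - w2)))"
    by (intro sums_add sums_mult ln_norm_one_minus_sums n)
  have neg: "3 * (- Re (w0 ^ n) / real n) + 4 * (- Re (w1 ^ n) / real n) + (- Re (w2 ^ n) / real n) \<le> 0" for n
  proof -
    define c where "c = Re (z ^ n)"
    have "norm (z ^ n) = 1" using z1 by (simp add: norm_power)
    then have "(Re (z ^ n))\<^sup>2 + (Im (z ^ n))\<^sup>2 = 1" by (metis cmod_power2 power_one)
    then have "Re ((z ^ n)\<^sup>2) = 2 * c\<^sup>2 - 1" by (simp add: c_def power2_eq_square)
    then have c2: "Re ((z\<^sup>2) ^ n) = 2 * c\<^sup>2 - 1" by (simp flip: power_mult add: mult.commute)
    have r: "Re (w0 ^ n) = x ^ n" "Re (w1 ^ n) = c * x ^ n" "Re (w2 ^ n) = (2 * c\<^sup>2 - 1) * x ^ n"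
      using c2 unfolding w0_def w1_def w2_def power_mult_distrib of_real_power[symmetric]
      by (auto simp: c_def simp del: of_real_power)
    have "3 * (- Re (w0 ^ n) / real n) + 4 * (- Re (w1 ^ n) / real n) + (- Re (w2 ^ n) / real n)
       = - (2 * (1 + c)\<^sup>2 * x ^ n) / real n"
      unfolding r by (simp add: divide_inverse algebra_simps power2_eq_square)
    also have "\<dots> \<le> 0" using x by (intro divide_nonpos_nonneg) auto
    finally show ?thesis .
  qed
  have "3 * ln (norm (1 - w0)) + 4 * ln (norm (1 - w1)) + ln (norm (1 - w2)) \<le> 0"
    by (rule sums_le[OF neg sm sums_zero])
  moreover have "ln (norm (1 - w0) ^ 3 * norm (1 - w1) ^ 4 * norm (1 - w2)) =
     3 * ln (norm (1 - w0)) + 4 * ln (norm (1 - w1)) + ln (norm (1 - w2))"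
    using pos by (simp add: ln_mult ln_realpow)
  ultimately show ?thesis using pos unfolding w0_def w1_def w2_def
    by (metis ln_le_zero_iff mult_pos_pos zero_less_power)
qed

text \<open>Each series times its finite Euler product tends to 1, while the local inequality bounds
  the three products combined by 1. Full zeta replaces the principal series: at primes dividing
  \<open>q\<close> its factor is at most 1 anyway.\<close>

lemma dser_three_four_one:
  assumes \<psi>: "dchar q \<psi>" and "q > 0" "\<delta> > 0"
  shows "wt_sum 0 \<delta> ^ 3 * norm (dser \<psi> 0 \<delta>) ^ 4 * norm (dser (\<lambda>m. (\<psi> m)\<^sup>2) 0 \<delta>) \<ge> 1"
proof -
  have hs: "((\<lambda>m. a m * of_real (wt 0 \<delta> (real m))) has_sum dser a 0 \<delta>) UNIV" if "\<And>m. norm (a m) \<le> 1" for a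
    using that by (intro dser_has_sum \<open>\<delta> > 0\<close>)
  have le: "norm (\<psi> m) \<le> 1" for m using norm_dchar_le assms by blast
  have m: "wt 0 \<delta> (real (m * n)) = wt 0 \<delta> (real m) * wt 0 \<delta> (real n)" for m n
    by (simp add: wt_def powr_mult)
  have w1: "wt 0 \<delta> 1 = 1" by (simp add: wt_def)
  have E: "(\<lambda>N. dser a 0 \<delta> * (\<Prod>p | prime p \<and> p \<le> N. 1 - a p * of_real (wt 0 \<delta> (real p)))) \<longlonglongrightarrow> 1"
    if "\<And>m n. a (m * n) = a m * a n" "a 1 = 1" "\<And>m. norm (a m) \<le> 1" for a
    using that w1 hs[of a] by (intro euler_product_tendsto) (auto simp: m simp del: of_nat_mult)
  let ?P = "\<lambda>a N. \<Prod>p | prime p \<and> p \<le> N. 1 - a p * complex_of_real (wt 0 \<delta> (real p))"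
  have E0: "(\<lambda>N. dser (\<lambda>_. 1) 0 \<delta> * ?P (\<lambda>_. 1) N) \<longlonglongrightarrow> 1" by (intro E) auto
  have E1: "(\<lambda>N. dser \<psi> 0 \<delta> * ?P \<psi> N) \<longlonglongrightarrow> 1"
    using le dchar_1[OF \<psi>] by (intro E) (auto simp: dchar_mult[OF \<psi>])
  have E2: "(\<lambda>N. dser (\<lambda>m. (\<psi> m)\<^sup>2) 0 \<delta> * ?P (\<lambda>m. (\<psi> m)\<^sup>2) N) \<longlonglongrightarrow> 1"
    using le dchar_1[OF \<psi>] by (intro E) (auto simp: dchar_mult[OF \<psi>] power_mult_distrib norm_power power_le_one)
  have Z: "norm (dser (\<lambda>_. 1) 0 \<delta>) = wt_sum 0 \<delta>"
  proof -
    have "(\<lambda>m. complex_of_real (wt 0 \<delta> (real m))) sums of_real (wt_sum 0 \<delta>)"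
      unfolding wt_sum_def by (intro sums_of_real summable_sums summable_wt \<open>\<delta> > 0\<close>)
    then have "dser (\<lambda>_. 1) 0 \<delta> = of_real (wt_sum 0 \<delta>)" unfolding dser_def by (simp add: sums_iff)
    moreover have "wt_sum 0 \<delta> \<ge> 0" unfolding wt_sum_def
      using summable_wt[OF \<open>\<delta> > 0\<close>] by (intro suminf_nonneg wt_nonneg)
    ultimately show ?thesis by simp
  qed
  let ?R = "wt_sum 0 \<delta> ^ 3 * norm (dser \<psi> 0 \<delta>) ^ 4 * norm (dser (\<lambda>m. (\<psi> m)\<^sup>2) 0 \<delta>)"
  have "(\<lambda>N. norm (dser (\<lambda>_. 1) 0 \<delta> * ?P (\<lambda>_. 1) N) ^ 3 * norm (dser \<psi> 0 \<delta> * ?P \<psi> N) ^ 4 *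
     norm (dser (\<lambda>m. (\<psi> m)\<^sup>2) 0 \<delta> * ?P (\<lambda>m. (\<psi> m)\<^sup>2) N)) \<longlonglongrightarrow> norm (1::complex) ^ 3 * norm (1::complex) ^ 4 * norm (1::complex)"
    by (intro tendsto_mult tendsto_power tendsto_norm E0 E1 E2)
  then have lim: "(\<lambda>N. norm (dser (\<lambda>_. 1) 0 \<delta> * ?P (\<lambda>_. 1) N) ^ 3 * norm (dser \<psi> 0 \<delta> * ?P \<psi> N) ^ 4 *
     norm (dser (\<lambda>m. (\<psi> m)\<^sup>2) 0 \<delta> * ?P (\<lambda>m. (\<psi> m)\<^sup>2) N)) \<longlonglongrightarrow> 1" by simp
  have "norm (dser (\<lambda>_. 1) 0 \<delta> * ?P (\<lambda>_. 1) N) ^ 3 * norm (dser \<psi> 0 \<delta> * ?P \<psi> N) ^ 4 *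
     norm (dser (\<lambda>m. (\<psi> m)\<^sup>2) 0 \<delta> * ?P (\<lambda>m. (\<psi> m)\<^sup>2) N) \<le> ?R" for N
  proof -
    have R0: "?R \<ge> 0" unfolding Z[symmetric] by (intro mult_nonneg_nonneg) auto
    have "norm (?P (\<lambda>_. 1) N) ^ 3 * norm (?P \<psi> N) ^ 4 * norm (?P (\<lambda>m. (\<psi> m)\<^sup>2) N) =
      (\<Prod>p | prime p \<and> p \<le> N. norm (1 - complex_of_real (wt 0 \<delta> (real p))) ^ 3 *
         norm (1 - \<psi> p * of_real (wt 0 \<delta> (real p))) ^ 4 * norm (1 - (\<psi> p)\<^sup>2 * of_real (wt 0 \<delta> (real p))))"
      by (simp add: prod_norm[symmetric] prod_power_distrib[symmetric] prod.distrib)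
    also have "\<dots> \<le> 1"
    proof (intro prod_le_1 conjI three_four_one)
      fix p assume p: "p \<in> {p. prime p \<and> p \<le> N}"
      then have "p > 1" using prime_gt_1_nat by blast
      then show "wt 0 \<delta> (real p) < 1"
        unfolding wt_def using \<open>\<delta> > 0\<close> by (simp add: powr_less_one)
      show "norm (\<psi> p) = 1 \<or> \<psi> p = 0" using norm_dchar[OF \<psi> \<open>q > 0\<close>] dchar_eq_0_iff[OF \<psi>] by blast
    qed (auto simp: wt_nonneg)
    finally have "norm (?P (\<lambda>_. 1) N) ^ 3 * norm (?P \<psi> N) ^ 4 * norm (?P (\<lambda>m. (\<psi> m)\<^sup>2) N) \<le> 1" .
    from mult_left_mono[OF this R0] show ?thesis
      by (simp add: norm_mult power_mult_distrib Z mult_ac)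
  qed
  with lim show ?thesis by (intro Lim_bounded) auto
qed

section \<open>Real characters\<close>

lemma sum_divisors_prime_power_mult:
  fixes a :: "nat \<Rightarrow> real"
  assumes mult: "\<And>m n. a (m * n) = a m * a n" and p: "prime p" "\<not> p dvd m" and "m > 0"
  shows "(\<Sum>d | d dvd p ^ e * m. a d) = (\<Sum>i\<le>e. a (p ^ i)) * (\<Sum>d | d dvd m. a d)"
proof -
  have bij: "bij_betw (\<lambda>(i, d). p ^ i * d) ({..e} \<times> {d. d dvd m}) {d. d dvd p ^ e * m}"
      unfolding bij_betw_def
    proof
      show "inj_on (\<lambda>(i, d). p ^ i * d) ({..e} \<times> {d. d dvd m})"
      proof (rule inj_onI, clarify)
        fix i d j d' assume *: "d dvd m" "d' dvd m" "p ^ i * d = p ^ j * d'"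
        have nd: "\<not> p dvd d" "\<not> p dvd d'" using * p dvd_trans by blast+
        have "multiplicity p (p ^ i * d) = i" if "\<not> p dvd d" for i d
          using that p multiplicity_prime_elem_times_other by (intro multiplicity_eqI) (auto simp: power_Suc2)
        then have "i = j" using * nd by metis
        moreover have "p > 0" using p prime_gt_0_nat by blast
        ultimately show "i = j \<and> d = d'" using * by simp
      qed
      show "(\<lambda>(i, d). p ^ i * d) ` ({..e} \<times> {d. d dvd m}) = {d. d dvd p ^ e * m}"
      proof (intro equalityI subsetI)
        fix x assume "x \<in> (\<lambda>(i, d). p ^ i * d) ` ({..e} \<times> {d. d dvd m})"
        then show "x \<in> {d. d dvd p ^ e * m}" by (auto intro!: mult_dvd_mono le_imp_power_dvd)
      next
        fix x assume "x \<in> {d. d dvd p ^ e * m}"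
        then obtain u v where "x = u * v" "u dvd p ^ e" "v dvd m"
          using division_decomp[of x "p ^ e" m] by auto
        moreover from this obtain i where "i \<le> e" "u = p ^ i" using divides_primepow_nat[OF p(1)] by blast
        ultimately show "x \<in> (\<lambda>(i, d). p ^ i * d) ` ({..e} \<times> {d. d dvd m})" by force
      qed
    qed
  have "(\<Sum>i\<le>e. a (p ^ i)) * (\<Sum>d | d dvd m. a d) = (\<Sum>z\<in>{..e} \<times> {d. d dvd m}. a (case z of (i, d) \<Rightarrow> p ^ i * d))"
    by (simp add: sum_product sum.cartesian_product mult case_prod_unfold)
  also have "\<dots> = (\<Sum>d | d dvd p ^ e * m. a d)" by (rule sum.reindex_bij_betw[OF bij])
  finally show ?thesis by simp
qed

lemma sum_powers_sign:
  fixes t :: real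
  assumes "t \<in> {-1, 0, 1}"
  shows "(\<Sum>i\<le>e. t ^ i) \<ge> 0" and "even e \<Longrightarrow> (\<Sum>i\<le>e. t ^ i) \<ge> 1"
proof -
  have "(\<Sum>i\<le>e. (-1 :: real) ^ i) = of_bool (even e)" by (induction e) auto
  moreover have "(\<Sum>i\<le>e. (0 :: real) ^ i) = 1" by (induction e) auto
  ultimately show "(\<Sum>i\<le>e. t ^ i) \<ge> 0" and "even e \<Longrightarrow> (\<Sum>i\<le>e. t ^ i) \<ge> 1"
    using assms by auto
qed

text \<open>The divisor sum is multiplicative, and at a prime power it is 1 + t + ... + t ^ e with t
  in {-1, 0, 1}. The induction strips all powers of one prime.\<close>

lemma sum_divisors_real_char:
  fixes a :: "nat \<Rightarrow> real"
  assumes mult: "\<And>m n. a (m * n) = a m * a n" and a1: "a 1 = 1" and v: "\<And>m. a m \<in> {-1, 0, 1}" and "n > 0"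
  shows "(\<Sum>d | d dvd n. a d) \<ge> 0" and "(\<Sum>d | d dvd n\<^sup>2. a d) \<ge> 1"
proof -
  have pw: "a (p ^ i) = a p ^ i" for p i by (induction i) (auto simp: mult a1[simplified])
  have "(\<Sum>d | d dvd n. a d) \<ge> 0 \<and> (\<Sum>d | d dvd n\<^sup>2. a d) \<ge> 1"
    using \<open>n > 0\<close>
  proof (induction n rule: less_induct)
    case (less n)
    show ?case
    proof (cases "n = 1")
      case True
      then show ?thesis using a1 by simp
    next
      case False
      then obtain p where p: "prime p" "p dvd n" using prime_factor_nat by blast
      have "n \<noteq> 0" "\<not> is_unit p" using less.prems p by auto
      then obtain m where m: "n = p ^ multiplicity p n * m" "\<not> p dvd m"
        using multiplicity_decompose'[of n p] by metis
      define e where "e = multiplicity p n"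
      have n: "n = p ^ e * m" using m(1) unfolding e_def .
      have m0: "m > 0" using \<open>n \<noteq> 0\<close> n by (cases m) auto
      have "p > 1" using p prime_gt_1_nat by blast
      moreover have "e > 0" using m(2) n p by (cases e) auto
      ultimately have "p ^ e > 1" by (metis one_less_power)
      then have "m < n" using n m0 by simp
      then have IH: "(\<Sum>d | d dvd m. a d) \<ge> 0" "(\<Sum>d | d dvd m\<^sup>2. a d) \<ge> 1" using less.IH m0 by auto
      have "(\<Sum>d | d dvd n. a d) = (\<Sum>i\<le>e. a p ^ i) * (\<Sum>d | d dvd m. a d)"
        unfolding n by (subst sum_divisors_prime_power_mult[OF mult p(1) m(2) m0]) (simp add: pw)
      also have "\<dots> \<ge> 0" using IH sum_powers_sign(1)[OF v] by simp
      finally have 1: "(\<Sum>d | d dvd n. a d) \<ge> 0" .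
      have nd: "\<not> p dvd m\<^sup>2" using m(2) p(1) prime_dvd_power by blast
      have n2: "n\<^sup>2 = p ^ (2 * e) * m\<^sup>2" unfolding n by (simp add: power_mult_distrib power_mult[symmetric] mult.commute)
      have "(\<Sum>d | d dvd n\<^sup>2. a d) = (\<Sum>i\<le>2 * e. a p ^ i) * (\<Sum>d | d dvd m\<^sup>2. a d)"
        unfolding n2 using m0 by (subst sum_divisors_prime_power_mult[OF mult p(1) nd]) (simp_all add: pw)
      also have "\<dots> \<ge> 1 * 1" 
      proof (intro mult_mono IH)
        show "1 \<le> (\<Sum>i\<le>2 * e. a p ^ i)" by (rule sum_powers_sign(2)[OF v]) simp
        then show "0 \<le> (\<Sum>i\<le>2 * e. a p ^ i)" by linarith
      qed simp
      finally show ?thesis using 1 by simp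
    qed
  qed
  then show "(\<Sum>d | d dvd n. a d) \<ge> 0" and "(\<Sum>d | d dvd n\<^sup>2. a d) \<ge> 1" by auto
qed


text \<open>The inequality of arithmetic and geometric means for the terms \<open>i\<close> and
  \<open>m - i\<close>. Writing the ratio as a square keeps roots out of the bound.\<close>

lemma geometric_sum_ge:
  fixes y :: real
  shows "(\<Sum>i\<le>m. (y\<^sup>2) ^ i) \<ge> real (Suc m) * y ^ m"
proof -
  have "(\<Sum>i\<le>m. (y\<^sup>2) ^ (m - i)) = (\<Sum>i\<le>m. (y\<^sup>2) ^ i)"
    by (rule sum.reindex_bij_witness[of _ "\<lambda>i. m - i" "\<lambda>i. m - i"]) auto
  then have "2 * (\<Sum>i\<le>m. (y\<^sup>2) ^ i) = (\<Sum>i\<le>m. (y\<^sup>2) ^ i + (y\<^sup>2) ^ (m - i))" by (simp add: sum.distrib)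
  also have "\<dots> \<ge> (\<Sum>i\<le>m. 2 * y ^ m)"
  proof (intro sum_mono)
    fix i assume "i \<in> {..m}"
    then have "y ^ i * y ^ (m - i) = y ^ m" by (simp flip: power_add)
    moreover have "0 \<le> (y ^ i - y ^ (m - i))\<^sup>2" by simp
    moreover have "(y ^ i - y ^ (m - i))\<^sup>2 = (y\<^sup>2) ^ i + (y\<^sup>2) ^ (m - i) - 2 * (y ^ i * y ^ (m - i))"
      by (simp add: power2_eq_square algebra_simps power_mult_distrib)
    ultimately show "2 * y ^ m \<le> (y\<^sup>2) ^ i + (y\<^sup>2) ^ (m - i)" by linarith
  qed
  finally show ?thesis by simp
qed

text \<open>In Monsky's proof that \<open>L(1)\<close> is nonzero, summing the character against these weights gives
  \<open>L(1) / (1 - x)\<close> minus a Lambert series that is unbounded as \<open>x\<close> tends to \<open>1\<close>.\<close>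

definition monsky :: "real \<Rightarrow> nat \<Rightarrow> real" where
  "monsky x m = 1 / (real m * (1 - x)) - x ^ m / (1 - x ^ m)"

text \<open>These are the hypotheses of Abel summation, together with the value of the first weight.
  After division by \<open>1 - x\<close> the denominators become geometric sums \<open>s m\<close>,
  which \<open>geometric_sum_ge\<close> bounds from below.\<close>

lemma monsky_props:
  assumes y: "0 < y" "y < 1" and x: "x = y\<^sup>2" and "m \<ge> 1"
  shows "monsky x m \<ge> 0" "monsky x (Suc m) \<le> monsky x m" "monsky x 1 = 1"
proof -
  have x01: "0 < x" "x < 1" using y x by (auto simp: power_less_one_iff)
  define s where "s m = (\<Sum>i<m. x ^ i)" for m
  have s: "1 - x ^ m = (1 - x) * s m" for m
    unfolding s_def using one_diff_power_eq[of x m] by simp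
  obtain l where l: "m = Suc l" using \<open>m \<ge> 1\<close> by (cases m) auto
  have s1: "s m \<ge> real m * y ^ l" "s (Suc m) \<ge> real (Suc m) * y ^ m"
    unfolding s_def x l lessThan_Suc_atMost using geometric_sum_ge by blast+
  have "y ^ m \<le> y ^ l" using y l by (intro power_decreasing) auto
  then have s2: "s m \<ge> real m * y ^ m" using s1(1) mult_left_mono[of "y ^ m" "y ^ l" "real m"] by linarith
  have pos: "real m * y ^ m > 0" "real (Suc m) * y ^ m > 0" using y \<open>m \<ge> 1\<close> by auto
  then have sp: "s m > 0" "s (Suc m) > 0" using s1(2) s2 by linarith+
  have xm: "x ^ m = y ^ m * y ^ m" unfolding x by (simp add: power_mult[symmetric] power_add[symmetric] mult_2)
  have "y ^ m \<le> 1" using y by (intro power_le_one) auto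
  have e: "monsky x m = (1 / real m - x ^ m / s m) / (1 - x)"
    unfolding monsky_def s by (simp add: diff_divide_distrib mult.commute)
  have e': "monsky x (Suc m) = (1 / real (Suc m) - x ^ Suc m / s (Suc m)) / (1 - x)"
    unfolding monsky_def s by (simp add: diff_divide_distrib mult.commute)
  have "real m * x ^ m \<le> real m * y ^ m" unfolding xm using y \<open>y ^ m \<le> 1\<close> by (intro mult_left_mono) (auto simp: mult_left_le)
  then have "real m * x ^ m \<le> s m" using s2 by linarith
  then have "x ^ m / s m \<le> 1 / real m" using sp \<open>m \<ge> 1\<close> by (simp add: field_simps)
  then show "monsky x m \<ge> 0" unfolding e using x01 by simp
  have ss: "s (Suc m) = 1 + x * s m" unfolding s_def sum.lessThan_Suc_shift by (simp add: sum_distrib_left)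
  \<comment> \<open>Monotonicity comes down to m (m + 1) x ^ m \<le> s m * s (Suc m), the product of
    the two mean inequalities with x = y * y.\<close>
  have "(real m * y ^ m) * (real (Suc m) * y ^ m) \<le> s m * s (Suc m)"
    using s2 s1(2) pos sp by (intro mult_mono) auto
  then have *: "real m * real (Suc m) * x ^ m \<le> s m * s (Suc m)" unfolding xm by (simp add: mult_ac)
  have "x ^ m / s m - x ^ Suc m / s (Suc m) = x ^ m * (s (Suc m) - x * s m) / (s m * s (Suc m))"
    using sp by (simp add: field_simps)
  also have "\<dots> = x ^ m / (s m * s (Suc m))" unfolding ss by simp
  also have "\<dots> \<le> 1 / (real m * real (Suc m))"
  proof -
    have "u / A \<le> 1 / B" if "B * u \<le> A" "0 < A" "0 < B" for u A B :: real
      using that by (simp add: field_simps)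
    from this[OF *] show ?thesis using sp \<open>m \<ge> 1\<close> by simp
  qed
  also have "\<dots> = 1 / real m - 1 / real (Suc m)" using \<open>m \<ge> 1\<close> by (simp add: field_simps)
  finally show "monsky x (Suc m) \<le> monsky x m" unfolding e e' using x01
    by (intro divide_right_mono) auto
  show "monsky x 1 = 1" unfolding monsky_def using x01 by (simp add: field_simps)
qed

text \<open>Expanding each term as a geometric series and collecting equal exponents gives a power
  series with the divisor sums as coefficients. These are nonnegative, so the squares up to the
  square of \<open>J\<close> alone give the bound.\<close>

lemma lambert_series_lower_bound:
  fixes a :: "nat \<Rightarrow> real"
  assumes mult: "\<And>m n. a (m * n) = a m * a n" and a1: "a 1 = 1" and v: "\<And>m. a m \<in> {-1, 0, 1}"
    and x: "0 < x" "x < 1"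
  obtains S where "(\<lambda>m. a m * (x ^ m / (1 - x ^ m))) sums S" "S \<ge> real J * x ^ J\<^sup>2"
proof -
  have le: "\<bar>a m\<bar> \<le> 1" for m using v[of m] by auto
  have row: "((\<lambda>j. c * x ^ (m * j)) has_sum c * (x ^ m / (1 - x ^ m))) {0<..}" if "m > 0" for c m
  proof -
    have xm: "norm (x ^ m) < 1" using x that by (auto simp: power_less_one_iff)
    have "(\<lambda>j. (x ^ m) ^ Suc j) sums (x ^ m * (1 / (1 - x ^ m)))"
      unfolding power_Suc by (intro sums_mult geometric_sums xm)
    then have "((\<lambda>j. (x ^ m) ^ Suc j) has_sum (x ^ m / (1 - x ^ m))) UNIV"
      using x by (intro sums_nonneg_imp_has_sum) auto
    also have "?this \<longleftrightarrow> ((\<lambda>j. x ^ (m * j)) has_sum (x ^ m / (1 - x ^ m))) {0<..}"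
      by (rule has_sum_reindex_bij_witness[of _ "\<lambda>j. j - 1" Suc]) (auto simp: power_mult power_add)
    finally show ?thesis by (rule has_sum_cmult_right)
  qed
  have sumG: "(\<lambda>m. x ^ m / (1 - x ^ m)) summable_on {0<..}"
  proof (rule summable_on_comparison_test)
    have "summable (\<lambda>m. norm (x ^ m / (1 - x)))"
      using x by (simp add: summable_divide summable_geometric)
    then have "(\<lambda>m. x ^ m / (1 - x)) summable_on UNIV" by (rule norm_summable_imp_summable_on)
    then show "(\<lambda>m. x ^ m / (1 - x)) summable_on {0<..}" by (rule summable_on_subset) simp
    fix m :: nat assume "m \<in> {0<..}"
    then have "x ^ m \<le> x ^ 1" using x by (intro power_decreasing) auto
    then show "x ^ m / (1 - x ^ m) \<le> x ^ m / (1 - x)" "0 \<le> x ^ m / (1 - x ^ m)"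
      using x by (auto intro!: divide_left_mono mult_pos_pos)
  qed
  have "(\<lambda>(m, j). 1 * x ^ (m * j)) summable_on ({0<..} \<times> {0<..})"
    using row[of _ 1] sumG x by (intro summable_on_SigmaI[where g = "\<lambda>m. x ^ m / (1 - x ^ m)"]) auto
  then have "(\<lambda>z. norm (case z of (m, j) \<Rightarrow> a m * x ^ (m * j))) summable_on ({0<..} \<times> {0<..})"
    by (rule summable_on_comparison_test) (use x le in \<open>auto simp: abs_mult mult_left_le_one_le\<close>)
  then have "(\<lambda>(m, j). a m * x ^ (m * j)) summable_on ({0<..} \<times> {0<..})" by (rule abs_summable_summable)
  then obtain S where S: "((\<lambda>(m, j). a m * x ^ (m * j)) has_sum S) ({0<..} \<times> {0<..})"
    by (auto simp: summable_on_def)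
  have "((\<lambda>m. a m * (x ^ m / (1 - x ^ m))) has_sum S) {0<..}"
    using has_sum_SigmaD[OF S, of "\<lambda>m. a m * (x ^ m / (1 - x ^ m))"] row by simp
  \<comment> \<open>At \<open>m = 0\<close> the term divides by zero and is 0.\<close>
  also have "?this \<longleftrightarrow> ((\<lambda>m. a m * (x ^ m / (1 - x ^ m))) has_sum S) UNIV"
    by (intro has_sum_cong_neutral) auto
  finally have 1: "(\<lambda>m. a m * (x ^ m / (1 - x ^ m))) sums S" by (rule has_sum_imp_sums)
  have "((\<lambda>(m, j). a m * x ^ (m * j)) has_sum S) ({0<..} \<times> {0<..}) \<longleftrightarrow>
      ((\<lambda>(n, d). a d * x ^ n) has_sum S) (SIGMA n:{0<..}. {d. d dvd n})"
    by (rule has_sum_reindex_bij_witness[of _ "\<lambda>(n, d). (d, n div d)" "\<lambda>(d, e). (d * e, d)"])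
       (auto elim!: dvdE)
  with S have "((\<lambda>(n, d). a d * x ^ n) has_sum S) (SIGMA n:{0<..}. {d. d dvd n})" by simp
  then have 2: "((\<lambda>n. (\<Sum>d | d dvd n. a d) * x ^ n) has_sum S) {0<..}"
    by (rule has_sum_SigmaD) (auto simp: sum_distrib_right intro!: has_sum_finiteI)
  have "real J * x ^ J\<^sup>2 = (\<Sum>k\<in>{1..J}. 1 * x ^ J\<^sup>2)" by simp
  also have "\<dots> \<le> (\<Sum>k\<in>{1..J}. (\<Sum>d | d dvd k\<^sup>2. a d) * x ^ k\<^sup>2)"
  proof (intro sum_mono mult_mono)
    fix k assume k: "k \<in> {1..J}"
    show "1 \<le> (\<Sum>d | d dvd k\<^sup>2. a d)" using k by (intro sum_divisors_real_char(2) mult a1 v) auto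
    then show "0 \<le> (\<Sum>d | d dvd k\<^sup>2. a d)" by linarith
    show "x ^ J\<^sup>2 \<le> x ^ k\<^sup>2" using k x by (intro power_decreasing power_mono) auto
  qed (use x in auto)
  also have "\<dots> = (\<Sum>n\<in>(\<lambda>k. k\<^sup>2) ` {1..J}. (\<Sum>d | d dvd n. a d) * x ^ n)"
    by (subst sum.reindex) (auto simp: inj_on_def)
  also have "\<dots> \<le> S"
  proof (rule finite_sum_le_has_sum[OF 2])
    fix n assume "n \<in> {0<..} - (\<lambda>k. k\<^sup>2) ` {1..J}"
    then have "0 \<le> (\<Sum>d | d dvd n. a d)" by (intro sum_divisors_real_char(1) mult a1 v) auto
    then show "0 \<le> (\<Sum>d | d dvd n. a d) * x ^ n" using x by simp
  qed auto
  finally show ?thesis using 1 that by blast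
qed

text \<open>Abel summation bounds the sum against the Monsky weights by \<open>q\<close>, while the
  Lambert series exceeds \<open>q + 1\<close> for a suitable fixed x. So the partial sums of L(1),
  divided by 1 - x, are eventually at least 1, and c = 1 - x is an explicit lower bound for
  them.\<close>

lemma real_char_dser_lower_bound:
  fixes a :: "nat \<Rightarrow> real"
  assumes mult: "\<And>m n. a (m * n) = a m * a n" and a1: "a 1 = 1" and v: "\<And>m. a m \<in> {-1, 0, 1}"
    and per: "\<And>m. a (m + q) = a m" and z: "(\<Sum>m<q. a m) = 0" and "q > 0"
  shows "\<exists>c>0. \<forall>\<^sub>F \<delta> in at_right 0. norm (dser (\<lambda>m. of_real (a m)) 0 \<delta>) \<ge> c"
proof -
  \<comment> \<open>As y tends to 1 the Lambert bound tends to \<open>J\<close>, so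
    \<open>J = q + 2\<close> suffices to exceed \<open>q + 1\<close>.\<close>
  define J where "J = q + 2"
  have "((\<lambda>y::real. real J * (y\<^sup>2) ^ J\<^sup>2) \<longlongrightarrow> real J * (1\<^sup>2) ^ J\<^sup>2) (at_left 1)"
    by (intro tendsto_intros)
  then have "\<forall>\<^sub>F y::real in at_left 1. real J * (y\<^sup>2) ^ J\<^sup>2 > real q + 1"
    by (rule order_tendstoD) (simp add: J_def)
  moreover have "\<forall>\<^sub>F y::real in at_left 1. y > 0" by (rule eventually_at_leftI[of 0]) auto
  moreover have "\<forall>\<^sub>F y::real in at_left 1. y < 1" by (simp add: eventually_at_filter)
  ultimately have "\<forall>\<^sub>F y::real in at_left 1. real J * (y\<^sup>2) ^ J\<^sup>2 > real q + 1 \<and> 0 < y \<and> y < 1"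
    by eventually_elim auto
  then obtain y :: real where y: "real J * (y\<^sup>2) ^ J\<^sup>2 > real q + 1" "0 < y" "y < 1"
    using eventually_happens'[of "at_left (1::real)"] trivial_limit_at_left_real by blast
  define x where "x = y\<^sup>2"
  have x: "0 < x" "x < 1" using y by (auto simp: x_def power_less_one_iff)
  define G where "G m = a m * (x ^ m / (1 - x ^ m))" for m
  obtain S where S: "G sums S" "S \<ge> real J * x ^ J\<^sup>2"
    using lambert_series_lower_bound[OF mult a1 v x] unfolding G_def by blast
  have "S > real q + 1" using S(2) y(1) unfolding x_def by linarith
  then have G: "\<forall>\<^sub>F M in sequentially. (\<Sum>m<M. G m) > real q + 1"
    using order_tendstoD(1)[OF S(1)[unfolded sums_def]] by blast
  define c where "c = 1 - x"
  have "c > 0" using x by (simp add: c_def)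
  have aC: "norm (\<Sum>m=N..<K. complex_of_real (a m)) \<le> real q" for N K
  proof (rule norm_sum_periodic_le)
    show "norm (complex_of_real (a m)) \<le> 1" for m using v[of m] by auto
    show "(\<Sum>m<q. complex_of_real (a m)) = 0" using z by (simp flip: of_real_sum)
  qed (use per \<open>q > 0\<close> in auto)
  have cM: "\<forall>\<^sub>F M in sequentially. (\<Sum>m=1..<M. a m / real m) \<ge> c"
    using G eventually_ge_at_top[of 1]
  proof eventually_elim
    case (elim M)
    have "norm (\<Sum>m=1..<M. complex_of_real (a m) * of_real (monsky x m)) \<le> real q * monsky x 1"
      using monsky_props[OF y(2,3) x_def] aC by (intro norm_sum_abel) auto
    then have "norm (complex_of_real (\<Sum>m=1..<M. a m * monsky x m)) \<le> real q"
      using monsky_props(3)[OF y(2,3) x_def, of 1] by simp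
    then have 1: "\<bar>\<Sum>m=1..<M. a m * monsky x m\<bar> \<le> real q" by (simp only: norm_of_real)
    have "(\<Sum>m<M. G m) = (\<Sum>m=1..<M. G m)"
      by (intro sum.mono_neutral_right) (auto simp: G_def not_le)
    then have "(\<Sum>m=1..<M. a m * monsky x m) + (\<Sum>m<M. G m) = (\<Sum>m=1..<M. a m / real m) / c"
      by (simp add: sum.distrib[symmetric] sum_divide_distrib G_def monsky_def c_def algebra_simps)
    then have "(\<Sum>m=1..<M. a m / real m) / c \<ge> 1" using 1 elim by linarith
    then show ?case using \<open>c > 0\<close> by (simp add: field_simps)
  qed
  \<comment> \<open>Passage from 1 to 1 + \<delta>: the tail beyond \<open>N\<close> costs at most
    \<open>q / N\<close> uniformly in \<delta>, and the finite head is continuous in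
    \<delta>.\<close>
  have "((\<lambda>N. real q / real N) \<longlongrightarrow> 0) sequentially" by real_asymp
  then have "\<forall>\<^sub>F N in sequentially. real q / real N < c / 4"
    using \<open>c > 0\<close> by (intro order_tendstoD) auto
  with cM eventually_ge_at_top[of "1::nat"]
  have "\<forall>\<^sub>F N in sequentially. N \<ge> 1 \<and> (\<Sum>m=1..<N. a m / real m) \<ge> c \<and> real q / real N < c / 4"
    by eventually_elim auto
  then obtain N where N: "N \<ge> 1" "(\<Sum>m=1..<N. a m / real m) \<ge> c" "real q / real N < c / 4"
    using eventually_happens'[OF sequentially_bot] by blast
  have "((\<lambda>\<delta>. \<Sum>m=1..<N. a m * wt 0 \<delta> (real m)) \<longlongrightarrow> (\<Sum>m=1..<N. a m * (ln (real m) ^ 0 * real m powr (-1 - 0)))) (at_right 0)"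
    unfolding wt_def by (intro tendsto_intros) auto
  also have "(\<Sum>m=1..<N. a m * (ln (real m) ^ 0 * real m powr (-1 - 0))) = (\<Sum>m=1..<N. a m / real m)"
    by (intro sum.cong) (auto simp: powr_minus_divide)
  finally have "\<forall>\<^sub>F \<delta> in at_right 0. (\<Sum>m=1..<N. a m * wt 0 \<delta> (real m)) > 3 * c / 4"
    by (rule order_tendstoD) (use N(2) \<open>c > 0\<close> in linarith)
  with eventually_at_right_less[of "0::real"]
  have "\<forall>\<^sub>F \<delta> in at_right 0. norm (dser (\<lambda>m. of_real (a m)) 0 \<delta>) \<ge> c / 2"
  proof eventually_elim
    case (elim \<delta>)
    let ?s = "\<Sum>m<N. complex_of_real (a m) * of_real (wt 0 \<delta> (real m))"
    have "norm (dser (\<lambda>m. of_real (a m)) 0 \<delta> - ?s) \<le> real q * wt 0 \<delta> (real N)"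
    proof (rule norm_dser_periodic_tail_le)
      show "norm (complex_of_real (a m)) \<le> 1" for m using v[of m] by auto
      show "(\<Sum>m<q. complex_of_real (a m)) = 0" using z by (simp flip: of_real_sum)
    qed (use per \<open>q > 0\<close> N elim in auto)
    also have "\<dots> \<le> real q * (1 / real N)"
      using wt_le_ln_power[of \<delta> N 0] N elim by (intro mult_left_mono) auto
    also have "\<dots> \<le> c / 4" using N(3) by simp
    finally have 1: "norm (dser (\<lambda>m. of_real (a m)) 0 \<delta> - ?s) \<le> c / 4" .
    have "(\<Sum>m<N. a m * wt 0 \<delta> (real m)) = (\<Sum>m=1..<N. a m * wt 0 \<delta> (real m))"
      by (intro sum.mono_neutral_right) (auto simp: not_le)
    then have "?s = of_real (\<Sum>m=1..<N. a m * wt 0 \<delta> (real m))" by (simp flip: of_real_sum of_real_mult)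
    then have "norm ?s \<ge> 3 * c / 4" using elim by (simp only: norm_of_real)
    moreover have "norm ?s \<le> norm (dser (\<lambda>m. of_real (a m)) 0 \<delta>) + norm (dser (\<lambda>m. of_real (a m)) 0 \<delta> - ?s)"
      by (metis norm_triangle_sub norm_minus_commute)
    ultimately show ?case using 1 by linarith
  qed
  then show ?thesis using \<open>c > 0\<close> by (intro exI[of _ "c / 2"]) auto
qed

text \<open>Hensel lifting for \<open>c\<^sup>2 + c = g y\<close>, iterating \<open>c \<mapsto> g y - c\<^sup>2\<close>; then \<open>(1 + 2 c)\<^sup>2 = 1 + 4 g y\<close>.\<close>

lemma exists_sqrt_mod_power:
  fixes g y n :: nat
  assumes "g > 0"
  shows "\<exists>b. [b\<^sup>2 = 1 + 4 * g * y] (mod g ^ n)"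
proof -
  have "\<exists>c::int. int g dvd c \<and> int g ^ n dvd c + c\<^sup>2 - int g * int y"
  proof (induction n)
    case (Suc n)
    then obtain c :: int where c: "int g dvd c" "int g ^ n dvd c + c\<^sup>2 - int g * int y" by blast
    define c' where "c' = int g * int y - c\<^sup>2"
    have "int g dvd c\<^sup>2" using c(1) by (simp add: power2_eq_square)
    then have d: "int g dvd c'" by (simp add: c'_def)
    have "c' + c'\<^sup>2 - int g * int y = (c + c\<^sup>2 - int g * int y) * - (c' + c)"
      unfolding c'_def by (simp add: power2_eq_square algebra_simps)
    moreover have "int g ^ n * int g dvd (c + c\<^sup>2 - int g * int y) * - (c' + c)"
      using c d by (intro mult_dvd_mono) (auto simp: dvd_minus_iff)
    ultimately show ?case using d by (auto simp: mult.commute intro!: exI[of _ c'])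
  qed (auto intro: exI[of _ 0])
  then obtain c :: int where c: "int g ^ n dvd c + c\<^sup>2 - int g * int y" by blast
  define b where "b = nat ((1 + 2 * c) mod int g ^ n)"
  have b: "int b = (1 + 2 * c) mod int g ^ n" unfolding b_def using assms by simp
  have "[int b = 1 + 2 * c] (mod int g ^ n)" unfolding b by (simp add: Cong.cong_def)
  then have "[(int b)\<^sup>2 = (1 + 2 * c)\<^sup>2] (mod int g ^ n)" by (rule cong_pow)
  moreover have "int g ^ n dvd 4 * (c + c\<^sup>2 - int g * int y)" using c by (rule dvd_mult)
  then have "[(1 + 2 * c)\<^sup>2 = 1 + 4 * int g * int y] (mod int g ^ n)"
    unfolding cong_iff_dvd_diff by (simp add: power2_eq_square algebra_simps)
  ultimately have "[int (b\<^sup>2) = int (1 + 4 * g * y)] (mod int (g ^ n))" by (simp add: cong_trans)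
  then have "[b\<^sup>2 = 1 + 4 * g * y] (mod g ^ n)" by (simp only: cong_int_iff)
  then show ?thesis by blast
qed

lemma principal_char_power: "n > 0 \<Longrightarrow> principal_char (g ^ n) = principal_char g"
  by (auto simp: principal_char_def)

text \<open>With \<open>t\<close> inverse to \<open>m\<close>, the number
  \<open>(m + 4 * g) * t\<close> is congruent to \<open>1 + 4 * g * t\<close>, which is a square mod
  \<open>g ^ n\<close>. A character with principal square is 1 on coprime squares, so both arguments
  have the value inverse to \<open>\<psi> t\<close>.\<close>

lemma real_dchar_periodic:
  assumes \<psi>: "dchar (g ^ n) \<psi>" and n: "n > 0" "g > 0" and sq: "\<And>m. (\<psi> m)\<^sup>2 = principal_char g m"
  shows "\<psi> (m + 4 * g) = \<psi> m"
proof (cases "coprime m (g ^ n)")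
  case False
  have "coprime (m + 4 * g) g \<longleftrightarrow> coprime m g"
    by (metis coprime_iff_gcd_eq_1 gcd_add_mult add.commute gcd.commute)
  then have "\<not> coprime (m + 4 * g) (g ^ n)" using False n by simp
  then show ?thesis using False dchar_eq_0_iff[OF \<psi>] by metis
next
  case True
  obtain t where t: "[m * t = 1] (mod g ^ n)" using cong_solve_coprime_nat[OF True] by auto
  obtain b where b: "[b\<^sup>2 = 1 + 4 * g * t] (mod g ^ n)" using exists_sqrt_mod_power[OF n(2)] by blast
  have "[(m + 4 * g) * t = 1 + 4 * g * t] (mod g ^ n)"
    using cong_add[OF t cong_refl[of "4 * g * t"]] by (simp add: algebra_simps)
  with b have "[(m + 4 * g) * t = b\<^sup>2] (mod g ^ n)" by (meson cong_sym cong_trans)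
  then have e1: "\<psi> (m + 4 * g) * \<psi> t = (\<psi> b)\<^sup>2"
    using dchar_cong[OF \<psi>] dchar_mult[OF \<psi>] dchar_power[OF \<psi>] by metis
  have e2: "\<psi> (m + 4 * g) * \<psi> t \<noteq> 0"
  proof -
    have "coprime (1 + 4 * g * t) g"
      by (metis coprime_1_left coprime_iff_gcd_eq_1 gcd_add_mult add.commute gcd.commute mult.assoc mult.commute)
    then have "\<psi> (1 + 4 * g * t) \<noteq> 0" using dchar_eq_0_iff[OF \<psi>] by (simp add: coprime_commute)
    moreover have "\<psi> (1 + 4 * g * t) = \<psi> (m + 4 * g) * \<psi> t"
      using dchar_cong[OF \<psi> \<open>[(m + 4 * g) * t = 1 + 4 * g * t] (mod g ^ n)\<close>] by (simp add: dchar_mult[OF \<psi>])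
    ultimately show ?thesis by simp
  qed
  have 1: "\<psi> (m + 4 * g) * \<psi> t = 1"
    using e1 e2 sq[of b] by (auto simp: principal_char_def split: if_splits)
  have 2: "\<psi> m * \<psi> t = 1"
    using dchar_cong[OF \<psi> t] by (simp add: dchar_mult[OF \<psi>] dchar_1[OF \<psi>])
  then have "\<psi> t \<noteq> 0" by auto
  then show ?thesis using 1 2 by (metis mult_right_cancel)
qed

text \<open>Period \<open>4 * g\<close> and three possible values leave finitely many functions for
  all \<open>n\<close> together, so the individual bounds have a positive minimum. This uniformity
  is where a Siegel zero is excluded.\<close>

lemma real_dchars_lower_bound:
  assumes g: "g \<ge> 2"
  shows "\<exists>c>0. \<forall>\<^sub>F \<delta> in at_right 0. \<forall>n>0. \<forall>\<psi>. dchar (g ^ n) \<psi> \<longrightarrow> \<psi> \<noteq> principal_char g \<longrightarrow>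
     (\<forall>m. (\<psi> m)\<^sup>2 = principal_char g m) \<longrightarrow> norm (dser \<psi> 0 \<delta>) \<ge> c"
proof -
  define R where "R = {\<psi>. \<exists>n>0. dchar (g ^ n) \<psi> \<and> \<psi> \<noteq> principal_char g \<and> (\<forall>m. (\<psi> m)\<^sup>2 = principal_char g m)}"
  have vals: "\<psi> m \<in> {-1, 0, 1}" if "\<psi> \<in> R" for \<psi> m
  proof -
    have "(\<psi> m)\<^sup>2 = principal_char g m" using that unfolding R_def by blast
    then have "(\<psi> m)\<^sup>2 = 0 \<or> (\<psi> m)\<^sup>2 = 1" unfolding principal_char_def by (cases "coprime m g") auto
    then show ?thesis by (auto simp: power2_eq_1_iff)
  qed
  have "finite R"
  proof (rule inj_on_finite)
    show "inj_on (\<lambda>\<psi>. restrict \<psi> {..<4 * g}) R"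
    proof (rule inj_onI, rule ext)
      fix \<psi> \<phi> m assume *: "\<psi> \<in> R" "\<phi> \<in> R" "restrict \<psi> {..<4 * g} = restrict \<phi> {..<4 * g}"
      have "\<psi> m = \<psi> (m mod (4 * g))" if "\<psi> \<in> R" for \<psi> m
      proof -
        have "\<psi> (m + 4 * g) = \<psi> m" for m
          using that g real_dchar_periodic[of g _ \<psi> m] unfolding R_def by auto
        then show ?thesis by (rule periodic_mod[symmetric])
      qed
      moreover have "\<psi> (m mod (4 * g)) = \<phi> (m mod (4 * g))"
        using fun_cong[OF *(3), of "m mod (4 * g)"] g by simp
      ultimately show "\<psi> m = \<phi> m" using * by metis
    qed
    show "(\<lambda>\<psi>. restrict \<psi> {..<4 * g}) ` R \<subseteq> {..<4 * g} \<rightarrow>\<^sub>E {-1, 0, 1}"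
      by (intro image_subsetI restrict_PiE_iff[THEN iffD2] ballI vals)
  qed (auto intro: finite_PiE)
  have "\<exists>c>0. \<forall>\<^sub>F \<delta> in at_right 0. norm (dser \<psi> 0 \<delta>) \<ge> c" if R: "\<psi> \<in> R" for \<psi>
  proof -
    obtain n where n: "n > 0" "dchar (g ^ n) \<psi>" "\<psi> \<noteq> principal_char g" using R unfolding R_def by blast
    have eq: "\<psi> m = of_real (Re (\<psi> m))" for m using vals[OF R, of m] by auto
    have "\<exists>c>0. \<forall>\<^sub>F \<delta> in at_right 0. norm (dser (\<lambda>m. of_real (Re (\<psi> m))) 0 \<delta>) \<ge> c"
    proof (rule real_char_dser_lower_bound)
      show "Re (\<psi> (m * k)) = Re (\<psi> m) * Re (\<psi> k)" for m k
        using eq[of m] eq[of k] dchar_mult[OF n(2), of m k] by (metis Re_complex_of_real of_real_mult)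
      show "Re (\<psi> 1) = 1" using dchar_1[OF n(2)] by simp
      show "Re (\<psi> m) \<in> {-1, 0, 1}" for m using vals[OF R, of m] by auto
      show "Re (\<psi> (m + g ^ n)) = Re (\<psi> m)" for m using n(2) unfolding dchar_def by simp
      have "(\<Sum>m<g ^ n. \<psi> m) = 0" using n g by (intro sum_dchar_eq_0) (auto simp: principal_char_power)
      then show "(\<Sum>m<g ^ n. Re (\<psi> m)) = 0" by (metis Re_sum zero_complex.simps(1))
      show "g ^ n > 0" using g by simp
    qed
    then show ?thesis by (simp only: eq[symmetric])
  qed
  then obtain c where c: "\<And>\<psi>. \<psi> \<in> R \<Longrightarrow> c \<psi> > 0 \<and> (\<forall>\<^sub>F \<delta> in at_right 0. norm (dser \<psi> 0 \<delta>) \<ge> c \<psi>)" by metis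
  \<comment> \<open>The 1 keeps the set nonempty when there are no such characters.\<close>
  define d where "d = Min (insert 1 (c ` R))"
  have d: "d > 0" "\<And>\<psi>. \<psi> \<in> R \<Longrightarrow> d \<le> c \<psi>" unfolding d_def using \<open>finite R\<close> c by auto
  have "\<forall>\<^sub>F \<delta> in at_right 0. \<forall>\<psi>\<in>R. norm (dser \<psi> 0 \<delta>) \<ge> c \<psi>"
    using c \<open>finite R\<close> by (intro eventually_ball_finite) auto
  then have "\<forall>\<^sub>F \<delta> in at_right 0. \<forall>\<psi>\<in>R. norm (dser \<psi> 0 \<delta>) \<ge> d"
    by eventually_elim (use d in force)
  then have "\<forall>\<^sub>F \<delta> in at_right 0. \<forall>n>0. \<forall>\<psi>. dchar (g ^ n) \<psi> \<longrightarrow> \<psi> \<noteq> principal_char g \<longrightarrow>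
     (\<forall>m. (\<psi> m)\<^sup>2 = principal_char g m) \<longrightarrow> norm (dser \<psi> 0 \<delta>) \<ge> d"
    by (rule eventually_mono) (unfold R_def, blast)
  then show ?thesis using d(1) by blast
qed

section \<open>Quantitative Dirichlet theorem for powers of a fixed base\<close>

text \<open>With \<open>t = tpar g K n\<close> the modulus is \<open>g ^ n = t ^ K\<close>. At \<open>1 + t powr (-14)\<close> one has \<open>|L| \<ge> t powr (-11)\<close>
  while all derivatives of \<open>L\<close> up to order \<open>K\<close> are at most \<open>t\<close>, so a nonprincipal character contributes
  \<open>O(t ^ (12 K))\<close> against the main term \<open>t ^ (14 K)\<close>, which has to be divided by \<open>t ^ K\<close>.\<close>

definition tpar :: "nat \<Rightarrow> nat \<Rightarrow> nat \<Rightarrow> real" where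
  "tpar g K n = exp (real n * ln (real g) / real K)"

definition dpar :: "nat \<Rightarrow> nat \<Rightarrow> nat \<Rightarrow> real" where
  "dpar g K n = 1 / tpar g K n ^ 14"

lemma tpar_pos: "tpar g K n > 0"
  by (simp add: tpar_def)

lemma dpar_pos: "dpar g K n > 0"
  unfolding dpar_def by (intro divide_pos_pos zero_less_power tpar_pos) simp

lemma tpar_power:
  assumes "g > 0" "K > 0"
  shows "tpar g K n ^ K = real (g ^ n)"
proof -
  have "tpar g K n ^ K = exp (real K * (real n * ln (real g) / real K))"
    unfolding tpar_def by (rule exp_of_nat_mult[symmetric])
  also have "\<dots> = exp (real n * ln (real g))" using assms by simp
  also have "\<dots> = real g ^ n" using assms by (simp add: exp_of_nat_mult)
  finally show ?thesis by simp
qed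

lemma tpar_at_top:
  assumes "g \<ge> 2" "K > 0"
  shows "filterlim (tpar g K) at_top sequentially"
proof -
  have "ln (real g) > 0" using assms by simp
  then show ?thesis unfolding tpar_def using assms by real_asymp
qed

lemma dpar_at_right:
  assumes "g \<ge> 2" "K > 0"
  shows "filterlim (dpar g K) (at_right 0) sequentially"
proof -
  have "filterlim (\<lambda>t::real. 1 / t ^ 14) (at_right 0) at_top" by real_asymp
  from filterlim_compose[OF this tpar_at_top[OF assms]] show ?thesis unfolding dpar_def .
qed

lemma eventually_dser_nonprincipal_le:
  assumes g: "g \<ge> 2" and K: "K > 0"
  shows "\<forall>\<^sub>F n in sequentially. \<forall>\<psi>. dchar (g ^ n) \<psi> \<longrightarrow> \<psi> \<noteq> principal_char g \<longrightarrow>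
     (\<forall>i\<le>K. norm (dser \<psi> i (dpar g K n)) \<le> tpar g K n)"
proof -
  have l: "ln (real g) > 0" using g by simp
  have "\<forall>\<^sub>F n in sequentially. (2 + real n * ln (real g)) ^ (K + 1) \<le> tpar g K n"
    unfolding tpar_def using l K by real_asymp
  moreover have "\<forall>\<^sub>F n in sequentially. real n * ln (real g) \<ge> real K" using l by real_asymp
  ultimately show ?thesis using eventually_gt_at_top[of 0]
  proof eventually_elim
    case (elim n)
    show ?case
    proof (intro allI impI)
      fix \<psi> i assume \<psi>: "dchar (g ^ n) \<psi>" "\<psi> \<noteq> principal_char g" and i: "i \<le> K"
      have ln: "ln (real (g ^ n)) = real n * ln (real g)" using g by (simp add: ln_realpow)
      have "norm (dser \<psi> i (dpar g K n)) \<le> (2 + ln (real (g ^ n))) ^ (i + 1)"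
      proof (rule norm_dser_le_ln_power)
        show "\<psi> (m + g ^ n) = \<psi> m" for m using \<psi>(1) unfolding dchar_def by simp
        show "(\<Sum>m<g ^ n. \<psi> m) = 0" using \<psi> g elim by (intro sum_dchar_eq_0) (auto simp: principal_char_power)
        show "norm (\<psi> m) \<le> 1" for m using norm_dchar_le[OF \<psi>(1)] g by simp
        show "real i \<le> ln (real (g ^ n))" unfolding ln using i elim by linarith
      qed (use g dpar_pos in auto)
      also have "\<dots> \<le> (2 + real n * ln (real g)) ^ (K + 1)"
        unfolding ln using i l by (intro power_increasing) auto
      finally show "norm (dser \<psi> i (dpar g K n)) \<le> tpar g K n" using elim by linarith
    qed
  qed
qed

text \<open>If the square of the character is nonprincipal, zeta is at most 2 t ^ 14 and the series
  of the square at most t, so 3-4-1 gives 1 \<le> 8 t ^ 43 |L| ^ 4. Once t \<ge> 8 this is at most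
  (t ^ 11 |L|) ^ 4, which explains the exponent 11. A principal square falls under the constant
  bound for real characters.\<close>

lemma eventually_dser_nonprincipal_ge:
  assumes g: "g \<ge> 2" and K: "K > 0"
  shows "\<forall>\<^sub>F n in sequentially. \<forall>\<psi>. dchar (g ^ n) \<psi> \<longrightarrow> \<psi> \<noteq> principal_char g \<longrightarrow>
     norm (dser \<psi> 0 (dpar g K n)) \<ge> 1 / tpar g K n ^ 11"
proof -
  note dt = dpar_at_right[OF g K] and tt = tpar_at_top[OF g K]
  obtain c where c: "c > 0" "\<forall>\<^sub>F \<delta> in at_right 0. \<forall>n>0. \<forall>\<psi>. dchar (g ^ n) \<psi> \<longrightarrow> \<psi> \<noteq> principal_char g \<longrightarrow>
     (\<forall>m. (\<psi> m)\<^sup>2 = principal_char g m) \<longrightarrow> norm (dser \<psi> 0 \<delta>) \<ge> c"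
    using real_dchars_lower_bound[OF g] by blast
  have "\<forall>\<^sub>F \<delta> in at_right 0. \<delta> ^ (0 + 1) * wt_sum 0 \<delta> < 2"
    using wt_sum_scaled_tendsto[of 0] by (rule order_tendstoD) simp
  then have Z: "\<forall>\<^sub>F n in sequentially. dpar g K n * wt_sum 0 (dpar g K n) < 2"
    using eventually_compose_filterlim[OF _ dt] by fastforce
  have R: "\<forall>\<^sub>F n in sequentially. \<forall>n'>0. \<forall>\<psi>. dchar (g ^ n') \<psi> \<longrightarrow> \<psi> \<noteq> principal_char g \<longrightarrow>
     (\<forall>m. (\<psi> m)\<^sup>2 = principal_char g m) \<longrightarrow> norm (dser \<psi> 0 (dpar g K n)) \<ge> c"
    using eventually_compose_filterlim[OF c(2) dt] .
  have "\<forall>\<^sub>F t::real in at_top. 1 / t ^ 11 \<le> c" using c(1) by real_asymp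
  from eventually_compose_filterlim[OF this tt]
  have c11: "\<forall>\<^sub>F n in sequentially. 1 / tpar g K n ^ 11 \<le> c" .
  have t8: "\<forall>\<^sub>F n in sequentially. tpar g K n \<ge> 8"
    using eventually_compose_filterlim[OF eventually_ge_at_top tt] .
  show ?thesis
    using Z R c11 t8 eventually_dser_nonprincipal_le[OF assms] eventually_gt_at_top[of 0]
  proof eventually_elim
    case (elim n)
    let ?t = "tpar g K n" and ?d = "dpar g K n"
    show ?case
    proof (intro allI impI)
      fix \<psi> assume \<psi>: "dchar (g ^ n) \<psi>" "\<psi> \<noteq> principal_char g"
      show "1 / ?t ^ 11 \<le> norm (dser \<psi> 0 ?d)"
      proof (cases "(\<lambda>m. (\<psi> m)\<^sup>2) = principal_char g")
        case True
        then have "(\<psi> m)\<^sup>2 = principal_char g m" for m by (rule fun_cong)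
        then have "c \<le> norm (dser \<psi> 0 ?d)" using elim(2,6) \<psi> by blast
        then show ?thesis using elim by linarith
      next
        case False
        have "dchar (g ^ n) (\<lambda>m. (\<psi> m)\<^sup>2)" using dchar_times[OF \<psi>(1) \<psi>(1)] by (simp add: power2_eq_square)
        then have L2: "norm (dser (\<lambda>m. (\<psi> m)\<^sup>2) 0 ?d) \<le> ?t" using elim False by blast
        have t0: "?t > 0" by (rule tpar_pos)
        have Zb: "wt_sum 0 ?d \<le> 2 * ?t ^ 14" using elim(1) t0 by (simp add: dpar_def field_simps)
        have Z0: "wt_sum 0 ?d \<ge> 0" unfolding wt_sum_def
          by (intro suminf_nonneg summable_wt wt_nonneg dpar_pos)
        define l where "l = norm (dser \<psi> 0 ?d)"
        have "1 \<le> wt_sum 0 ?d ^ 3 * l ^ 4 * norm (dser (\<lambda>m. (\<psi> m)\<^sup>2) 0 ?d)"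
          unfolding l_def using g by (intro dser_three_four_one[OF \<psi>(1)] dpar_pos) auto
        also have "\<dots> \<le> (2 * ?t ^ 14) ^ 3 * l ^ 4 * ?t"
          using L2 Zb Z0 by (intro mult_mono power_mono) (auto simp: l_def)
        also have "\<dots> = 8 * ?t ^ 43 * l ^ 4" by (simp add: power_mult_distrib algebra_simps flip: power_mult power_Suc)
        also have "\<dots> \<le> ?t * ?t ^ 43 * l ^ 4" using elim t0 by (intro mult_right_mono) (auto simp: l_def)
        also have "\<dots> = (?t ^ 11 * l) ^ 4" by (simp add: power_mult_distrib flip: power_mult power_Suc)
        finally have "1 ^ 4 \<le> (?t ^ 11 * l) ^ 4" by simp
        moreover have "0 \<le> ?t ^ 11 * l" using t0 by (simp add: l_def)
        ultimately have "1 \<le> ?t ^ 11 * l" by (subst (asm) power_mono_iff) auto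
        then show ?thesis using t0 by (simp add: field_simps l_def)
      qed
    qed
  qed
qed

lemma eventually_dser_mangoldt_nonprincipal_le:
  assumes g: "g \<ge> 2"
  shows "\<exists>C\<ge>1. \<forall>\<^sub>F n in sequentially. \<forall>\<psi>. dchar (g ^ n) \<psi> \<longrightarrow> \<psi> \<noteq> principal_char g \<longrightarrow>
     norm (dser (\<lambda>m. mangoldt m * \<psi> m) k (dpar g (Suc k) n)) \<le> C * tpar g (Suc k) n ^ (12 * Suc k)"
proof -
  let ?t = "tpar g (Suc k)" and ?d = "dpar g (Suc k)"
  obtain C where C: "C \<ge> 1" "\<And>P L :: nat \<Rightarrow> complex. \<And>M \<mu> :: real.
     (\<forall>i. (\<Sum>j\<le>i. of_nat (i choose j) * (P j * L (i - j))) = L (Suc i)) \<Longrightarrow>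
     (\<forall>i\<le>Suc k. norm (L i) \<le> M) \<Longrightarrow> \<mu> \<le> norm (L 0) \<Longrightarrow> 0 < \<mu> \<Longrightarrow> \<mu> \<le> 1 \<Longrightarrow> 1 \<le> M \<Longrightarrow>
     norm (P k) \<le> C * (M / \<mu>) ^ Suc k"
    using recurrence_bound[of k] by blast
  have t1: "\<forall>\<^sub>F n in sequentially. ?t n \<ge> 1"
    using eventually_compose_filterlim[OF eventually_ge_at_top tpar_at_top[OF g]] by simp
  have "\<forall>\<^sub>F n in sequentially. \<forall>\<psi>. dchar (g ^ n) \<psi> \<longrightarrow> \<psi> \<noteq> principal_char g \<longrightarrow>
     norm (dser (\<lambda>m. mangoldt m * \<psi> m) k (?d n)) \<le> C * ?t n ^ (12 * Suc k)"
    using t1 eventually_dser_nonprincipal_le[OF g zero_less_Suc[of k]] eventually_dser_nonprincipal_ge[OF g zero_less_Suc[of k]]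
  proof eventually_elim
    case (elim n)
    show ?case
    proof (intro allI impI)
      fix \<psi> assume \<psi>: "dchar (g ^ n) \<psi>" "\<psi> \<noteq> principal_char g"
      have "norm (dser (\<lambda>m. mangoldt m * \<psi> m) k (?d n)) \<le> C * (?t n / (1 / ?t n ^ 11)) ^ Suc k"
      proof (rule C(2)[where L = "\<lambda>i. dser \<psi> i (?d n)" and P = "\<lambda>i. dser (\<lambda>m. mangoldt m * \<psi> m) i (?d n)"])
        show "\<forall>i. (\<Sum>j\<le>i. of_nat (i choose j) * (dser (\<lambda>m. mangoldt m * \<psi> m) j (?d n) * dser \<psi> (i - j) (?d n))) = dser \<psi> (Suc i) (?d n)"
          using g by (intro allI dser_mangoldt_recurrence dchar_mult[OF \<psi>(1)] norm_dchar_le[OF \<psi>(1)] dpar_pos) auto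
        show "\<forall>i\<le>Suc k. norm (dser \<psi> i (?d n)) \<le> ?t n" using elim \<psi> by blast
        show "1 / ?t n ^ 11 \<le> norm (dser \<psi> 0 (?d n))" using elim \<psi> by blast
        show "1 / ?t n ^ 11 \<le> 1" using elim(1) one_le_power[OF elim(1), of 11] by (simp add: divide_le_eq)
      qed (use elim tpar_pos in auto)
      also have "?t n / (1 / ?t n ^ 11) = ?t n ^ 12" by (simp flip: power_Suc)
      finally show "norm (dser (\<lambda>m. mangoldt m * \<psi> m) k (?d n)) \<le> C * ?t n ^ (12 * Suc k)"
        by (simp only: power_mult)
    qed
  qed
  then show ?thesis using C(1) by blast
qed

lemma dser_mangoldt_residue_class:
  assumes q: "q > 0" and a: "coprime a q" and d: "\<delta> > 0"
  shows "of_nat (card {\<psi>. dchar q \<psi>}) * dser (\<lambda>m. mangoldt m * of_bool ([m = a] (mod q))) k \<delta> =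
    (\<Sum>\<psi> | dchar q \<psi>. cnj (\<psi> a) * dser (\<lambda>m. mangoldt m * \<psi> m) k \<delta>)"
proof -
  let ?h = "of_nat (card {\<psi>. dchar q \<psi>}) :: complex"
  have "((\<lambda>m. \<Sum>\<psi> | dchar q \<psi>. cnj (\<psi> a) * (mangoldt m * \<psi> m * of_real (wt k \<delta> (real m)))) has_sum
      (\<Sum>\<psi> | dchar q \<psi>. cnj (\<psi> a) * dser (\<lambda>m. mangoldt m * \<psi> m) k \<delta>)) UNIV"
    using finite_dchar[OF q] norm_dchar_le[OF _ q] d
    by (intro has_sum_sum_finite has_sum_cmult_right dser_mangoldt_has_sum) auto
  also have "(\<lambda>m. \<Sum>\<psi> | dchar q \<psi>. cnj (\<psi> a) * (mangoldt m * \<psi> m * of_real (wt k \<delta> (real m)))) =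
      (\<lambda>m. ?h * (mangoldt m * of_bool ([m = a] (mod q)) * of_real (wt k \<delta> (real m))))"
  proof
    fix m
    have "(\<Sum>\<psi> | dchar q \<psi>. cnj (\<psi> a) * (mangoldt m * \<psi> m * of_real (wt k \<delta> (real m)))) =
        (\<Sum>\<psi> | dchar q \<psi>. cnj (\<psi> a) * \<psi> m) * (mangoldt m * of_real (wt k \<delta> (real m)))"
      unfolding sum_distrib_right by (intro sum.cong) (auto simp: mult_ac)
    then show "(\<Sum>\<psi> | dchar q \<psi>. cnj (\<psi> a) * (mangoldt m * \<psi> m * of_real (wt k \<delta> (real m)))) =
        ?h * (mangoldt m * of_bool ([m = a] (mod q)) * of_real (wt k \<delta> (real m)))"
      using dchar_orthogonality[OF q a, of m] by simp
  qed
  finally have 1: "((\<lambda>m. ?h * (mangoldt m * of_bool ([m = a] (mod q)) * of_real (wt k \<delta> (real m)))) has_sum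
      (\<Sum>\<psi> | dchar q \<psi>. cnj (\<psi> a) * dser (\<lambda>m. mangoldt m * \<psi> m) k \<delta>)) UNIV" .
  have "((\<lambda>m. ?h * (mangoldt m * of_bool ([m = a] (mod q)) * of_real (wt k \<delta> (real m)))) has_sum
      ?h * dser (\<lambda>m. mangoldt m * of_bool ([m = a] (mod q))) k \<delta>) UNIV"
    using d by (intro has_sum_cmult_right dser_mangoldt_has_sum) auto
  from has_sum_unique[OF this 1] show ?thesis .
qed

lemma eventually_residue_class_ge:
  assumes g: "g \<ge> 2" and a: "coprime a g"
  shows "\<forall>\<^sub>F n in sequentially. norm (dser (\<lambda>m. mangoldt m * of_bool ([m = a] (mod g ^ n))) k (dpar g (Suc k) n))
    \<ge> tpar g (Suc k) n ^ (13 * Suc k) / 4"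
proof -
  let ?t = "tpar g (Suc k)" and ?d = "dpar g (Suc k)"
  obtain C where C: "C \<ge> 1" "\<forall>\<^sub>F n in sequentially. \<forall>\<psi>. dchar (g ^ n) \<psi> \<longrightarrow> \<psi> \<noteq> principal_char g \<longrightarrow>
     norm (dser (\<lambda>m. mangoldt m * \<psi> m) k (?d n)) \<le> C * ?t n ^ (12 * Suc k)"
    using eventually_dser_mangoldt_nonprincipal_le[OF g] by blast
  have "((\<lambda>\<delta>. norm (of_real \<delta> ^ Suc k * dser (\<lambda>m. mangoldt m * principal_char g m) k \<delta>)) \<longlongrightarrow> norm (fact k :: complex)) (at_right 0)"
    using g by (intro tendsto_norm mangoldt_principal_char_tendsto) auto
  then have "\<forall>\<^sub>F \<delta> in at_right 0. norm (of_real \<delta> ^ Suc k * dser (\<lambda>m. mangoldt m * principal_char g m) k \<delta>) > 1 / 2"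
  proof (rule order_tendstoD)
    have "(1 :: real) \<le> fact k" by (rule fact_ge_1)
    then have "1 / 2 < (fact k :: real)" by linarith
    then show "1 / 2 < norm (fact k :: complex)" by simp
  qed
  from eventually_compose_filterlim[OF this dpar_at_right[OF g zero_less_Suc]]
  have P0: "\<forall>\<^sub>F n in sequentially. norm (of_real (?d n) ^ Suc k * dser (\<lambda>m. mangoldt m * principal_char g m) k (?d n)) > 1 / 2" .
  have t4: "\<forall>\<^sub>F n in sequentially. ?t n \<ge> 4 * C"
    using eventually_compose_filterlim[OF eventually_ge_at_top tpar_at_top[OF g]] by simp
  show ?thesis using C(2) P0 t4 eventually_gt_at_top[of 0]
  proof eventually_elim
    case (elim n)
    define h where "h = card {\<psi>. dchar (g ^ n) \<psi>}"
    define S where "S = norm (dser (\<lambda>m. mangoldt m * of_bool ([m = a] (mod g ^ n))) k (?d n))"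
    define P where "P \<psi> = dser (\<lambda>m. mangoldt m * \<psi> m) k (?d n)" for \<psi>
    have t0: "?t n > 0" by (rule tpar_pos)
    have t1: "?t n \<ge> 1" using elim C(1) by linarith
    have gn: "g ^ n > 1" using g elim by (intro one_less_power) auto
    have gn0: "g ^ n > 0" using gn by linarith
    have h: "h > 0" "h \<le> g ^ n" unfolding h_def using card_dchar_le[OF gn] by auto
    have fin: "finite {\<psi>. dchar (g ^ n) \<psi>}" by (rule finite_dchar[OF gn0])
    have pc: "dchar (g ^ n) (principal_char g)" using dchar_principal[of "g ^ n"] elim by (simp add: principal_char_power)
    have a': "coprime a (g ^ n)" using a by simp
    have "of_nat h * dser (\<lambda>m. mangoldt m * of_bool ([m = a] (mod g ^ n))) k (?d n) =
        (\<Sum>\<psi> | dchar (g ^ n) \<psi>. cnj (\<psi> a) * P \<psi>)"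
      unfolding h_def P_def by (rule dser_mangoldt_residue_class[OF gn0 a' dpar_pos])
    also have "\<dots> = cnj (principal_char g a) * P (principal_char g) +
        (\<Sum>\<psi>\<in>{\<psi>. dchar (g ^ n) \<psi>} - {principal_char g}. cnj (\<psi> a) * P \<psi>)"
      using pc fin by (intro sum.remove) auto
    also have "cnj (principal_char g a) = 1" using a by (simp add: principal_char_def)
    finally have eq: "P (principal_char g) = of_nat h * dser (\<lambda>m. mangoldt m * of_bool ([m = a] (mod g ^ n))) k (?d n)
        - (\<Sum>\<psi>\<in>{\<psi>. dchar (g ^ n) \<psi>} - {principal_char g}. cnj (\<psi> a) * P \<psi>)" by simp
    have "norm (\<Sum>\<psi>\<in>{\<psi>. dchar (g ^ n) \<psi>} - {principal_char g}. cnj (\<psi> a) * P \<psi>)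
        \<le> (\<Sum>\<psi>\<in>{\<psi>. dchar (g ^ n) \<psi>} - {principal_char g}. C * ?t n ^ (12 * Suc k))"
    proof (intro sum_norm_le)
      fix \<psi> assume \<psi>: "\<psi> \<in> {\<psi>. dchar (g ^ n) \<psi>} - {principal_char g}"
      then have "norm (P \<psi>) \<le> C * ?t n ^ (12 * Suc k)" unfolding P_def using elim by blast
      moreover have "norm (\<psi> a) = 1" using \<psi> norm_dchar[OF _ gn0 a'] by blast
      ultimately show "norm (cnj (\<psi> a) * P \<psi>) \<le> C * ?t n ^ (12 * Suc k)" by (simp add: norm_mult)
    qed
    also have "\<dots> = real (h - 1) * (C * ?t n ^ (12 * Suc k))"
      using pc fin by (simp add: h_def card_Diff_singleton)
    also have "\<dots> \<le> real h * (C * ?t n ^ (12 * Suc k))"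
      using C(1) t0 by (intro mult_right_mono) auto
    finally have N: "norm (\<Sum>\<psi>\<in>{\<psi>. dchar (g ^ n) \<psi>} - {principal_char g}. cnj (\<psi> a) * P \<psi>) \<le> real h * (C * ?t n ^ (12 * Suc k))" .
    have "norm (P (principal_char g)) \<le> real h * S + real h * (C * ?t n ^ (12 * Suc k))"
      unfolding eq using N norm_triangle_ineq4 by (intro order_trans[OF norm_triangle_ineq4] add_mono) (auto simp: norm_mult S_def)
    moreover have "norm (P (principal_char g)) \<ge> ?t n ^ (14 * Suc k) / 2"
    proof -
      have "1 / 2 < norm (P (principal_char g)) / ?t n ^ (14 * Suc k)"
        using elim(2) t0 unfolding P_def dpar_def power_mult
        by (simp add: norm_mult norm_power norm_divide power_divide del: power_Suc)
      then show ?thesis using t0 by (simp add: field_simps del: power_Suc mult_Suc mult_Suc_right)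
    qed
    ultimately have "?t n ^ (14 * Suc k) / 2 \<le> real h * (S + C * ?t n ^ (12 * Suc k))" by (simp add: distrib_left)
    also have "\<dots> \<le> ?t n ^ Suc k * (S + C * ?t n ^ (12 * Suc k))"
    proof (rule mult_right_mono)
      have "real h \<le> real (g ^ n)" using h by linarith
      also have "\<dots> = ?t n ^ Suc k" using g by (intro tpar_power[symmetric]) auto
      finally show "real h \<le> ?t n ^ Suc k" .
    qed (use C(1) t0 in \<open>auto simp: S_def intro!: add_nonneg_nonneg\<close>)
    finally have "?t n ^ Suc k * (?t n ^ (13 * Suc k) / 2) \<le> ?t n ^ Suc k * (S + C * ?t n ^ (12 * Suc k))"
      by (simp add: power_add[symmetric] del: power_Suc)
    then have "?t n ^ (13 * Suc k) / 2 \<le> S + C * ?t n ^ (12 * Suc k)"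
      using t0 by (subst (asm) mult_le_cancel_left_pos) auto
    \<comment> \<open>The main term is half of t ^ (13 K); \<open>4 * C \<le> t\<close> holds the
      other characters to a quarter.\<close>
    moreover have "C * ?t n ^ (12 * Suc k) \<le> ?t n ^ (13 * Suc k) / 4"
    proof -
      have "4 * C \<le> ?t n ^ 1" using elim by simp
      also have "\<dots> \<le> ?t n ^ Suc k" using t1 by (intro power_increasing) auto
      finally have "4 * C * ?t n ^ (12 * Suc k) \<le> ?t n ^ Suc k * ?t n ^ (12 * Suc k)"
        using t0 by (intro mult_right_mono) auto
      also have "\<dots> = ?t n ^ (13 * Suc k)" by (simp add: power_add[symmetric] del: power_Suc)
      finally show ?thesis by simp
    qed
    ultimately show ?case unfolding S_def by linarith
  qed
qed

text \<open>The logarithms cost less than m powr (1/4). With exponent -3/4 left, the squares of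
  primes already give the convergent sum of p powr (-3/2), and higher powers form geometric
  series.\<close>

lemma summable_on_proper_prime_powers:
  "(\<lambda>m. ln (real m) ^ K / real m) summable_on {m. primepow m \<and> \<not> prime m}"
proof -
  have "(\<lambda>m::nat. ln (real m) ^ K / real m) \<in> O(\<lambda>m. real m powr (-3/4))" by real_asymp
  then obtain C where C: "C > 0" "\<forall>\<^sub>F m in sequentially. norm (ln (real m) ^ K / real m) \<le> C * norm (real m powr (-3/4))"
    by (auto elim!: landau_o.bigE)
  then obtain m0 where m0: "\<And>m. m \<ge> m0 \<Longrightarrow> norm (ln (real m) ^ K / real m) \<le> C * norm (real m powr (-3/4))"
    by (auto simp: eventually_at_top_linorder)
  let ?N = "{m::nat. primepow m \<and> \<not> prime m}"
  let ?T = "{(p, k). prime p \<and> k \<ge> (1::nat)} :: (nat \<times> nat) set"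
  have inj: "inj_on (\<lambda>(p, k). p ^ Suc k) ?T"
    using bij_betw_primepows[where 'a = nat] by (auto simp: bij_betw_def intro: inj_on_subset)
  have img: "(\<lambda>(p, k). p ^ Suc k) ` ?T = ?N"
  proof (intro equalityI subsetI)
    fix m assume "m \<in> (\<lambda>(p, k). p ^ Suc k) ` ?T"
    then obtain p k where "m = p ^ Suc k" "prime p" "k \<ge> 1" by auto
    then show "m \<in> ?N" using prime_power_iff[of p "Suc k"] by (auto intro!: primepow_prime_power simp del: power_Suc)
  next
    fix m assume m: "m \<in> ?N"
    then have "m \<in> (\<lambda>(p, k). p ^ Suc k) ` (Collect prime \<times> UNIV)"
      using bij_betw_imp_surj_on[OF bij_betw_primepows[where 'a = nat]] by blast
    then obtain p k where pk: "prime p" "m = p ^ Suc k" by (auto simp del: power_Suc)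
    moreover have "k \<ge> 1" using m pk by (cases k) auto
    ultimately show "m \<in> (\<lambda>(p, k). p ^ Suc k) ` ?T" by force
  qed
  \<comment> \<open>The double series is taken over all integers from 2 on; primes are selected only
    afterwards.\<close>
  have "(\<lambda>(p, k). (real p powr (-3/4)) ^ (k + 2)) summable_on ({2..} \<times> (UNIV :: nat set))"
  proof (rule summable_on_SigmaI)
    fix p :: nat assume p: "p \<in> {2..}"
    define r where "r = real p powr (-3/4)"
    have r: "0 < r" "r < 1" using p by (auto simp: r_def powr_less_one)
    have "(\<lambda>k. r ^ 2 * r ^ k) sums (r ^ 2 * (1 / (1 - r)))" using r by (intro sums_mult geometric_sums) auto
    then have "((\<lambda>k. r ^ (k + 2)) has_sum (r ^ 2 / (1 - r))) UNIV"
      using r by (intro sums_nonneg_imp_has_sum) (auto simp: power2_eq_square mult_ac)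
    then show "((\<lambda>k. case (p, k) of (p, k) \<Rightarrow> (real p powr (-3/4)) ^ (k + 2)) has_sum
        ((real p powr (-3/4)) ^ 2 / (1 - real p powr (-3/4)))) UNIV" by (simp add: r_def)
  next
    show "(\<lambda>p. (real p powr (-3/4)) ^ 2 / (1 - real p powr (-3/4))) summable_on {2..}"
    proof (rule summable_on_comparison_test)
      have "summable (\<lambda>p. norm (real p powr (-3/2) / (1 - 2 powr (-3/4))))"
        by (auto simp: summable_real_powr_iff intro!: summable_divide)
      then have "(\<lambda>p. real p powr (-3/2) / (1 - 2 powr (-3/4))) summable_on UNIV" by (rule norm_summable_imp_summable_on)
      then show "(\<lambda>p. real p powr (-3/2) / (1 - 2 powr (-3/4))) summable_on {2..}" by (rule summable_on_subset) simp
      fix p :: nat assume p: "p \<in> {2..}"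
      have r1: "real p powr (-3/4) \<le> 2 powr (-3/4)" using p by (intro powr_mono2') auto
      have r2: "(2::real) powr (-3/4) < 1" by (auto simp: powr_less_one)
      have "(real p powr (-3/4)) ^ 2 = real p powr (-3/2)"
        by (simp add: power2_eq_square powr_add[symmetric])
      then show "(real p powr (-3/4)) ^ 2 / (1 - real p powr (-3/4)) \<le> real p powr (-3/2) / (1 - 2 powr (-3/4))"
        using r1 r2 by (auto intro!: divide_left_mono mult_pos_pos)
      show "0 \<le> (real p powr (-3/4)) ^ 2 / (1 - real p powr (-3/4))" using r1 r2 by simp
    qed
  qed auto
  then have "(\<lambda>(p, k). (real p powr (-3/4)) ^ (k + 2)) summable_on ((\<lambda>(p, k). (p, k - 1)) ` ?T)"
    by (rule summable_on_subset) (auto simp: prime_ge_2_nat)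
  moreover have "inj_on (\<lambda>(p::nat, k::nat). (p, k - 1)) ?T" by (auto simp: inj_on_def)
  ultimately have "((\<lambda>(p, k). (real p powr (-3/4)) ^ (k + 2)) \<circ> (\<lambda>(p, k). (p, k - 1))) summable_on ?T"
    by (simp only: summable_on_reindex)
  also have "?this \<longleftrightarrow> ((\<lambda>m. real m powr (-3/4)) \<circ> (\<lambda>(p, k). p ^ Suc k)) summable_on ?T"
  proof (intro summable_on_cong)
    fix z assume "z \<in> ?T"
    then obtain p k where z: "z = (p, k)" "prime p" "k \<ge> 1" by auto
    have "p > 0" using z prime_gt_0_nat by blast
    have "(real p powr (-3/4)) ^ Suc k = real (p ^ Suc k) powr (-3/4)"
      using \<open>p > 0\<close> by (simp only: powr_realpow[symmetric] powr_powr of_nat_power powr_gt_zero of_nat_0_less_iff mult.commute)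
    then show "((\<lambda>(p, k). (real p powr (-3/4)) ^ (k + 2)) \<circ> (\<lambda>(p, k). (p, k - 1))) z =
        ((\<lambda>m. real m powr (-3/4)) \<circ> (\<lambda>(p, k). p ^ Suc k)) z"
      using z by (simp add: numeral_2_eq_2 del: power_Suc)
  qed
  also have "\<dots> \<longleftrightarrow> (\<lambda>m. real m powr (-3/4)) summable_on ?N"
    unfolding img[symmetric] by (rule summable_on_reindex[OF inj, symmetric])
  finally have S: "(\<lambda>m. real m powr (-3/4)) summable_on ?N" .
  have "(\<lambda>m. C * real m powr (-3/4)) summable_on (?N \<inter> {m0..})"
    using summable_on_subset[OF S, of "?N \<inter> {m0..}"] by (intro summable_on_cmult_right) auto
  then have "(\<lambda>m. ln (real m) ^ K / real m) summable_on (?N \<inter> {m0..})"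
  proof (rule summable_on_comparison_test)
    fix m assume m: "m \<in> ?N \<inter> {m0..}"
    have "ln (real m) ^ K / real m \<le> norm (ln (real m) ^ K / real m)" by (simp only: real_norm_def abs_ge_self)
    also have "\<dots> \<le> C * norm (real m powr (-3/4))" using m by (intro m0) auto
    finally show "ln (real m) ^ K / real m \<le> C * real m powr (-3/4)" by simp
    have "m \<ge> 1" using m primepow_gt_0_nat[of m] by auto
    then show "0 \<le> ln (real m) ^ K / real m" by simp
  qed
  moreover have "(\<lambda>m. ln (real m) ^ K / real m) summable_on (?N \<inter> {..<m0})" by (rule summable_on_finite) auto
  ultimately have "(\<lambda>m. ln (real m) ^ K / real m) summable_on (?N \<inter> {m0..} \<union> ?N \<inter> {..<m0})"
    by (rule summable_on_union)
  moreover have "?N \<inter> {m0..} \<union> ?N \<inter> {..<m0} = ?N" by auto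
  ultimately show ?thesis by simp
qed

text \<open>Otherwise the class contains, besides \<open>p\<close> and proper prime powers, only
  primes m with ln m > t ^ 15. Since \<delta> t ^ 15 = t, half of \<delta> yields a factor exp (- t
  / 2) for these, and the other half keeps the series convergent with a sum polynomial in t. The
  class sum would then stay below a constant, against its growth like t ^ (13 K).\<close>

lemma eventually_exists_prime_in_class:
  assumes g: "g \<ge> 2" and p: "prime p" "coprime p g"
  shows "\<forall>\<^sub>F n in sequentially. \<exists>r. prime r \<and> r \<noteq> p \<and> [r = p] (mod g ^ n) \<and> ln (real r) \<le> tpar g (Suc k) n ^ 15"
proof -
  let ?t = "tpar g (Suc k)" and ?d = "dpar g (Suc k)"
  define K where "K = Suc k"
  define N where "N = {m::nat. primepow m \<and> \<not> prime m}"
  define B where "B = infsum (\<lambda>m. ln (real m) ^ K / real m) N"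
  have NB: "((\<lambda>m. ln (real m) ^ K / real m) has_sum B) N"
    unfolding B_def N_def by (rule has_sum_infsum[OF summable_on_proper_prime_powers])
  note dt = dpar_at_right[OF g zero_less_Suc[of k]] and tt = tpar_at_top[OF g zero_less_Suc[of k]]
  have "\<forall>\<^sub>F \<delta> in at_right 0. \<delta> ^ (K + 1) * wt_sum K \<delta> < 2 * fact K"
    using wt_sum_scaled_tendsto[of K] by (rule order_tendstoD) simp
  moreover have "filterlim (\<lambda>n. ?d n / 2) (at_right 0) sequentially"
  proof -
    have "filterlim (\<lambda>x::real. x / 2) (at_right 0) (at_right 0)" by real_asymp
    from filterlim_compose[OF this dt] show ?thesis .
  qed
  ultimately have Z: "\<forall>\<^sub>F n in sequentially. (?d n / 2) ^ (K + 1) * wt_sum K (?d n / 2) < 2 * fact K"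
    by (rule eventually_compose_filterlim)
  \<comment> \<open>Contributions of \<open>p\<close> itself, of the proper prime powers, and at
    most 1 from the large primes.\<close>
  define c where "c = ln (real p) ^ K + B + 1"
  have "\<forall>\<^sub>F t::real in at_top. exp (- t / 2) * (2 * fact K * (2 * t ^ 14) ^ (K + 1)) < 1" by real_asymp
  from eventually_compose_filterlim[OF this tt]
  have T1: "\<forall>\<^sub>F n in sequentially. exp (- ?t n / 2) * (2 * fact K * (2 * ?t n ^ 14) ^ (K + 1)) < 1" .
  have "\<forall>\<^sub>F t::real in at_top. t ^ (13 * K) / 4 > c" unfolding K_def by real_asymp
  from eventually_compose_filterlim[OF this tt]
  have T2: "\<forall>\<^sub>F n in sequentially. ?t n ^ (13 * K) / 4 > c" .
  show ?thesis using Z T1 T2 eventually_residue_class_ge[OF g p(2), of k]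
  proof eventually_elim
    case (elim n)
    let ?D = "?d n" and ?q = "g ^ n"
    define X where "X = ?t n ^ 15"
    have t0: "?t n > 0" by (rule tpar_pos)
    have d0: "?D > 0" by (rule dpar_pos)
    show ?case
    proof (rule ccontr)
      assume no: "\<nexists>r. prime r \<and> r \<noteq> p \<and> [r = p] (mod ?q) \<and> ln (real r) \<le> ?t n ^ 15"
      let ?f = "\<lambda>m. mangoldt m * of_bool ([m = p] (mod ?q)) * complex_of_real (wt k ?D (real m))"
      define f1 where "f1 m = (if m = p then ln (real p) ^ K else 0)" for m
      define f2 where "f2 m = (if m \<in> N then ln (real m) ^ K / real m else 0)" for m
      define E where "E = exp (- ?t n / 2)"
      have h1: "(f1 has_sum ln (real p) ^ K) UNIV"
        unfolding f1_def by (rule has_sum_finite_neutralI[of "{p}"]) auto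
      have h2: "(f2 has_sum B) UNIV"
        using NB unfolding f2_def by (subst has_sum_cong_neutral[where g = "\<lambda>m. ln (real m) ^ K / real m" and T = N]) auto
      have h3: "((\<lambda>m. E * wt K (?D / 2) (real m)) has_sum E * wt_sum K (?D / 2)) UNIV"
        unfolding wt_sum_def using d0
        by (intro has_sum_cmult_right sums_nonneg_imp_has_sum summable_sums summable_wt wt_nonneg) auto
      have bound: "norm (?f m) \<le> f1 m + f2 m + E * wt K (?D / 2) (real m)" for m
      proof (cases "m = 0 \<or> \<not> primepow m \<or> \<not> [m = p] (mod ?q)")
        case True
        have "f1 m \<ge> 0" "f2 m \<ge> 0" unfolding f1_def f2_def N_def using p prime_gt_0_nat[of p] primepow_gt_0_nat[of m] by auto
        moreover have "E * wt K (?D / 2) (real m) \<ge> 0" unfolding E_def by (intro mult_nonneg_nonneg wt_nonneg) auto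
        moreover have "norm (?f m) = 0" using True by (auto simp: mangoldt_def)
        ultimately show ?thesis by linarith
      next
        case False
        then have m: "m > 0" "primepow m" "[m = p] (mod ?q)" by auto
        have "norm (?f m) \<le> wt K ?D (real m)" unfolding K_def by (rule norm_mangoldt_mult_wt_le) simp
        moreover have w: "wt K ?D (real m) \<le> ln (real m) ^ K / real m" using m d0 by (intro wt_le_ln_power) auto
        moreover have f0: "f1 m \<ge> 0" "f2 m \<ge> 0" unfolding f1_def f2_def using m p prime_gt_0_nat[of p] by auto
        moreover have e0: "E * wt K (?D / 2) (real m) \<ge> 0" unfolding E_def by (intro mult_nonneg_nonneg wt_nonneg) auto
        moreover consider "m \<in> N" | "m = p" | "prime m" "m \<noteq> p" using m unfolding N_def by blast
        then have "wt K ?D (real m) \<le> f1 m + f2 m + E * wt K (?D / 2) (real m)"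
        proof cases
          case 1
          then have "f2 m = ln (real m) ^ K / real m" by (simp add: f2_def)
          then show ?thesis using w f0 e0 by linarith
        next
          case 2
          have "ln (real m) ^ K / real m \<le> ln (real m) ^ K / 1" using m by (intro divide_left_mono) auto
          then have "f1 m \<ge> ln (real m) ^ K / real m" using 2 by (simp add: f1_def)
          then show ?thesis using w f0 e0 by linarith
        next
          case 3
          then have "\<not> ln (real m) \<le> ?t n ^ 15" using no m(3) by blast
          then have "ln (real m) > X" unfolding X_def by simp
          then have "?D * ln (real m) / 2 \<ge> ?D * X / 2" using d0 by simp
          moreover have "?D * X = ?t n" unfolding X_def dpar_def using t0 by (simp add: field_simps flip: power_Suc)
          ultimately have *: "- (?D / 2) * ln (real m) \<le> - ?t n / 2" by simp
          have e: "-1 - ?D = - (?D / 2) + (-1 - ?D / 2)" by simp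
          have "real m powr (-1 - ?D) = real m powr (- (?D / 2)) * real m powr (-1 - ?D / 2)"
            by (subst e) (rule powr_add)
          also have "real m powr (- (?D / 2)) \<le> E" unfolding E_def powr_def using m * by simp
          finally have "real m powr (-1 - ?D) \<le> E * real m powr (-1 - ?D / 2)" by (simp add: mult_right_mono)
          then have "ln (real m) ^ K * real m powr (-1 - ?D) \<le> ln (real m) ^ K * (E * real m powr (-1 - ?D / 2))"
            using m by (intro mult_left_mono) auto
          then have "wt K ?D (real m) \<le> E * wt K (?D / 2) (real m)"
            unfolding wt_def by (simp only: mult.left_commute)
          then show ?thesis using f0 by linarith
        qed
        ultimately show ?thesis by linarith
      qed
      have f: "(?f has_sum dser (\<lambda>m. mangoldt m * of_bool ([m = p] (mod ?q))) k ?D) UNIV"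
        using d0 by (intro dser_mangoldt_has_sum) auto
      have tot: "((\<lambda>m. f1 m + f2 m + E * wt K (?D / 2) (real m)) has_sum
          (ln (real p) ^ K + B + E * wt_sum K (?D / 2))) UNIV"
        by (intro has_sum_add h1 h2 h3)
      have ab: "(\<lambda>m. norm (?f m)) summable_on UNIV"
        using f by (simp add: summable_on_iff_abs_summable_on_complex[symmetric] has_sum_imp_summable)
      have "norm (dser (\<lambda>m. mangoldt m * of_bool ([m = p] (mod ?q))) k ?D) \<le> infsum (\<lambda>m. norm (?f m)) UNIV"
        by (rule norm_has_sum_bound[OF has_sum_infsum[OF ab] f])
      also have "\<dots> \<le> ln (real p) ^ K + B + E * wt_sum K (?D / 2)"
        by (rule has_sum_mono[OF has_sum_infsum[OF ab] tot]) (use bound in auto)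
      also have "E * wt_sum K (?D / 2) \<le> E * (2 * fact K * (2 * ?t n ^ 14) ^ (K + 1))"
      proof (rule mult_left_mono)
        have e: "?D / 2 = 1 / (2 * ?t n ^ 14)" by (simp add: dpar_def)
        have pos: "(2 * ?t n ^ 14) ^ (K + 1) > 0" using t0 by (intro zero_less_power mult_pos_pos) auto
        have "wt_sum K (?D / 2) / (2 * ?t n ^ 14) ^ (K + 1) < 2 * fact K"
          using elim(1) unfolding e power_one_over by (simp only: times_divide_eq_left mult_1)
        then show "wt_sum K (?D / 2) \<le> 2 * fact K * (2 * ?t n ^ 14) ^ (K + 1)"
          unfolding pos_divide_less_eq[OF pos] by (rule less_imp_le)
      qed (simp add: E_def)
      also have "\<dots> < 1" using elim(2) unfolding E_def .
      finally have "norm (dser (\<lambda>m. mangoldt m * of_bool ([m = p] (mod ?q))) k ?D) < c" unfolding c_def by simp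
      then show False using elim(3,4) unfolding K_def by linarith
    qed
  qed
qed

section \<open>The digit sequence\<close>

lemma exists_next_prime:
  fixes g p b :: nat
  assumes g: "g \<ge> 2" and p: "prime p" "coprime p g"
  shows "\<exists>n r l. n \<ge> b \<and> n < l \<and> prime r \<and> r \<noteq> p \<and> [r = p] (mod g ^ n) \<and> r < g ^ l \<and> ln (real l) \<le> real n / 4"
proof -
  \<comment> \<open>Chosen so that t ^ 15 = exp (a n) with a = 15 ln g / (k + 1) < 1/4; the room
    below exp (n / 4) absorbs the terms added to the length.\<close>
  define k where "k = nat \<lceil>60 * ln (real g)\<rceil>"
  have lg: "ln (real g) > 0" using g by simp
  define a where "a = 15 * ln (real g) / real (Suc k)"
  have "60 * ln (real g) < real (Suc k)" unfolding k_def by linarith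
  then have a: "0 < a" "a < 1 / 4" using lg by (auto simp: a_def field_simps)
  have t15: "tpar g (Suc k) n ^ 15 = exp (a * real n)" for n
    by (simp add: tpar_def a_def exp_of_nat_mult[symmetric] field_simps)
  have "\<forall>\<^sub>F n in sequentially. exp (a * real n) / ln (real g) + real n + 3 \<le> exp (real n / 4)"
    using a lg by real_asymp
  then have "\<forall>\<^sub>F n in sequentially. (exp (a * real n) / ln (real g) + real n + 3 \<le> exp (real n / 4)) \<and> n \<ge> b \<and>
     (\<exists>r. prime r \<and> r \<noteq> p \<and> [r = p] (mod g ^ n) \<and> ln (real r) \<le> exp (a * real n))"
    using eventually_exists_prime_in_class[OF g p, of k, unfolded t15] eventually_ge_at_top[of b] by eventually_elim auto
  then obtain n r where n: "exp (a * real n) / ln (real g) + real n + 3 \<le> exp (real n / 4)" "n \<ge> b"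
    and r: "prime r" "r \<noteq> p" "[r = p] (mod g ^ n)" "ln (real r) \<le> exp (a * real n)"
    using eventually_happens'[OF sequentially_bot] by blast
  define T where "T = exp (a * real n) / ln (real g)"
  \<comment> \<open>The floor plus 2 exceeds \<open>T\<close>, which bounds ln r / ln g; adding
    \<open>n\<close> makes the length exceed \<open>n\<close>.\<close>
  define l where "l = nat \<lfloor>T\<rfloor> + n + 2"
  have "T \<ge> 0" unfolding T_def using lg by simp
  then have l: "T < real l" "real l \<le> T + real n + 3" "n < l" unfolding l_def by (linarith, linarith, simp)
  have "ln (real r) \<le> T * ln (real g)" using r(4) lg by (simp add: T_def)
  also have "\<dots> < real l * ln (real g)" using l lg by (intro mult_strict_right_mono) auto
  also have "\<dots> = ln (real (g ^ l))" using g by (simp add: ln_realpow)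
  finally have "real r < real (g ^ l)" using r(1) prime_gt_0_nat[of r] g by (subst (asm) ln_less_cancel_iff) auto
  then have "r < g ^ l" by linarith
  moreover have "ln (real l) \<le> real n / 4"
  proof -
    have "ln (real l) \<le> ln (exp (real n / 4))" using l n(1) unfolding T_def by (intro ln_mono) auto
    then show ?thesis by simp
  qed
  ultimately show ?thesis using n r l by blast
qed

text \<open>Dependent choice. The invariant \<open>Q\<close> also carries coprimality to
  \<open>g\<close>, without which a prime could not be continued.\<close>

lemma exists_prime_chain:
  fixes g :: nat
  assumes g: "g \<ge> 2"
  shows "\<exists>P l n :: nat \<Rightarrow> nat. (\<forall>k. prime (P k) \<and> P k < g ^ l k \<and> 1 \<le> l k \<and> 2 * l k \<le> n k \<and> n k < l (Suc k) \<and>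
    P (Suc k) \<noteq> P k \<and> [P (Suc k) = P k] (mod g ^ n k) \<and> ln (real (l (Suc k))) \<le> real (n k) / 4)"
proof -
  define Q where "Q = (\<lambda>(_::nat) (p, l). prime p \<and> coprime p g \<and> p < g ^ l \<and> (1::nat) \<le> l)"
  define R where "R = (\<lambda>(_::nat) (p, l) (p', l'). \<exists>n. 2 * l \<le> n \<and> n < l' \<and> p' \<noteq> p \<and> [p' = p] (mod g ^ n) \<and> ln (real l') \<le> real n / 4)"
  have "\<exists>f. \<forall>k. Q k (f k) \<and> R k (f k) (f (Suc k))"
  proof (rule dependent_nat_choice)
    \<comment> \<open>A prime above \<open>g\<close> is coprime to \<open>g\<close>, and
      \<open>p < g ^ p\<close> makes \<open>p\<close> itself an admissible length.\<close>
    obtain p where p: "prime p" "p > g" using bigger_prime by blast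
    have "coprime p g" using p g prime_imp_coprime_nat[of p g] dvd_imp_le[of p g] by force
    moreover have "p < g ^ p" using g less_exp[of p] power_mono[of 2 g p] by (meson less_le_trans zero_le)
    moreover have "1 \<le> p" using p by simp
    ultimately have "Q 0 (p, p)" using p unfolding Q_def by simp
    then show "\<exists>x. Q 0 x" by blast
  next
    fix x k assume x: "Q k x"
    obtain p l where xpl: "x = (p, l)" by force
    have p: "prime p" "coprime p g" "p < g ^ l" "1 \<le> l" using x unfolding Q_def xpl by auto
    obtain n r l' where *: "n \<ge> 2 * l" "n < l'" "prime r" "r \<noteq> p" "[r = p] (mod g ^ n)" "r < g ^ l'" "ln (real l') \<le> real n / 4"
      using exists_next_prime[OF g p(1,2), of "2 * l"] by blast
    have "coprime r g"
    proof -
      have "[p = r] (mod g)" using * p by (intro cong_dvd_modulus_nat[OF cong_sym[OF *(5)]] dvd_power) auto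
      then show ?thesis using p cong_imp_coprime by blast
    qed
    then have "Q (Suc k) (r, l')" using * unfolding Q_def by auto
    moreover have "R k x (r, l')" using * unfolding R_def xpl by auto
    ultimately show "\<exists>y. Q (Suc k) y \<and> R k x y" by blast
  qed
  then obtain f where f: "\<And>k. Q k (f k)" "\<And>k. R k (f k) (f (Suc k))" by blast
  define P l where "P k = fst (f k)" and "l k = snd (f k)" for k
  have Q: "prime (P k) \<and> P k < g ^ l k \<and> 1 \<le> l k" for k
    using f(1)[of k] unfolding Q_def P_def l_def by (auto simp: case_prod_beta)
  have "\<forall>k. \<exists>n. 2 * l k \<le> n \<and> n < l (Suc k) \<and> P (Suc k) \<noteq> P k \<and> [P (Suc k) = P k] (mod g ^ n) \<and> ln (real (l (Suc k))) \<le> real n / 4"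
    using f(2) unfolding R_def P_def l_def by (auto simp: case_prod_beta)
  then obtain n where "\<And>k. 2 * l k \<le> n k \<and> n k < l (Suc k) \<and> P (Suc k) \<noteq> P k \<and> [P (Suc k) = P k] (mod g ^ n k) \<and> ln (real (l (Suc k))) \<le> real (n k) / 4"
    by metis
  with Q show ?thesis by blast
qed

lemma digit_trunc_eq_mod:
  assumes "\<And>i. i < m \<Longrightarrow> d i = (x div g ^ i) mod g"
  shows "digit_trunc d g m = x mod g ^ m"
  using assms
proof (induction m)
  case (Suc m)
  have "x mod (g ^ m * g) = g ^ m * (x div g ^ m mod g) + x mod g ^ m" by (rule mod_mult2_eq)
  then show ?case using Suc by (simp add: digit_trunc_def mult_ac)
qed (simp add: digit_trunc_def)

lemma digit_cong:
  assumes "[x = y] (mod g ^ Suc i)"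
  shows "(x div g ^ i) mod g = (y div g ^ i) mod (g::nat)"
proof (cases "g = 0")
  case False
  have "(z div g ^ i) mod g = (z mod g ^ Suc i) div g ^ i" for z
    using False by (simp add: mod_mult2_eq mult.commute[of g])
  then show ?thesis using assms unfolding Cong.cong_def by simp
next
  case True
  then show ?thesis using assms by (cases i) (auto simp: Cong.cong_def)
qed

theorem theorem2p1:
  fixes g :: nat
  assumes "g \<ge> 2"
  shows "\<exists>d :: nat \<Rightarrow> nat.
    (\<forall>i. d i \<in> {0..g - 1}) \<and>
    infinite {i. d i \<noteq> 0} \<and>
    (\<exists>\<epsilon> :: nat \<Rightarrow> real. \<epsilon> \<longlonglongrightarrow> 0 \<and>
      (\<forall>\<^sub>F N in sequentially.
        real (prime_trunc_count d g N) \<ge> (1 / ln (12 / 5) + \<epsilon> N) * ln (real N)))"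
proof -
  obtain P l n :: "nat \<Rightarrow> nat" where
    chain: "\<And>k. prime (P k) \<and> P k < g ^ l k \<and> 1 \<le> l k \<and> 2 * l k \<le> n k \<and> n k < l (Suc k) \<and>
      P (Suc k) \<noteq> P k \<and> [P (Suc k) = P k] (mod g ^ n k) \<and> ln (real (l (Suc k))) \<le> real (n k) / 4"
    using exists_prime_chain[OF assms] by blast
  \<comment> \<open>Digit \<open>i\<close> can be read off \<open>P i\<close> because
    \<open>n i > i\<close>: all later primes agree with \<open>P i\<close> modulo
    \<open>g ^ Suc i\<close>.\<close>
  define d where "d i = (P i div g ^ i) mod g" for i
  have l_ge: "l k > k" for k
  proof (induction k)
    case 0
    show ?case using chain[of 0] by linarith
  next
    case (Suc k)
    show ?case using Suc chain[of k] by linarith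
  qed
  have n_gt: "n k > k" for k using l_ge[of k] chain[of k] by linarith
  have n_mono: "n j \<le> n k" if "j \<le> k" for j k
    using that
  proof (induction k rule: dec_induct)
    case (step k)
    then show ?case using chain[of k] chain[of "Suc k"] by linarith
  qed simp
  have P_cong: "[P k = P j] (mod g ^ M)" if "j \<le> k" "M \<le> n j" for j k M
    using that(1)
  proof (induction k rule: dec_induct)
    case (step k)
    have "M \<le> n k" using n_mono[OF step.hyps(1)] that by linarith
    then have "[P (Suc k) = P k] (mod g ^ M)"
      using chain[of k] by (meson cong_dvd_modulus_nat le_imp_power_dvd)
    then show ?case using step.IH by (rule cong_trans)
  qed simp
  have trunc: "digit_trunc d g m = P k mod g ^ m" if "m \<le> n k" for m k
  proof (rule digit_trunc_eq_mod)
    fix i assume i: "i < m"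
    have "[P i = P k] (mod g ^ Suc i)"
    proof (cases "i \<le> k")
      case True
      show ?thesis by (rule cong_sym, rule P_cong[OF True]) (use n_gt[of i] in linarith)
    next
      case False
      show ?thesis by (rule P_cong) (use False i that in linarith)+
    qed
    then show "d i = P k div g ^ i mod g" unfolding d_def by (rule digit_cong)
  qed
  have truncP: "digit_trunc d g m = P k" if "l k \<le> m" "m \<le> n k" for m k
  proof -
    have "P k < g ^ l k" using chain by blast
    also have "g ^ l k \<le> g ^ m" using that assms by (intro power_increasing) auto
    finally show ?thesis using trunc[OF that(2)] by simp
  qed
  \<comment> \<open>If the digits vanished from \<open>I\<close> on, the truncations would be
    constant there, although they take the distinct values \<open>P I\<close> and
    \<open>P (Suc I)\<close>.\<close>
  have inf: "infinite {i. d i \<noteq> 0}"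
  proof
    assume "finite {i. d i \<noteq> 0}"
    then obtain I where I: "\<And>i. d i \<noteq> 0 \<Longrightarrow> i < I" using finite_nat_set_iff_bounded[of "{i. d i \<noteq> 0}"] by blast
    have zero: "d i = 0" if "i \<ge> I" for i using I[of i] that by linarith
    have const: "digit_trunc d g m = digit_trunc d g I" if "m \<ge> I" for m
      unfolding digit_trunc_def using that by (intro sum.mono_neutral_right) (auto simp: zero)
    have "P I = digit_trunc d g (l I)" using chain[of I] by (intro truncP[symmetric]) auto
    also have "\<dots> = digit_trunc d g (l (Suc I))" using const[of "l I"] const[of "l (Suc I)"] l_ge[of I] l_ge[of "Suc I"] by simp
    also have "\<dots> = P (Suc I)" using chain[of "Suc I"] by (intro truncP) auto
    finally show False using chain[of I] by simp
  qed
  have count: "real (prime_trunc_count d g N) \<ge> 2 * ln (real N)" if "N \<ge> l 1" for N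
  proof -
    \<comment> \<open>The last block that has started by \<open>N\<close> is number
      \<open>Suc k\<close>; starting from \<open>l 1\<close> guarantees that block \<open>k\<close>
      precedes it.\<close>
    define k where "k = Greatest (\<lambda>k. l (Suc k) \<le> N)"
    have bd: "k \<le> N" if "l (Suc k) \<le> N" for k using l_ge[of "Suc k"] that by linarith
    have k1: "l (Suc k) \<le> N"
      unfolding k_def using that by (intro GreatestI_nat[of "\<lambda>k. l (Suc k) \<le> N" 0 N, OF _ bd]) simp
    have k2: "N < l (Suc (Suc k))"
    proof (rule ccontr)
      assume "\<not> N < l (Suc (Suc k))"
      then have "Suc k \<le> k"
        using Greatest_le_nat[of "\<lambda>k. l (Suc k) \<le> N" "Suc k" N, OF _ bd] unfolding k_def[symmetric] by linarith
      then show False by simp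
    qed
    let ?S = "{m \<in> {1..N}. prime (digit_trunc d g m)}"
    have fin: "finite ?S" by simp
    have sub: "{l j..n j} \<inter> {..N} \<subseteq> ?S" for j
      using truncP[of j] chain[of j] by auto
    show ?thesis
    proof (cases "N \<le> n (Suc k)")
      \<comment> \<open>The block \<open>Suc k\<close> is complete, and its length pays for the
        logarithm of \<open>l (Suc (Suc k))\<close>, which exceeds \<open>N\<close>.\<close>
      case False
      have "{l (Suc k)..n (Suc k)} \<subseteq> ?S" using sub[of "Suc k"] False by auto
      from card_mono[OF fin this] have "n (Suc k) + 1 - l (Suc k) \<le> prime_trunc_count d g N" by (simp add: prime_trunc_count_def)
      then have "real (n (Suc k)) / 2 \<le> real (prime_trunc_count d g N)" using chain[of "Suc k"] by linarith
      moreover have "2 * ln (real N) \<le> real (n (Suc k)) / 2"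
      proof -
        have "ln (real N) \<le> ln (real (l (Suc (Suc k))))" using k1 k2 l_ge[of "Suc k"] by (intro ln_mono) auto
        then show ?thesis using chain[of "Suc k"] by linarith
      qed
      ultimately show ?thesis by linarith
    next
      case True
      have "{l k..n k} \<union> {l (Suc k)..N} \<subseteq> ?S"
        using sub[of k] sub[of "Suc k"] True chain[of k] k1 by auto
      moreover have "card ({l k..n k} \<union> {l (Suc k)..N}) = (n k + 1 - l k) + (N + 1 - l (Suc k))"
        using chain[of k] by (subst card_Un_disjoint) auto
      ultimately have "(n k + 1 - l k) + (N + 1 - l (Suc k)) \<le> prime_trunc_count d g N"
        using card_mono[OF fin, of "{l k..n k} \<union> {l (Suc k)..N}"] by (simp add: prime_trunc_count_def)
      then have 1: "real (n k) / 2 + (real N - real (l (Suc k))) \<le> real (prime_trunc_count d g N)"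
        using chain[of k] k1 by linarith
      define L where "L = real (l (Suc k))"
      \<comment> \<open>The complete block \<open>k\<close> pays for 2 ln L. Beyond L \<ge> 2 the
        function 2 ln has slope at most 1, so each further length in the current block pays for its
        own increase.\<close>
      have L: "2 \<le> L" "L \<le> real N" using l_ge[of "Suc k"] k1 unfolding L_def by linarith+
      have "ln (real N) - ln L = ln (real N / L)" using L by (simp add: ln_div)
      also have "\<dots> \<le> real N / L - 1" using L by (intro ln_le_minus_one) auto
      also have "\<dots> = (real N - L) / L" using L by (simp add: field_simps)
      also have "\<dots> \<le> (real N - L) / 2" using L by (intro divide_left_mono) auto
      finally have "2 * ln (real N) \<le> 2 * ln L + (real N - L)" by (simp add: field_simps)
      moreover have "2 * ln L \<le> real (n k) / 2" using chain[of k] unfolding L_def by linarith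
      ultimately show ?thesis using 1 unfolding L_def by linarith
    qed
  qed
  \<comment> \<open>From e \<le> 3 < (12/5) squared one gets ln (12/5) \<ge> 1/2, so the required
    constant is at most 2.\<close>
  have "exp (1 / 2 :: real) ^ 2 \<le> (12 / 5) ^ 2"
  proof -
    have "exp (1 / 2 :: real) ^ 2 = exp 1" by (simp flip: exp_of_nat_mult)
    then show ?thesis using exp_le by (simp add: power2_eq_square)
  qed
  then have "exp (1 / 2 :: real) \<le> 12 / 5" by (rule power2_le_imp_le) simp
  then have ln: "ln (12 / 5 :: real) \<ge> 1 / 2" by (subst ln_ge_iff) auto
  have "\<forall>\<^sub>F N in sequentially. real (prime_trunc_count d g N) \<ge> (1 / ln (12 / 5) + 0) * ln (real N)"
    using eventually_ge_at_top[of "l 1"]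
  proof eventually_elim
    case (elim N)
    have "1 / ln (12 / 5 :: real) \<le> 2" using ln by (simp add: field_simps)
    then have "(1 / ln (12 / 5) + 0) * ln (real N) \<le> 2 * ln (real N)"
      using l_ge[of 1] elim by (intro mult_right_mono) auto
    then show ?case using count[OF elim] by linarith
  qed
  moreover have "d i \<in> {0..g - 1}" for i
  proof -
    have "d i < g" unfolding d_def using assms by simp
    then show ?thesis by auto
  qed
  ultimately show ?thesis using inf by (intro exI[of _ d] conjI exI[of _ "\<lambda>_. 0"]) auto
qed

end
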